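(* Let $\Omega\subseteq\mathbb{R}^N$ satisfy the standing assumptions below and suppose \[ \lambda_1(\Omega)<\mathcal{E}(\Omega):=\min\{\lambda_1(E_1),\dots,\lambda_1(E_k)\}. \] Then the infimum defining $\lambda_1(\Omega)$ is attained: there exists $u_1\in\mathcal{S}_2(\Omega)$ with $u_1\ge0$ and $\int_\Omega|\nabla u_1|^2dx=\lambda_1(\Omega)$, and $u_1$ satisfies $\int_\Omega\langle\nabla u_1,\nabla\varphi\rangle dx=\lambda_1(\Omega)\int_\Omega u_1\varphi\,dx$ for all $\varphi\in W^{1,2}_0(\Omega)$. Moreover, if $\Omega$ is connected, every other minimizer (first eigenfunction) is a constant multiple of $u_1$.
   Context: Standing assumptions: $N\ge2$ and $\Omega=\Omega_0\cup\bigcup_{i=1}^k\mathcal{C}_i$ with $k\ge1$, where (A1) $\Omega_0\subseteq\mathbb{R}^N$ is a bounded open set (possibly empty); (A2) for each $i$, $\mathcal{C}_i=\mathbf{R}_i(E_i\times(0,+\infty))+\mathbf{t}_i$, where $E_i\subseteq\mathbb{R}^{N-1}$ is open, bounded and connected, $\mathbf{R}_i$ is an $N\times N$ orthogonal matrix and $\mathbf{t}_i\in\mathbb{R}^N$; (A3) there is $\varrho_0>0$ with $(\mathcal{C}_i\cap\mathcal{C}_j)\setminus B_{\varrho_0}(0)=\emptyset$ for $i\neq j$. $W^{1,2}_0(\Omega)$ is the closure of $C^\infty_0(\Omega)$ in $W^{1,2}(\Omega)$, $\mathcal{S}_2(\Omega)=\{\varphi\in W^{1,2}_0(\Omega):\|\varphi\|_{L^2(\Omega)}=1\}$.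 For an open set $A\subseteq\mathbb{R}^d$, $\lambda_1(A)=\inf\{\int_A|\nabla\varphi|^2:\varphi\in W^{1,2}_0(A),\ \|\varphi\|_{L^2(A)}=1\}$. *)

theory Defs
  imports "HOL-Analysis.Analysis"
begin

(* C^\<infinity>(R^d): f is differentiable everywhere and every first-order partial
   derivative is again C^\<infinity>.  (Greatest fixed point = all iterated partial
   derivatives exist everywhere.) *)
coinductive smooth_fun :: "('b::euclidean_space \<Rightarrow> real) \<Rightarrow> bool" where
  "(\<forall>x. f differentiable (at x)) \<Longrightarrow>
   (\<forall>b\<in>Basis. smooth_fun (\<lambda>x. frechet_derivative f (at x) b)) \<Longrightarrow> smooth_fun f"

definition test_fun :: "'b::euclidean_space set \<Rightarrow> ('b \<Rightarrow> real) \<Rightarrow> bool" where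
  "test_fun A \<phi> \<longleftrightarrow> smooth_fun \<phi> \<and> compact (closure {x. \<phi> x \<noteq> 0})
      \<and> closure {x. \<phi> x \<noteq> 0} \<subseteq> A"

definition cgrad :: "('b::euclidean_space \<Rightarrow> real) \<Rightarrow> 'b \<Rightarrow> 'b" where
  "cgrad \<phi> x = (\<Sum>b\<in>Basis. frechet_derivative \<phi> (at x) b *\<^sub>R b)"

definition L2 :: "'b::euclidean_space set \<Rightarrow> ('b \<Rightarrow> 'c::euclidean_space) \<Rightarrow> bool" where
  "L2 A u \<longleftrightarrow> u \<in> borel_measurable (lebesgue_on A)
      \<and> integrable (lebesgue_on A) (\<lambda>x. (norm (u x))\<^sup>2)"

definition is_weak_grad :: "'b::euclidean_space set \<Rightarrow> ('b \<Rightarrow> real) \<Rightarrow> ('b \<Rightarrow> 'b) \<Rightarrow> bool" where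
  "is_weak_grad A u g \<longleftrightarrow>
     u \<in> borel_measurable (lebesgue_on A) \<and> g \<in> borel_measurable (lebesgue_on A) \<and>
     (\<forall>K. compact K \<and> K \<subseteq> A \<longrightarrow> set_integrable lebesgue K u \<and> set_integrable lebesgue K g) \<and>
     (\<forall>\<phi>. test_fun A \<phi> \<longrightarrow> (\<forall>b\<in>Basis.
        (\<integral>x. u x * (cgrad \<phi> x \<bullet> b) \<partial>lebesgue_on A)
          = - (\<integral>x. (g x \<bullet> b) * \<phi> x \<partial>lebesgue_on A)))"

definition wgrad :: "'b::euclidean_space set \<Rightarrow> ('b \<Rightarrow> real) \<Rightarrow> 'b \<Rightarrow> 'b" where
  "wgrad A u = (SOME g. is_weak_grad A u g)"

definition W12 :: "'b::euclidean_space set \<Rightarrow> ('b \<Rightarrow> real) \<Rightarrow> bool" where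
  "W12 A u \<longleftrightarrow> L2 A u \<and> (\<exists>g. is_weak_grad A u g \<and> L2 A g)"

definition W12_0 :: "'b::euclidean_space set \<Rightarrow> ('b \<Rightarrow> real) \<Rightarrow> bool" where
  "W12_0 A u \<longleftrightarrow> W12 A u \<and>
     (\<exists>\<phi>::nat \<Rightarrow> 'b \<Rightarrow> real. (\<forall>n. test_fun A (\<phi> n)) \<and>
        (\<lambda>n. (\<integral>x. (u x - \<phi> n x)\<^sup>2 \<partial>lebesgue_on A)
            + (\<integral>x. (norm (wgrad A u x - cgrad (\<phi> n) x))\<^sup>2 \<partial>lebesgue_on A))
        \<longlonglongrightarrow> 0)"

definition S2 :: "'b::euclidean_space set \<Rightarrow> ('b \<Rightarrow> real) \<Rightarrow> bool" where
  "S2 A u \<longleftrightarrow> W12_0 A u \<and> (\<integral>x. (u x)\<^sup>2 \<partial>lebesgue_on A) = 1"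

definition dirichlet :: "'b::euclidean_space set \<Rightarrow> ('b \<Rightarrow> real) \<Rightarrow> real" where
  "dirichlet A u = (\<integral>x. (norm (wgrad A u x))\<^sup>2 \<partial>lebesgue_on A)"

(* first Dirichlet eigenvalue, as an extended real (Inf of the empty set = +\<infinity>) *)
definition lambda1 :: "'b::euclidean_space set \<Rightarrow> ereal" where
  "lambda1 A = Inf {ereal (dirichlet A \<phi>) | \<phi>. S2 A \<phi>}"

(* the half-cylinder R(E \<times> (0,\<infinity>)) + t  in  R^N = R^{N-1} \<times> R *)
definition cyl :: "'a::euclidean_space set \<Rightarrow> ('a \<times> real \<Rightarrow> 'a \<times> real) \<Rightarrow> 'a \<times> real
                    \<Rightarrow> ('a \<times> real) set" where
  "cyl E R t = (\<lambda>x. R x + t) ` (E \<times> {0<..})"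

end

theory Submission
  imports Defs "HOL-Complex_Analysis.Great_Picard" "HOL-Real_Asymp.Real_Asymp"
begin

text \<open>
  \<^bold>\<open>Existence.\<close> Everything is done with test functions. In the ends of $\Omega$ the Dirichlet form is bounded below by
  some $\mu>\lambda_1(\Omega)$: restrict to a half-cylinder, slice along the axis and use $\lambda_1(E_i)>\mu$ on each slice.
  An IMS localization $\chi^2+\eta^2=1$ with $|\nabla\chi|^2+|\nabla\eta|^2=O(R^{-2})$ then shows that a minimizing sequence is
  tight, and with Rellich's theorem on balls a subsequence converges in $L^2$. Since $\lambda_1$ is an infimum, the
  parallelogram law upgrades this to convergence in $W^{1,2}$. Replacing $\varphi$ by
  $\sqrt{\varphi^2+\delta^2}-\delta$ makes the sequence nonnegative; the same device shows that the eigenspace is closed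
  under absolute values, without a chain rule for Sobolev functions.

  \<^bold>\<open>Simplicity.\<close> A nonnegative eigenfunction $w$ is weakly superharmonic, so its averages against a suitable family of
  rescaled bumps $\kappa_s$ decrease in $s$. As $s\to 0$ they converge to a multiple of $w$ in $L^2$; hence if $w$ vanishes on a
  set of positive measure in a small ball, it vanishes on that ball, and by connectedness everywhere. For an eigenfunction $v$
  and $c=\langle v,u_1\rangle$ the eigenfunction $w=v-cu_1$ therefore has a sign, while $\int w u_1=0$ and $u_1>0$; so $w=0$.
\<close>

section \<open>Smooth functions\<close>

text \<open>The weak gradient of the statement is a choice among functions that agree almost
  everywhere, and its integrals are taken over Lebesgue measure on the domain, whereas translations,
  slices and rotations act on the whole space. The work is therefore done with
  \<open>h10_pair\<close>: a function and a gradient, Borel and extended by zero, that are limits of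
  the same test functions. \<open>wgrad\<close> occurs only where results are translated. Test
  functions suit the lower bound in the ends, since every slice of one is again a test function.
  Eigenfunctions are handled as the functions for which L |u|^2 <= |grad u|^2, in integrated form,
  is an equality. A variation turns this into the weak equation, and unlike the equation it is
  easily checked for limits and absolute values. In the maximum principle W has no pointwise values,
  so a mean value inequality cannot simply be evaluated at a zero. A translation estimate replaces
  this: means of radius s differ from a multiple of W by O(s) in L^2, and the zero set enters
  through its measure.\<close>

primrec Ck :: "nat \<Rightarrow> ('b::euclidean_space \<Rightarrow> real) \<Rightarrow> bool" where
  "Ck 0 f \<longleftrightarrow> True"
| "Ck (Suc n) f \<longleftrightarrow> (\<forall>x. f differentiable (at x)) \<and>
     (\<forall>b\<in>Basis. Ck n (\<lambda>x. frechet_derivative f (at x) b))"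

text \<open>Differentiating a product or a composition leaves a sum of products, so a direct
  coinduction would need an invariant closed under all these operations. Through the finite orders
  each closure property becomes an induction on n over arbitrary functions.\<close>

lemma smooth_fun_iff_Ck: "smooth_fun f \<longleftrightarrow> (\<forall>n. Ck n f)"
proof
  assume "smooth_fun f"
  then show "\<forall>n. Ck n f"
  proof -
    have "smooth_fun f \<Longrightarrow> Ck n f" for n and f :: "'a \<Rightarrow> real"
    proof (induction n arbitrary: f)
      case (Suc n)
      from Suc.prems show ?case
        by (cases rule: smooth_fun.cases) (use Suc.IH in auto)
    qed simp
    with \<open>smooth_fun f\<close> show ?thesis by blast
  qed
next
  assume "\<forall>n. Ck n f"
  then show "smooth_fun f"
  proof (coinduction arbitrary: f)
    case (smooth_fun f)
    then have "Ck (Suc n) f" for n by blast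
    then show ?case by auto
  qed
qed

lemma Ck_SucI:
  assumes "\<And>x. (f has_derivative f' x) (at x)"
    and "\<And>b. b \<in> Basis \<Longrightarrow> Ck n (\<lambda>x. f' x b)"
  shows "Ck (Suc n) f"
proof -
  have "frechet_derivative f (at x) = f' x" for x
    using assms(1) frechet_derivative_at by metis
  then show ?thesis using assms by (auto simp: differentiable_def)
qed

lemma Ck_SucD:
  assumes "Ck (Suc n) f"
  shows "(f has_derivative frechet_derivative f (at x)) (at x)"
    and "b \<in> Basis \<Longrightarrow> Ck n (\<lambda>x. frechet_derivative f (at x) b)"
  using assms by (auto simp: frechet_derivative_works)

lemma Ck_Suc_imp: "Ck (Suc n) f \<Longrightarrow> Ck n f"
proof (induction n arbitrary: f)
  case (Suc n)
  show ?case
    by (rule Ck_SucI[OF Ck_SucD(1)[OF Suc.prems]]) (use Suc in auto)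
qed simp

lemma Ck_const: "Ck n (\<lambda>x. c)"
proof (induction n arbitrary: c)
  case (Suc n)
  show ?case by (rule Ck_SucI[where f' = "\<lambda>x v. 0"]) (use Suc in auto)
qed simp

lemma Ck_add: "Ck n f \<Longrightarrow> Ck n g \<Longrightarrow> Ck n (\<lambda>x. f x + g x)"
proof (induction n arbitrary: f g)
  case (Suc n)
  show ?case
    by (rule Ck_SucI[OF has_derivative_add[OF Ck_SucD(1)[OF Suc.prems(1)] Ck_SucD(1)[OF Suc.prems(2)]]])
       (intro Suc.IH Ck_SucD(2)[OF Suc.prems(1)] Ck_SucD(2)[OF Suc.prems(2)])
qed simp

lemma Ck_mult: "Ck n f \<Longrightarrow> Ck n g \<Longrightarrow> Ck n (\<lambda>x. f x * g x)"
proof (induction n arbitrary: f g)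
  case (Suc n)
  note d = has_derivative_mult[OF Ck_SucD(1)[OF Suc.prems(1)] Ck_SucD(1)[OF Suc.prems(2)]]
  show ?case
    by (intro Ck_SucI[OF d] Ck_add Suc.IH Ck_Suc_imp[OF Suc.prems(1)] Ck_Suc_imp[OF Suc.prems(2)]
          Ck_SucD(2)[OF Suc.prems(1)] Ck_SucD(2)[OF Suc.prems(2)])
qed simp

lemma Ck_sum: "(\<And>i. i \<in> I \<Longrightarrow> Ck n (f i)) \<Longrightarrow> Ck n (\<lambda>x. \<Sum>i\<in>I. f i x)"
  by (induction I rule: infinite_finite_induct) (auto simp del: Ck.simps intro: Ck_const Ck_add)

text \<open>The partial derivative of the composite in direction b is the derivative of f along
  \<open>L b\<close>, a combination with constant coefficients of partial derivatives of f, each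
  composed with the same affine map.\<close>

lemma Ck_comp_affine:
  fixes L :: "'b::euclidean_space \<Rightarrow> 'c::euclidean_space"
  assumes L: "linear L"
  shows "Ck n f \<Longrightarrow> Ck n (\<lambda>x. f (L x + c))"
proof (induction n arbitrary: f)
  case (Suc n)
  note df = Ck_SucD[OF Suc.prems]
  have D: "((\<lambda>x. f (L x + c)) has_derivative (\<lambda>v. frechet_derivative f (at (L x + c)) (L v))) (at x)" for x
  proof (rule has_derivative_compose[of "\<lambda>x. L x + c" L x UNIV f, OF _ df(1)])
    show "((\<lambda>x. L x + c) has_derivative L) (at x)"
      using has_derivative_add[OF linear_imp_has_derivative[OF L] has_derivative_const[of c]] by simp
  qed
  have eq: "frechet_derivative f (at y) (L b) = (\<Sum>i\<in>Basis. (L b \<bullet> i) * frechet_derivative f (at y) i)" for y b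
  proof -
    have l: "linear (frechet_derivative f (at y))"
      using df(1) has_derivative_linear by blast
    show ?thesis
      by (subst euclidean_representation[of "L b", symmetric])
         (simp add: linear_sum[OF l] linear_scale[OF l])
  qed
  show ?case
    by (rule Ck_SucI[OF D]) (auto simp: eq intro!: Ck_sum Ck_mult Ck_const Suc.IH df(2))
qed simp

text \<open>Listing all derivatives \<open>D m\<close> of the outer function at once closes the
  induction: differentiating \<open>D m\<close> after f gives a partial derivative of f times
  \<open>D (Suc m)\<close> after f. The set S admits outer functions that are differentiable on part
  of the line only, such as powers on the positive reals.\<close>

lemma Ck_comp_seq:
  assumes "\<And>m y. y \<in> S \<Longrightarrow> (D m has_real_derivative D (Suc m) y) (at y)"
    and "\<And>x. f x \<in> S"
  shows "Ck n f \<Longrightarrow> Ck n (\<lambda>x. D m (f x))"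
proof (induction n arbitrary: m)
  case (Suc n)
  have "((\<lambda>x. D m (f x)) has_derivative (\<lambda>v. frechet_derivative f (at x) v * D (Suc m) (f x))) (at x)" for x
    using has_derivative_compose[OF Ck_SucD(1)[OF Suc.prems] assms(1)[OF assms(2), unfolded has_field_derivative_def]]
    by (simp add: mult.commute)
  then show ?case
    by (rule Ck_SucI) (intro Ck_mult Suc.IH Ck_SucD(2) Suc.prems Ck_Suc_imp; assumption)
qed simp

lemma Ck_local:
  fixes g :: "'b::euclidean_space \<Rightarrow> real"
  assumes "\<And>x. \<exists>U f. open U \<and> x \<in> U \<and> Ck n f \<and> (\<forall>y\<in>U. g y = f y)"
  shows "Ck n g"
  using assms
proof (induction n arbitrary: g)
  case (Suc n)
  have D: "(g has_derivative frechet_derivative f (at y)) (at y)"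
    if "open U" "y \<in> U" "Ck (Suc n) f" "\<forall>y\<in>U. g y = f y" for U f y
    by (rule has_derivative_transform_within_open[OF Ck_SucD(1)[OF that(3)] that(1,2)]) (use that in auto)
  have dg: "(g has_derivative frechet_derivative g (at x)) (at x)" for x
    using Suc.prems[of x] D by (metis frechet_derivative_at)
  show ?case
  proof (rule Ck_SucI[OF dg])
    fix b :: 'b assume b: "b \<in> Basis"
    show "Ck n (\<lambda>x. frechet_derivative g (at x) b)"
    proof (rule Suc.IH)
      fix x
      obtain U f where U: "open U" "x \<in> U" "Ck (Suc n) f" "\<forall>y\<in>U. g y = f y"
        using Suc.prems by blast
      have "\<forall>y\<in>U. frechet_derivative g (at y) b = frechet_derivative f (at y) b"
        using D[OF U(1) _ U(3,4)] frechet_derivative_at by metis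
      then show "\<exists>U f. open U \<and> x \<in> U \<and> Ck n f \<and> (\<forall>y\<in>U. frechet_derivative g (at y) b = f y)"
        using U Ck_SucD(2)[OF U(3) b] by blast
    qed
  qed
qed simp

section \<open>Closure properties and gradients of smooth functions\<close>

lemma smooth_const: "smooth_fun (\<lambda>x. c)"
  and smooth_add: "smooth_fun f \<Longrightarrow> smooth_fun g \<Longrightarrow> smooth_fun (\<lambda>x. f x + g x)"
  and smooth_mult: "smooth_fun f \<Longrightarrow> smooth_fun g \<Longrightarrow> smooth_fun (\<lambda>x. f x * g x)"
  by (auto simp: smooth_fun_iff_Ck intro: Ck_const Ck_add Ck_mult)

lemma smooth_sum: "(\<And>i. i \<in> I \<Longrightarrow> smooth_fun (f i)) \<Longrightarrow> smooth_fun (\<lambda>x. \<Sum>i\<in>I. f i x)"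
  by (auto simp: smooth_fun_iff_Ck intro: Ck_sum)

lemma smooth_prod: "(\<And>i. i \<in> I \<Longrightarrow> smooth_fun (f i)) \<Longrightarrow> smooth_fun (\<lambda>x. \<Prod>i\<in>I. f i x)"
  by (induction I rule: infinite_finite_induct) (auto intro: smooth_const smooth_mult)

lemma smooth_comp_affine: "linear L \<Longrightarrow> smooth_fun f \<Longrightarrow> smooth_fun (\<lambda>x. f (L x + c))"
  by (auto simp: smooth_fun_iff_Ck intro: Ck_comp_affine)

lemma smooth_comp_seq:
  assumes "\<And>m y. y \<in> S \<Longrightarrow> (D m has_real_derivative D (Suc m) y) (at y)"
    and "\<And>x. f x \<in> S" "smooth_fun f"
  shows "smooth_fun (\<lambda>x. D m (f x))"
  using Ck_comp_seq[of S D f] assms by (auto simp: smooth_fun_iff_Ck)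

text \<open>This glues a function to its extension by zero, as needed for the pieces of a test
  function in \<open>ends_bound\<close>.\<close>

lemma smooth_local:
  assumes "\<And>x. \<exists>U f. open U \<and> x \<in> U \<and> smooth_fun f \<and> (\<forall>y\<in>U. g y = f y)"
  shows "smooth_fun g"
  unfolding smooth_fun_iff_Ck
proof
  fix n show "Ck n g"
    using assms by (intro Ck_local) (metis smooth_fun_iff_Ck)
qed

lemma smooth_inner: "smooth_fun (\<lambda>x. x \<bullet> a)"
proof -
  have "Ck n (\<lambda>x. x \<bullet> a)" for n
    by (cases n) (auto intro!: Ck_SucI[where f' = "\<lambda>x v. v \<bullet> a"] Ck_const derivative_eq_intros simp del: Ck.simps(2))
  then show ?thesis by (auto simp: smooth_fun_iff_Ck)
qed

lemma smooth_norm2: "smooth_fun (\<lambda>x::'b::euclidean_space. (norm x)\<^sup>2)"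
proof -
  have "smooth_fun (\<lambda>x::'b. \<Sum>b\<in>Basis. (x \<bullet> b) * (x \<bullet> b))"
    by (intro smooth_sum smooth_mult smooth_inner)
  then show ?thesis by (simp add: power2_norm_eq_inner euclidean_inner[symmetric])
qed

lemma smooth_deriv: "smooth_fun f \<Longrightarrow> smooth_fun (\<lambda>x. frechet_derivative f (at x) v)"
proof -
  assume f: "smooth_fun f"
  have l: "linear (frechet_derivative f (at y))" for y
    by (meson Ck_SucD(1) f has_derivative_linear smooth_fun_iff_Ck)
  have "frechet_derivative f (at y) v = (\<Sum>i\<in>Basis. (v \<bullet> i) * frechet_derivative f (at y) i)" for y
    by (subst euclidean_representation[of v, symmetric])
       (simp add: linear_sum[OF l] linear_scale[OF l])
  moreover have "smooth_fun (\<lambda>y. \<Sum>i\<in>Basis. (v \<bullet> i) * frechet_derivative f (at y) i)"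
    using f by (intro smooth_sum smooth_mult smooth_const) (auto elim: smooth_fun.cases)
  ultimately show ?thesis by simp
qed

lemma smooth_has_derivative:
  assumes "smooth_fun f"
  shows "(f has_derivative (\<lambda>v. cgrad f x \<bullet> v)) (at x)"
proof -
  have d: "(f has_derivative frechet_derivative f (at x)) (at x)"
    by (meson Ck_SucD(1) assms smooth_fun_iff_Ck)
  then have l: "linear (frechet_derivative f (at x))" using has_derivative_linear by blast
  have "frechet_derivative f (at x) = (\<lambda>v. cgrad f x \<bullet> v)"
  proof
    fix v
    show "frechet_derivative f (at x) v = cgrad f x \<bullet> v"
      by (subst euclidean_representation[of v, symmetric])
         (simp add: linear_sum[OF l] linear_scale[OF l] cgrad_def inner_sum_left inner_sum_right inner_commute mult.commute)
  qed
  then show ?thesis using d by simp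
qed

lemma cgrad_eqI: "(f has_derivative (\<lambda>v. g \<bullet> v)) (at x) \<Longrightarrow> cgrad f x = g"
  unfolding cgrad_def by (drule frechet_derivative_at, drule sym) (simp add: euclidean_representation)

lemma frechet_eq_cgrad: "smooth_fun f \<Longrightarrow> frechet_derivative f (at x) v = cgrad f x \<bullet> v"
  using smooth_has_derivative frechet_derivative_at by metis

lemma smooth_cgrad_inner: "smooth_fun f \<Longrightarrow> smooth_fun (\<lambda>x. cgrad f x \<bullet> v)"
  using smooth_deriv[of f v] by (simp add: frechet_eq_cgrad)

lemma smooth_continuous: "smooth_fun f \<Longrightarrow> continuous_on S f"
  using smooth_has_derivative has_derivative_continuous
  by (meson continuous_at_imp_continuous_on)

lemma cgrad_continuous:
  assumes "smooth_fun f" shows "continuous_on S (cgrad f)"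
proof -
  have "continuous_on S (\<lambda>x. \<Sum>b\<in>Basis. (cgrad f x \<bullet> b) *\<^sub>R b)"
    by (intro continuous_intros smooth_continuous smooth_cgrad_inner assms)
  then show ?thesis by (simp add: euclidean_representation)
qed

lemma cgrad_add: "smooth_fun f \<Longrightarrow> smooth_fun g \<Longrightarrow> cgrad (\<lambda>x. f x + g x) x = cgrad f x + cgrad g x"
  by (rule cgrad_eqI) (auto intro!: derivative_eq_intros smooth_has_derivative simp: inner_add_left)

lemma cgrad_mult:
  "smooth_fun f \<Longrightarrow> smooth_fun g \<Longrightarrow> cgrad (\<lambda>x. f x * g x) x = g x *\<^sub>R cgrad f x + f x *\<^sub>R cgrad g x"
  by (rule cgrad_eqI) (auto intro!: derivative_eq_intros smooth_has_derivative simp: inner_add_left algebra_simps)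

lemma cgrad_comp:
  assumes "smooth_fun f" "(h has_real_derivative d) (at (f x))"
  shows "cgrad (\<lambda>x. h (f x)) x = d *\<^sub>R cgrad f x"
  by (rule cgrad_eqI)
     (use has_derivative_compose[OF smooth_has_derivative[OF assms(1)] assms(2)[unfolded has_field_derivative_def]] in simp)

lemma cgrad_const: "cgrad (\<lambda>x. c) x = 0"
  by (rule cgrad_eqI) auto

lemma smooth_cmult: "smooth_fun f \<Longrightarrow> smooth_fun (\<lambda>x. c * f x)"
  by (intro smooth_mult smooth_const)

lemma cgrad_cmult: "smooth_fun f \<Longrightarrow> cgrad (\<lambda>x. c * f x) x = c *\<^sub>R cgrad f x"
  by (simp add: cgrad_mult smooth_const cgrad_const)

lemma smooth_diff: "smooth_fun f \<Longrightarrow> smooth_fun g \<Longrightarrow> smooth_fun (\<lambda>x. f x - g x)"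
  using smooth_add[OF _ smooth_cmult[of g "-1"], of f] by simp

lemma cgrad_diff: "smooth_fun f \<Longrightarrow> smooth_fun g \<Longrightarrow> cgrad (\<lambda>x. f x - g x) x = cgrad f x - cgrad g x"
  using cgrad_add[OF _ smooth_cmult[of g "-1"], of f x] cgrad_cmult[of g "-1" x] by simp

lemma cgrad_norm2: "cgrad (\<lambda>x. (norm x)\<^sup>2) x = 2 *\<^sub>R x"
  by (rule cgrad_eqI) (auto intro!: derivative_eq_intros simp: power2_norm_eq_inner inner_commute)

lemma smooth_sin: "smooth_fun f \<Longrightarrow> smooth_fun (\<lambda>x. sin (f x))"
proof -
  \<comment> \<open>A quarter-period shift writes all derivatives of the sine as one family indexed
    by m.\<close>
  have "((\<lambda>y. sin (y + of_nat m * (pi/2))) has_real_derivative sin (y + of_nat (Suc m) * (pi/2))) (at y)" for m y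
  proof -
    have "sin (y + of_nat (Suc m) * (pi/2)) = cos (y + of_nat m * (pi/2))"
    proof -
      have "y + of_nat (Suc m) * (pi/2) = (y + of_nat m * (pi/2)) + pi/2" by (simp add: field_simps)
      then show ?thesis by (simp only: sin_add) simp
    qed
    then show ?thesis by (auto intro!: derivative_eq_intros)
  qed
  then show "smooth_fun f \<Longrightarrow> smooth_fun (\<lambda>x. sin (f x))"
    using smooth_comp_seq[of UNIV "\<lambda>m y. sin (y + of_nat m * (pi/2))" f 0] by simp
qed

lemma smooth_cos: "smooth_fun f \<Longrightarrow> smooth_fun (\<lambda>x. cos (f x))"
  using smooth_sin[OF smooth_diff[OF smooth_const, of f "pi/2"]] by (simp add: cos_sin_eq)

lemma smooth_exp: "smooth_fun f \<Longrightarrow> smooth_fun (\<lambda>x. exp (f x))"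
  using smooth_comp_seq[of UNIV "\<lambda>m y. exp y" f 0] by (force intro!: derivative_eq_intros)

lemma smooth_powr:
  assumes "smooth_fun f" "\<And>x. f x > 0" shows "smooth_fun (\<lambda>x. f x powr a)"
proof -
  have "((\<lambda>y. (\<Prod>i<m. a - real i) * y powr (a - real m)) has_real_derivative
          (\<Prod>i<Suc m. a - real i) * y powr (a - real (Suc m))) (at y)" if "y > 0" for y m
    using that by (auto intro!: derivative_eq_intros simp: algebra_simps)
  then show ?thesis
    using smooth_comp_seq[of "{0<..}" "\<lambda>m y. (\<Prod>i<m. a - real i) * y powr (a - real m)" f 0] assms
    by simp
qed

section \<open>The flat function exp(-1/t) and its derivatives\<close>

definition flat :: "real \<Rightarrow> real" where
  "flat t = (if t > 0 then exp (- (1 / t)) else 0)"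

definition flat' :: "real \<Rightarrow> real" where
  "flat' t = (if t > 0 then exp (- (1 / t)) / t\<^sup>2 else 0)"

text \<open>With z = 1/t the chain rule gives d/dt (p(z) exp(-z)) = z^2 (p(z) - p'(z)) exp(-z). This
  is the recursion for the polynomial factor in the m-th derivative of \<open>flat\<close>.\<close>

primrec flat_poly :: "nat \<Rightarrow> real poly" where
  "flat_poly 0 = 1"
| "flat_poly (Suc n) = [:0, 0, 1:] * (flat_poly n - pderiv (flat_poly n))"

definition flat_D :: "nat \<Rightarrow> real \<Rightarrow> real" where
  "flat_D m t = (if t > 0 then poly (flat_poly m) (1 / t) * exp (- (1 / t)) else 0)"

lemma poly_exp_tendsto_0: "((\<lambda>z::real. poly p z * exp (- z)) \<longlongrightarrow> 0) at_top"
proof -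
  have "((\<lambda>z::real. \<Sum>i\<le>degree p. coeff p i * (z ^ i / exp z)) \<longlongrightarrow> (\<Sum>i\<le>degree p. coeff p i * 0)) at_top"
    by (intro tendsto_intros tendsto_power_div_exp_0)
  then show ?thesis
    by (simp add: poly_altdef exp_minus sum_distrib_right divide_inverse mult.assoc)
qed

lemma flat_D_deriv: "(flat_D m has_real_derivative flat_D (Suc m) t) (at t)"
proof (cases t "0::real" rule: linorder_cases)
  case greater
  have "((\<lambda>t. poly (flat_poly m) (1 / t) * exp (- (1 / t))) has_real_derivative flat_D (Suc m) t) (at t)"
  proof -
    have i: "((\<lambda>t. 1 / t) has_real_derivative - (1 / t\<^sup>2)) (at t)"
      using greater by (auto intro!: derivative_eq_intros simp: power2_eq_square divide_simps)
    note p = DERIV_chain2[OF poly_DERIV[of "flat_poly m"] i]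
    have e: "((\<lambda>t. exp (- (1 / t))) has_real_derivative exp (- (1 / t)) * (1 / t\<^sup>2)) (at t)"
      using DERIV_chain2[OF DERIV_exp DERIV_minus[OF i]] by simp
    have "poly (pderiv (flat_poly m)) (1 / t) * - (1 / t\<^sup>2) * exp (- (1 / t))
        + exp (- (1 / t)) * (1 / t\<^sup>2) * poly (flat_poly m) (1 / t) = flat_D (Suc m) t"
      using greater by (simp add: flat_D_def power2_eq_square algebra_simps)
    then show ?thesis using DERIV_mult[OF p e] by simp
  qed
  moreover have "eventually (\<lambda>s. poly (flat_poly m) (1 / s) * exp (- (1 / s)) = flat_D m s) (nhds t)"
    using greater by (intro eventually_nhds_in_open[THEN eventually_mono, of "{0<..}"]) (auto simp: flat_D_def)
  ultimately show ?thesis by (subst (asm) DERIV_cong_ev[OF refl _ refl])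
next
  case less
  have "((\<lambda>t. 0) has_real_derivative flat_D (Suc m) t) (at t)"
    using less by (auto simp: flat_D_def)
  moreover have "eventually (\<lambda>s. 0 = flat_D m s) (nhds t)"
    using less by (intro eventually_nhds_in_open[THEN eventually_mono, of "{..<0}"]) (auto simp: flat_D_def)
  ultimately show ?thesis by (subst (asm) DERIV_cong_ev[OF refl _ refl])
next
  case equal
  \<comment> \<open>From the right the difference quotient at 0 is z p(z) exp(-z) with z = 1/h
    tending to infinity; from the left it is 0.\<close>
  have r: "((\<lambda>h. flat_D m h / h) \<longlongrightarrow> 0) (at_right 0)"
  proof -
    have "((\<lambda>h. poly ([:0,1:] * flat_poly m) (inverse h) * exp (- (inverse h))) \<longlongrightarrow> 0) (at_right (0::real))"
      by (rule filterlim_compose[OF poly_exp_tendsto_0 filterlim_inverse_at_top_right])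
    moreover have "eventually (\<lambda>h. poly ([:0,1:] * flat_poly m) (inverse h) * exp (- (inverse h)) = flat_D m h / h) (at_right (0::real))"
      by (auto simp: eventually_at_filter flat_D_def divide_inverse)
    ultimately show ?thesis using tendsto_cong by fast
  qed
  have l: "((\<lambda>h. flat_D m h / h) \<longlongrightarrow> 0) (at_left 0)"
    by (rule tendsto_eventually) (auto simp: eventually_at_filter flat_D_def)
  have "((\<lambda>h. flat_D m h / h) \<longlongrightarrow> 0) (at 0)" using l r by (simp add: filterlim_at_split)
  then show ?thesis using equal by (simp add: DERIV_def flat_D_def)
qed

lemma smooth_flat: "smooth_fun f \<Longrightarrow> smooth_fun (\<lambda>x. flat (f x))"
proof -
  have "flat_D 0 = flat" by (auto simp: flat_D_def flat_def fun_eq_iff)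
  then show "smooth_fun f \<Longrightarrow> smooth_fun (\<lambda>x. flat (f x))"
    using smooth_comp_seq[of UNIV flat_D f 0] flat_D_deriv by simp
qed

lemma smooth_flat': "smooth_fun f \<Longrightarrow> smooth_fun (\<lambda>x. flat' (f x))"
proof -
  have "flat_D (Suc 0) = flat'" by (auto simp: flat_D_def flat'_def fun_eq_iff power2_eq_square divide_simps)
  then show "smooth_fun f \<Longrightarrow> smooth_fun (\<lambda>x. flat' (f x))"
    using smooth_comp_seq[of UNIV flat_D f "Suc 0"] flat_D_deriv by simp
qed

lemma flat_deriv: "(flat has_real_derivative flat' t) (at t)"
proof -
  have "flat_D (Suc 0) = flat'" "flat_D 0 = flat"
    by (auto simp: flat_D_def flat'_def flat_def fun_eq_iff power2_eq_square divide_simps)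
  then show ?thesis using flat_D_deriv[of 0 t] by simp
qed

section \<open>Square-integrable functions\<close>

text \<open>\<open>L2\<close> with a measure in place of the domain. For \<open>lborel\<close> it
  describes functions on the whole space, and a function on A is represented there by a Borel
  function that vanishes off A.\<close>

definition sqi :: "'a measure \<Rightarrow> ('a \<Rightarrow> 'c::euclidean_space) \<Rightarrow> bool" where
  "sqi M f \<longleftrightarrow> f \<in> borel_measurable M \<and> integrable M (\<lambda>x. (norm (f x))\<^sup>2)"

definition N2 :: "'a measure \<Rightarrow> ('a \<Rightarrow> 'c::euclidean_space) \<Rightarrow> real" where
  "N2 M f = (\<integral>x. (norm (f x))\<^sup>2 \<partial>M)"

lemma sqi_measurable[measurable_dest]: "sqi M f \<Longrightarrow> f \<in> borel_measurable M"
  and sqi_integrable: "sqi M f \<Longrightarrow> integrable M (\<lambda>x. (norm (f x))\<^sup>2)"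
  by (auto simp: sqi_def)

lemma N2_nonneg: "N2 M f \<ge> 0"
  by (simp add: N2_def)

lemma sqi_bound:
  assumes "sqi M f" "g \<in> borel_measurable M" "AE x in M. norm (g x) \<le> c * norm (f x)"
  shows "sqi M g"
  unfolding sqi_def
proof
  show "integrable M (\<lambda>x. (norm (g x))\<^sup>2)"
  proof (rule Bochner_Integration.integrable_bound[of M "\<lambda>x. c\<^sup>2 * (norm (f x))\<^sup>2"])
    show "AE x in M. norm ((norm (g x))\<^sup>2) \<le> norm (c\<^sup>2 * (norm (f x))\<^sup>2)"
      using assms(3)
    proof eventually_elim
      case (elim x)
      then show ?case using power_mono[OF elim, of 2] by (simp add: power_mult_distrib)
    qed
  qed (use assms in \<open>auto simp: sqi_def\<close>)
qed fact

lemma sqi_integrable_inner: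
  assumes "sqi M f" "sqi M g" shows "integrable M (\<lambda>x. f x \<bullet> g x)"
proof (rule Bochner_Integration.integrable_bound[of M "\<lambda>x. (norm (f x))\<^sup>2 + (norm (g x))\<^sup>2"])
  show "AE x in M. norm (f x \<bullet> g x) \<le> norm ((norm (f x))\<^sup>2 + (norm (g x))\<^sup>2)"
  proof (rule AE_I2)
    fix x
    have "\<bar>f x \<bullet> g x\<bar> \<le> norm (f x) * norm (g x)" by (rule Cauchy_Schwarz_ineq2)
    also have "\<dots> \<le> (norm (f x))\<^sup>2 + (norm (g x))\<^sup>2"
      using sum_squares_bound[of "norm (f x)" "norm (g x)"] mult_nonneg_nonneg[OF norm_ge_zero norm_ge_zero, of "f x" "g x"]
      by linarith
    finally show "norm (f x \<bullet> g x) \<le> norm ((norm (f x))\<^sup>2 + (norm (g x))\<^sup>2)" by simp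
  qed
qed (use assms in \<open>auto simp: sqi_def\<close>)

lemma sqi_integrable_mult:
  fixes f g :: "'a \<Rightarrow> real"
  shows "sqi M f \<Longrightarrow> sqi M g \<Longrightarrow> integrable M (\<lambda>x. f x * g x)"
  using sqi_integrable_inner[of M f g] by simp

lemma sqi_scaleR: "sqi M f \<Longrightarrow> sqi M (\<lambda>x. c *\<^sub>R f x)"
  by (auto simp: sqi_def power_mult_distrib)

lemma sqi_add:
  assumes "sqi M f" "sqi M g" shows "sqi M (\<lambda>x. f x + g x)"
proof -
  have "(norm (f x + g x))\<^sup>2 = (norm (f x))\<^sup>2 + 2 * (f x \<bullet> g x) + (norm (g x))\<^sup>2" for x
    by (simp add: power2_norm_eq_inner inner_add_left inner_add_right inner_commute)
  then show ?thesis using assms sqi_integrable_inner[OF assms] by (auto simp: sqi_def)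
qed

lemma sqi_diff: "sqi M f \<Longrightarrow> sqi M g \<Longrightarrow> sqi M (\<lambda>x. f x - g x)"
  using sqi_add[OF _ sqi_scaleR[of M g "-1"]] by simp

lemma N2_scaleR: "N2 M (\<lambda>x. c *\<^sub>R f x) = c\<^sup>2 * N2 M f"
  by (simp add: N2_def power_mult_distrib)

lemma N2_minus_commute: "N2 M (\<lambda>x. f x - g x) = N2 M (\<lambda>x. g x - f x)"
  by (simp add: N2_def norm_minus_commute)

lemma N2_add:
  assumes "sqi M f" "sqi M g"
  shows "N2 M (\<lambda>x. f x + g x) = N2 M f + 2 * (\<integral>x. f x \<bullet> g x \<partial>M) + N2 M g"
proof -
  have "N2 M (\<lambda>x. f x + g x) = (\<integral>x. (norm (f x))\<^sup>2 + 2 * (f x \<bullet> g x) + (norm (g x))\<^sup>2 \<partial>M)"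
    unfolding N2_def
    by (intro Bochner_Integration.integral_cong refl)
       (simp add: power2_norm_eq_inner inner_add_left inner_add_right inner_commute)
  then show ?thesis using assms sqi_integrable_inner[OF assms] by (simp add: N2_def sqi_def)
qed

lemma N2_diff:
  assumes "sqi M f" "sqi M g"
  shows "N2 M (\<lambda>x. f x - g x) = N2 M f - 2 * (\<integral>x. f x \<bullet> g x \<partial>M) + N2 M g"
  using N2_add[OF assms(1) sqi_scaleR[OF assms(2), of "-1"]] N2_scaleR[of M "-1" g] by simp

lemma N2_parallelogram:
  assumes "sqi M f" "sqi M g"
  shows "N2 M (\<lambda>x. f x + g x) + N2 M (\<lambda>x. f x - g x) = 2 * N2 M f + 2 * N2 M g"
  using N2_add[OF assms] N2_diff[OF assms] by simp

lemma L2_Cauchy_Schwarz: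
  assumes "sqi M f" "sqi M g"
  shows "\<bar>\<integral>x. f x \<bullet> g x \<partial>M\<bar> \<le> sqrt (N2 M f) * sqrt (N2 M g)"
proof -
  let ?I = "\<integral>x. f x \<bullet> g x \<partial>M"
  have q: "0 \<le> N2 M f + 2 * s * ?I + s\<^sup>2 * N2 M g" for s
    using N2_add[OF assms(1) sqi_scaleR[OF assms(2), of s]] N2_scaleR[of M s g]
      N2_nonneg[of M "\<lambda>x. f x + s *\<^sub>R g x"] by simp
  have "?I\<^sup>2 \<le> N2 M f * N2 M g"
  proof (cases "N2 M g = 0")
    case True
    have "?I = 0"
    proof (rule ccontr)
      assume "?I \<noteq> 0"
      \<comment> \<open>When \<open>N2 M g\<close> is 0 the quadratic is affine in s, and this s
        gives it the value -1.\<close>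
      then show False using q[of "- (N2 M f + 1) / (2 * ?I)"] True by (simp add: field_simps)
    qed
    then show ?thesis using True by simp
  next
    case False
    then have "N2 M g > 0" using N2_nonneg[of M g] by simp
    then show ?thesis using q[of "- ?I / N2 M g"] by (simp add: field_simps power2_eq_square)
  qed
  then have "sqrt (?I\<^sup>2) \<le> sqrt (N2 M f * N2 M g)" by (rule real_sqrt_le_mono)
  then show ?thesis by (simp add: real_sqrt_mult)
qed

lemma N2_triangle:
  assumes "sqi M f" "sqi M g"
  shows "sqrt (N2 M (\<lambda>x. f x + g x)) \<le> sqrt (N2 M f) + sqrt (N2 M g)"
proof -
  have "N2 M (\<lambda>x. f x + g x) \<le> (sqrt (N2 M f) + sqrt (N2 M g))\<^sup>2"
    using N2_add[OF assms] L2_Cauchy_Schwarz[OF assms] N2_nonneg[of M f] N2_nonneg[of M g]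
    by (simp add: power2_sum)
  then show ?thesis
    by (metis N2_nonneg add_nonneg_nonneg real_le_lsqrt real_sqrt_ge_zero)
qed

lemma N2_add_le:
  assumes "sqi M f" "sqi M g"
  shows "N2 M (\<lambda>x. f x + g x) \<le> 2 * N2 M f + 2 * N2 M g"
  using N2_parallelogram[OF assms] N2_nonneg[of M "\<lambda>x. f x - g x"] by simp

lemma N2_diff_tendsto:
  assumes "\<And>n. sqi M (f n)" "\<And>n. sqi M (g n)" "sqi M F" "sqi M G"
    and "(\<lambda>n. N2 M (\<lambda>x. F x - f n x)) \<longlonglongrightarrow> 0" "(\<lambda>n. N2 M (\<lambda>x. G x - g n x)) \<longlonglongrightarrow> 0"
  shows "(\<lambda>n. \<integral>x. f n x \<bullet> g n x \<partial>M) \<longlonglongrightarrow> (\<integral>x. F x \<bullet> G x \<partial>M)"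
proof -
  let ?a = "\<lambda>n. sqrt (N2 M (\<lambda>x. F x - f n x))" and ?b = "\<lambda>n. sqrt (N2 M (\<lambda>x. G x - g n x))"
  have ab: "?a \<longlonglongrightarrow> 0" "?b \<longlonglongrightarrow> 0"
    using tendsto_real_sqrt[OF assms(5)] tendsto_real_sqrt[OF assms(6)] by auto
  have "\<bar>(\<integral>x. f n x \<bullet> g n x \<partial>M) - (\<integral>x. F x \<bullet> G x \<partial>M)\<bar>
      \<le> sqrt (N2 M F) * ?b n + ?a n * sqrt (N2 M G) + ?a n * ?b n" for n
  proof -
    note i = sqi_integrable_inner
    note d = sqi_diff[OF assms(3) assms(1)[of n]] sqi_diff[OF assms(4) assms(2)[of n]]
    have "(\<integral>x. f n x \<bullet> g n x \<partial>M)
       = (\<integral>x. (F x - f n x) \<bullet> (G x - g n x) - F x \<bullet> (G x - g n x) - (F x - f n x) \<bullet> G x + F x \<bullet> G x \<partial>M)"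
      by (rule Bochner_Integration.integral_cong) (auto simp: inner_diff_left inner_diff_right)
    also have "\<dots> = (\<integral>x. (F x - f n x) \<bullet> (G x - g n x) \<partial>M) - (\<integral>x. F x \<bullet> (G x - g n x) \<partial>M)
         - (\<integral>x. (F x - f n x) \<bullet> G x \<partial>M) + (\<integral>x. F x \<bullet> G x \<partial>M)"
      by (simp only: Bochner_Integration.integral_add Bochner_Integration.integral_diff
           Bochner_Integration.integrable_diff i[OF d(1) d(2)] i[OF assms(3) d(2)] i[OF d(1) assms(4)] i[OF assms(3,4)])
    finally show ?thesis
      using L2_Cauchy_Schwarz[OF d] L2_Cauchy_Schwarz[OF assms(3) d(2)] L2_Cauchy_Schwarz[OF d(1) assms(4)]
      by linarith
  qed
  then have bd: "\<forall>\<^sub>F n in sequentially. norm ((\<integral>x. f n x \<bullet> g n x \<partial>M) - (\<integral>x. F x \<bullet> G x \<partial>M))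
      \<le> sqrt (N2 M F) * ?b n + ?a n * sqrt (N2 M G) + ?a n * ?b n"
    by (intro always_eventually allI) (simp only: real_norm_def)
  have "(\<lambda>n. sqrt (N2 M F) * ?b n + ?a n * sqrt (N2 M G) + ?a n * ?b n) \<longlonglongrightarrow>
      sqrt (N2 M F) * 0 + 0 * sqrt (N2 M G) + 0 * 0"
    by (intro tendsto_intros ab)
  then have lim0: "(\<lambda>n. sqrt (N2 M F) * ?b n + ?a n * sqrt (N2 M G) + ?a n * ?b n) \<longlonglongrightarrow> 0"
    by (simp only: mult_zero_left mult_zero_right add_0_left)
  have "(\<lambda>n. (\<integral>x. f n x \<bullet> g n x \<partial>M) - (\<integral>x. F x \<bullet> G x \<partial>M)) \<longlonglongrightarrow> 0"
    by (rule Lim_null_comparison[OF bd lim0])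
  then show ?thesis by (simp add: LIM_zero_iff)
qed

lemma N2_tendsto:
  assumes "\<And>n. sqi M (f n)" "sqi M F" "(\<lambda>n. N2 M (\<lambda>x. F x - f n x)) \<longlonglongrightarrow> 0"
  shows "(\<lambda>n. N2 M (f n)) \<longlonglongrightarrow> N2 M F"
  using N2_diff_tendsto[OF assms(1,1,2,2,3,3)] by (simp add: N2_def power2_norm_eq_inner)

lemma inner_tendsto:
  assumes "\<And>n. sqi M (f n)" "sqi M F" "sqi M G" "(\<lambda>n. N2 M (\<lambda>x. F x - f n x)) \<longlonglongrightarrow> 0"
  shows "(\<lambda>n. \<integral>x. f n x \<bullet> G x \<partial>M) \<longlonglongrightarrow> (\<integral>x. F x \<bullet> G x \<partial>M)"
  using N2_diff_tendsto[OF assms(1) _ assms(2,3,4), of "\<lambda>n. G"] assms(3) by (simp add: N2_def)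

lemma L2_limit_add:
  assumes "\<And>n. sqi M (f n)" "\<And>n. sqi M (g n)" "sqi M F" "sqi M G"
    and "(\<lambda>n. N2 M (\<lambda>x. F x - f n x)) \<longlonglongrightarrow> 0" "(\<lambda>n. N2 M (\<lambda>x. G x - g n x)) \<longlonglongrightarrow> 0"
  shows "(\<lambda>n. N2 M (\<lambda>x. (F x + G x) - (f n x + g n x))) \<longlonglongrightarrow> 0"
proof (rule tendsto_sandwich[OF _ _ tendsto_const])
  show "(\<lambda>n. 2 * N2 M (\<lambda>x. F x - f n x) + 2 * N2 M (\<lambda>x. G x - g n x)) \<longlonglongrightarrow> 0"
    using tendsto_add[OF tendsto_mult[OF tendsto_const assms(5), of 2] tendsto_mult[OF tendsto_const assms(6), of 2]] by simp
  have "(\<lambda>x. (F x + G x) - (f n x + g n x)) = (\<lambda>x. (F x - f n x) + (G x - g n x))" for n by auto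
  then show "\<forall>\<^sub>F n in sequentially. N2 M (\<lambda>x. (F x + G x) - (f n x + g n x))
      \<le> 2 * N2 M (\<lambda>x. F x - f n x) + 2 * N2 M (\<lambda>x. G x - g n x)"
    using N2_add_le[OF sqi_diff[OF assms(3) assms(1)] sqi_diff[OF assms(4) assms(2)]]
    by (intro always_eventually) simp
qed (auto simp: N2_nonneg)

lemma N2_zero_iff:
  assumes "sqi M f" shows "N2 M f = 0 \<longleftrightarrow> (AE x in M. f x = 0)"
  unfolding N2_def by (subst integral_nonneg_eq_0_iff_AE) (use assms in \<open>auto simp: sqi_def\<close>)

lemma L2_AE_subseq:
  assumes "\<And>n. sqi M (f n)" "sqi M F" "(\<lambda>n. N2 M (\<lambda>x. F x - f n x)) \<longlonglongrightarrow> 0"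
  shows "\<exists>r::nat\<Rightarrow>nat. strict_mono r \<and> (AE x in M. (\<lambda>n. f (r n) x) \<longlonglongrightarrow> F x)"
proof -
  have "\<exists>r::nat\<Rightarrow>nat. strict_mono r \<and> (AE x in M. (\<lambda>n. (norm (F x - f (r n) x))\<^sup>2) \<longlonglongrightarrow> 0)"
    by (rule tendsto_L1_AE_subseq)
       (use assms(3) sqi_integrable[OF sqi_diff[OF assms(2,1)]] in \<open>auto simp: N2_def\<close>)
  then obtain r :: "nat \<Rightarrow> nat" where r: "strict_mono r" and ae: "AE x in M. (\<lambda>n. (norm (F x - f (r n) x))\<^sup>2) \<longlonglongrightarrow> 0"
    by blast
  from ae have "AE x in M. (\<lambda>n. f (r n) x) \<longlonglongrightarrow> F x"
  proof eventually_elim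
    case (elim x)
    then have "(\<lambda>n. norm (F x - f (r n) x)) \<longlonglongrightarrow> 0"
      using tendsto_real_sqrt[OF elim] by simp
    then show ?case by (subst tendsto_dist_iff) (simp add: dist_norm norm_minus_commute)
  qed
  with r show ?thesis by blast
qed

text \<open>Riesz-Fischer. Along a subsequence whose squared increments are below 4^-k, the sum of
  2^k |d_k|^2 is integrable, hence finite almost everywhere. Since |d_k| <= 2^-k + 2^k |d_k|^2, the
  increments are then absolutely summable at almost every point, and Fatou's lemma carries the
  Cauchy bound over to the limit.\<close>

theorem L2_complete:
  fixes f :: "nat \<Rightarrow> 'a \<Rightarrow> 'c::euclidean_space"
  assumes sq: "\<And>n. sqi M (f n)"
    and cauchy: "\<And>e. e > 0 \<Longrightarrow> \<exists>N. \<forall>m\<ge>N. \<forall>n\<ge>N. N2 M (\<lambda>x. f m x - f n x) < e"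
  shows "\<exists>F. sqi M F \<and> (\<lambda>n. N2 M (\<lambda>x. F x - f n x)) \<longlonglongrightarrow> 0"
proof -
  note [measurable] = sqi_measurable[OF sq]
  have "\<exists>N. \<forall>k. \<forall>m\<ge>N k. \<forall>n\<ge>N k. N2 M (\<lambda>x. f m x - f n x) < (1/4)^k"
    using cauchy by (intro choice) simp
  then obtain N where N: "\<And>k m n. m \<ge> N k \<Longrightarrow> n \<ge> N k \<Longrightarrow> N2 M (\<lambda>x. f m x - f n x) < (1/4)^k"
    by blast
  \<comment> \<open>Summing the thresholds makes r monotone, so that both \<open>r k\<close> and
    \<open>r (Suc k)\<close> are at least \<open>N k\<close>.\<close>
  define r where "r k = (\<Sum>i\<le>k. N i) + k" for k :: nat
  have rN: "N k \<le> r k" for k unfolding r_def by (rule trans_le_add1) (auto intro: member_le_sum)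
  have rS: "r k \<le> r (Suc k)" for k by (simp add: r_def)
  define d where "d k x = f (r (Suc k)) x - f (r k) x" for k x
  have dsq: "sqi M (d k)" for k unfolding d_def by (intro sqi_diff sq)
  note [measurable] = sqi_measurable[OF dsq]
  have dN: "N2 M (d k) < (1/4)^k" for k
    unfolding d_def by (rule N) (use rN[of k] rS[of k] in auto)
  have nn: "(\<integral>\<^sup>+x. ennreal ((norm (h x))\<^sup>2) \<partial>M) = ennreal (N2 M h)" if "sqi M h" for h :: "'a \<Rightarrow> 'c"
    unfolding N2_def by (rule nn_integral_eq_integral) (use that in \<open>auto simp: sqi_def\<close>)
  have "(\<integral>\<^sup>+x. (\<Sum>k. ennreal (2^k * (norm (d k x))\<^sup>2)) \<partial>M) = (\<Sum>k. \<integral>\<^sup>+x. ennreal (2^k * (norm (d k x))\<^sup>2) \<partial>M)"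
    by (rule nn_integral_suminf) measurable
  also have "\<dots> \<le> (\<Sum>k. ennreal ((1/2)^k))"
  proof (rule suminf_le)
    fix k
    have "(\<integral>\<^sup>+x. ennreal (2^k * (norm (d k x))\<^sup>2) \<partial>M) = ennreal (2^k * N2 M (d k))"
      using nn[OF dsq] by (simp add: ennreal_mult nn_integral_cmult N2_nonneg)
    also have "\<dots> \<le> ennreal ((1/2)^k)"
      using mult_left_mono[OF less_imp_le[OF dN[of k]], of "2^k"]
      by (intro ennreal_leI) (simp add: power_mult_distrib[symmetric])
    finally show "(\<integral>\<^sup>+x. ennreal (2^k * (norm (d k x))\<^sup>2) \<partial>M) \<le> ennreal ((1/2)^k)" .
  qed auto
  also have "\<dots> < \<infinity>"
    using summable_geometric[of "1/2::real"] by (simp add: suminf_ennreal_eq[OF _ summable_sums] less_top)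
  finally have "AE x in M. (\<Sum>k. ennreal (2^k * (norm (d k x))\<^sup>2)) \<noteq> \<infinity>"
    by (intro nn_integral_PInf_AE) (auto simp: less_top)
  then have conv: "AE x in M. convergent (\<lambda>k. f (r k) x)"
  proof eventually_elim
    case (elim x)
    have s: "summable (\<lambda>k. 2^k * (norm (d k x))\<^sup>2)"
      using elim by (intro summable_suminf_not_top) auto
    have "norm (norm (d k x)) \<le> (1/2)^k + 2^k * (norm (d k x))\<^sup>2" for k
    proof -
      define u v where "u = 2^k * norm (d k x)" and "v = (1/2::real)^k"
      have e: "norm (d k x) = u * v" "2^k * (norm (d k x))\<^sup>2 = v * u\<^sup>2" "v > 0"
        by (auto simp: u_def v_def power2_eq_square power_one_over)
      have "u * v \<le> v + v * u\<^sup>2"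
      proof -
        have "u \<le> 1 + u\<^sup>2" using zero_le_power2[of "u - 1/2"] by (simp add: power2_diff power_divide)
        then have "v * u \<le> v * (1 + u\<^sup>2)" using e(3) by (intro mult_left_mono) auto
        then show ?thesis by (simp add: algebra_simps)
      qed
      then show ?thesis unfolding real_norm_def abs_norm_cancel e(2) unfolding e(1) v_def .
    qed
    then have "summable (\<lambda>k. norm (d k x))"
      by (intro summable_comparison_test'[OF summable_add[OF summable_geometric[of "1/2::real"] s]]) auto
    then have "summable (\<lambda>k. d k x)" by (rule summable_norm_cancel)
    then have "convergent (\<lambda>n. \<Sum>k<n. d k x)" by (simp add: summable_iff_convergent)
    moreover have "(\<Sum>k<n. d k x) = f (r n) x - f (r 0) x" for n
      unfolding d_def by (rule sum_lessThan_telescope)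
    ultimately have "convergent (\<lambda>n. f (r n) x - f (r 0) x)" by simp
    then have "convergent (\<lambda>n. f (r n) x - f (r 0) x + f (r 0) x)"
      by (intro convergent_add convergent_const)
    then show ?case by simp
  qed
  define F where "F x = lim (\<lambda>k. f (r k) x)" for x
  have Fm [measurable]: "F \<in> borel_measurable M"
    unfolding F_def by measurable
  have le: "(\<integral>\<^sup>+x. ennreal ((norm (F x - f n x))\<^sup>2) \<partial>M) \<le> ennreal ((1/4)^j)" if n: "n \<ge> N j" for n j
  proof -
    have "(\<integral>\<^sup>+x. ennreal ((norm (F x - f n x))\<^sup>2) \<partial>M)
        = (\<integral>\<^sup>+x. liminf (\<lambda>k. ennreal ((norm (f (r k) x - f n x))\<^sup>2)) \<partial>M)"
    proof (rule nn_integral_cong_AE)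
      show "AE x in M. ennreal ((norm (F x - f n x))\<^sup>2) = liminf (\<lambda>k. ennreal ((norm (f (r k) x - f n x))\<^sup>2))"
        using conv
      proof eventually_elim
        case (elim x)
        then have "(\<lambda>k. f (r k) x) \<longlonglongrightarrow> F x" by (simp add: convergent_LIMSEQ_iff F_def)
        then have "(\<lambda>k. ennreal ((norm (f (r k) x - f n x))\<^sup>2)) \<longlonglongrightarrow> ennreal ((norm (F x - f n x))\<^sup>2)"
          by (intro tendsto_intros)
        then show ?case by (subst lim_imp_Liminf) auto
      qed
    qed
    also have "\<dots> \<le> liminf (\<lambda>k. \<integral>\<^sup>+x. ennreal ((norm (f (r k) x - f n x))\<^sup>2) \<partial>M)"
      by (rule nn_integral_liminf) measurable
    also have "\<dots> \<le> ennreal ((1/4)^j)"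
    proof (rule Liminf_le)
      have "r k \<ge> N j" if "k \<ge> j" for k
      proof -
        have "N j \<le> (\<Sum>i\<le>k. N i)" using that by (intro member_le_sum) auto
        then show ?thesis by (simp add: r_def)
      qed
      then show "\<forall>\<^sub>F k in sequentially. (\<integral>\<^sup>+x. ennreal ((norm (f (r k) x - f n x))\<^sup>2) \<partial>M) \<le> ennreal ((1/4)^j)"
        by (intro eventually_sequentiallyI[of j])
           (simp add: nn[OF sqi_diff[OF sq sq]] ennreal_leI less_imp_le N n)
    qed simp
    finally show ?thesis .
  qed
  have Fd: "sqi M (\<lambda>x. F x - f n x)" if "n \<ge> N j" for n j
    unfolding sqi_def
    by (auto intro!: integrableI_bounded order.strict_trans1[OF le[OF that]])
  have "sqi M F" using sqi_add[OF Fd[OF order_refl, of 0] sq[of "N 0"]] by simp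
  moreover have "(\<lambda>n. N2 M (\<lambda>x. F x - f n x)) \<longlonglongrightarrow> 0"
  proof (rule LIMSEQ_I)
    fix e :: real assume "e > 0"
    then obtain j where j: "(1/4::real)^j < e"
      using real_arch_pow_inv[of e "1/4"] by auto
    have "N2 M (\<lambda>x. F x - f n x) < e" if "n \<ge> N j" for n
    proof -
      have "ennreal (N2 M (\<lambda>x. F x - f n x)) \<le> ennreal ((1/4)^j)"
        using nn[OF Fd[OF that]] le[OF that] by simp
      then show ?thesis using j by (simp add: ennreal_le_iff)
    qed
    then show "\<exists>no. \<forall>n\<ge>no. norm (N2 M (\<lambda>x. F x - f n x) - 0) < e"
      by (auto simp: N2_nonneg)
  qed
  ultimately show ?thesis by blast
qed

section \<open>Translation invariance\<close>

lemma lborel_integral_shift: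
  fixes f :: "'b::euclidean_space \<Rightarrow> 'c::{banach, second_countable_topology}"
  assumes [measurable]: "f \<in> borel_measurable borel"
  shows "(\<integral>x. f (x + h) \<partial>lborel) = (\<integral>x. f x \<partial>lborel)"
    and "integrable lborel (\<lambda>x. f (x + h)) = integrable lborel f"
proof -
  have d: "distr lborel borel (\<lambda>x. x + h) = (lborel::'b measure)"
    using lborel_distr_plus[of h] by (simp add: add.commute[of _ h] cong: distr_cong)
  show "(\<integral>x. f (x + h) \<partial>lborel) = (\<integral>x. f x \<partial>lborel)"
    by (subst (2) d[symmetric], subst integral_distr) auto
  show "integrable lborel (\<lambda>x. f (x + h)) = integrable lborel f"
    by (subst (2) d[symmetric], subst integrable_distr_eq) auto
qed

lemma lborel_nn_integral_shift:
  assumes [measurable]: "f \<in> borel_measurable borel"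
  shows "(\<integral>\<^sup>+x. f (x + h) \<partial>lborel) = (\<integral>\<^sup>+x. f x \<partial>(lborel::'b::euclidean_space measure))"
proof -
  have d: "distr lborel borel (\<lambda>x. x + h) = (lborel::'b measure)"
    using lborel_distr_plus[of h] by (simp add: add.commute[of _ h] cong: distr_cong)
  show ?thesis by (subst (2) d[symmetric], subst nn_integral_distr) auto
qed

lemma sqi_nn_integral:
  "sqi M h \<Longrightarrow> (\<integral>\<^sup>+x. ennreal ((norm (h x))\<^sup>2) \<partial>M) = ennreal (N2 M h)"
  unfolding N2_def by (rule nn_integral_eq_integral) (auto simp: sqi_def)

lemma sqi_nn_integral_bound:
  fixes h :: "'a \<Rightarrow> 'c::euclidean_space"
  assumes "h \<in> borel_measurable M" "(\<integral>\<^sup>+x. ennreal ((norm (h x))\<^sup>2) \<partial>M) \<le> ennreal c" "c \<ge> 0"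
  shows "sqi M h" "N2 M h \<le> c"
proof -
  show s: "sqi M h" unfolding sqi_def
    using assms by (auto intro!: integrableI_bounded order.strict_trans1[OF assms(2)])
  show "N2 M h \<le> c" using assms(2,3) sqi_nn_integral[OF s] by (simp add: ennreal_le_iff)
qed

lemma sqi_shift:
  fixes f :: "'b::euclidean_space \<Rightarrow> 'c::euclidean_space"
  assumes "sqi lborel f"
  shows "sqi lborel (\<lambda>x. f (x + h))" "N2 lborel (\<lambda>x. f (x + h)) = N2 lborel f"
proof -
  have [measurable]: "f \<in> borel_measurable borel" using assms by (simp add: sqi_def)
  show "sqi lborel (\<lambda>x. f (x + h))" "N2 lborel (\<lambda>x. f (x + h)) = N2 lborel f"
    using lborel_integral_shift[of "\<lambda>x. (norm (f x))\<^sup>2" h] assms by (auto simp: sqi_def N2_def)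
qed

section \<open>Test functions and translations\<close>

lemma test_fun_smooth: "test_fun A f \<Longrightarrow> smooth_fun f"
  by (simp add: test_fun_def)

lemma test_funI:
  assumes "smooth_fun f" "compact K" "K \<subseteq> A" "\<And>x. x \<notin> K \<Longrightarrow> f x = 0"
  shows "test_fun A f"
proof -
  have "{x. f x \<noteq> 0} \<subseteq> K" using assms(4) by blast
  then have c: "closure {x. f x \<noteq> 0} \<subseteq> K"
    using assms(2) by (simp add: closure_minimal compact_imp_closed)
  moreover have "compact (closure {x. f x \<noteq> 0})"
    using compact_Int_closed[OF assms(2), of "closure {x. f x \<noteq> 0}"] c by (simp add: Int_absorb1)
  ultimately show ?thesis using assms by (auto simp: test_fun_def)
qed

lemma test_funE:
  assumes "test_fun A f"
  obtains K where "compact K" "K \<subseteq> A" "\<And>x. x \<notin> K \<Longrightarrow> f x = 0" "\<And>x. x \<notin> K \<Longrightarrow> cgrad f x = 0"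
proof
  let ?K = "closure {x. f x \<noteq> 0}"
  show "compact ?K" "?K \<subseteq> A" using assms by (auto simp: test_fun_def)
  show z: "f x = 0" if "x \<notin> ?K" for x using that closure_subset[of "{x. f x \<noteq> 0}"] by blast
  show "cgrad f x = 0" if "x \<notin> ?K" for x
  proof (rule cgrad_eqI)
    have "((\<lambda>x. 0) has_derivative (\<lambda>v. 0)) (at x)" by simp
    then have "(f has_derivative (\<lambda>v. 0)) (at x)"
    proof (rule has_derivative_transform_within_open)
      show "open (- ?K)" by (simp add: open_Compl)
      show "x \<in> - ?K" using that by simp
      show "0 = f y" if "y \<in> - ?K" for y using z[of y] that by simp
    qed
    then show "(f has_derivative (\<bullet>) 0) (at x)" by (simp add: inner_zero_left[abs_def])
  qed
qed

lemma test_fun_mono: "test_fun A f \<Longrightarrow> A \<subseteq> B \<Longrightarrow> test_fun B f"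
  by (auto simp: test_fun_def)

lemma test_fun_mult:
  assumes "test_fun A f" "smooth_fun g" shows "test_fun A (\<lambda>x. g x * f x)"
proof -
  obtain K where K: "compact K" "K \<subseteq> A" "\<And>x. x \<notin> K \<Longrightarrow> f x = 0" using test_funE[OF assms(1)] by metis
  show ?thesis
    by (rule test_funI[OF smooth_mult K(1,2)]) (use assms K in \<open>auto simp: test_fun_smooth\<close>)
qed

lemma test_fun_cmult: "test_fun A f \<Longrightarrow> test_fun A (\<lambda>x. c * f x)"
  by (rule test_fun_mult) (auto simp: smooth_const)

lemma test_fun_add:
  assumes "test_fun A f" "test_fun A g" shows "test_fun A (\<lambda>x. f x + g x)"
proof -
  obtain K where K: "compact K" "K \<subseteq> A" "\<And>x. x \<notin> K \<Longrightarrow> f x = 0" using test_funE[OF assms(1)] by metis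
  obtain K' where K': "compact K'" "K' \<subseteq> A" "\<And>x. x \<notin> K' \<Longrightarrow> g x = 0" using test_funE[OF assms(2)] by metis
  show ?thesis
    by (rule test_funI[OF smooth_add compact_Un[OF K(1) K'(1)]]) (use assms K K' in \<open>auto simp: test_fun_smooth\<close>)
qed

lemma test_fun_comp:
  assumes "test_fun A f" "smooth_fun (\<lambda>x. h (f x))" "h 0 = 0"
  shows "test_fun A (\<lambda>x. h (f x))"
proof -
  obtain K where K: "compact K" "K \<subseteq> A" "\<And>x. x \<notin> K \<Longrightarrow> f x = 0" using test_funE[OF assms(1)] by metis
  show ?thesis by (rule test_funI[OF assms(2) K(1,2)]) (use K(3) assms(3) in auto)
qed

lemma test_fun_deriv:
  assumes "test_fun A f" shows "test_fun A (\<lambda>x. cgrad f x \<bullet> v)"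
proof -
  obtain K where K: "compact K" "K \<subseteq> A" "\<And>x. x \<notin> K \<Longrightarrow> cgrad f x = 0" using test_funE[OF assms(1)] by metis
  show ?thesis by (rule test_funI[OF smooth_cgrad_inner K(1,2)]) (use K(3) assms in \<open>auto simp: test_fun_smooth\<close>)
qed

section \<open>Integrability of test functions and integration by parts\<close>

lemma continuous_compact_support_integrable:
  fixes f :: "'b::euclidean_space \<Rightarrow> 'c::euclidean_space"
  assumes "continuous_on UNIV f" "compact K" "\<And>x. x \<notin> K \<Longrightarrow> f x = 0"
  shows "integrable lborel f"
proof -
  have "integrable lborel (\<lambda>x. indicator K x *\<^sub>R f x)"
    using borel_integrable_compact[OF assms(2) continuous_on_subset[OF assms(1)]] by simp
  moreover have "(\<lambda>x. indicator K x *\<^sub>R f x) = f" using assms(3) by (auto simp: indicator_def)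
  ultimately show ?thesis by simp
qed

lemma continuous_compact_support_sqi:
  fixes f :: "'b::euclidean_space \<Rightarrow> 'c::euclidean_space"
  assumes "continuous_on UNIV f" "compact K" "\<And>x. x \<notin> K \<Longrightarrow> f x = 0"
  shows "sqi lborel f"
  unfolding sqi_def
proof
  show "integrable lborel (\<lambda>x. (norm (f x))\<^sup>2)"
    by (rule continuous_compact_support_integrable[OF _ assms(2)])
       (use assms in \<open>auto intro!: continuous_intros\<close>)
qed (use assms(1) borel_measurable_continuous_onI in auto)

lemma test_fun_sqi:
  assumes "test_fun A f"
  shows "sqi lborel f" "sqi lborel (cgrad f)" "integrable lborel f" "integrable lborel (cgrad f)"
proof -
  obtain K where K: "compact K" "K \<subseteq> A" "\<And>x. x \<notin> K \<Longrightarrow> f x = 0" "\<And>x. x \<notin> K \<Longrightarrow> cgrad f x = 0"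
    using test_funE[OF assms(1)] by metis
  note c = smooth_continuous[OF test_fun_smooth[OF assms]] cgrad_continuous[OF test_fun_smooth[OF assms]]
  show "sqi lborel f" "sqi lborel (cgrad f)" "integrable lborel f" "integrable lborel (cgrad f)"
    using continuous_compact_support_sqi[OF c(1) K(1,3)] continuous_compact_support_sqi[OF c(2) K(1,4)]
      continuous_compact_support_integrable[OF c(1) K(1,3)] continuous_compact_support_integrable[OF c(2) K(1,4)]
    by auto
qed

lemma cgrad_bounded:
  assumes "test_fun A f"
  obtains B where "\<And>x. norm (cgrad f x) \<le> B" "B \<ge> 0"
proof -
  obtain K where K: "compact K" "K \<subseteq> A" "\<And>x. x \<notin> K \<Longrightarrow> cgrad f x = 0"
    using test_funE[OF assms(1)] by metis
  have "compact (cgrad f ` K)"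
    using K(1) cgrad_continuous[OF test_fun_smooth[OF assms]] by (rule compact_continuous_image[rotated])
  then obtain B where "\<And>x. x \<in> K \<Longrightarrow> norm (cgrad f x) \<le> B"
    using compact_imp_bounded bounded_iff by (metis imageI)
  then have "norm (cgrad f x) \<le> max B 0" for x using K(3)[of x] by (cases "x \<in> K") (auto simp: le_max_iff_disj)
  then show ?thesis using that[of "max B 0"] by auto
qed

lemma smooth_Lipschitz:
  assumes "smooth_fun f" "\<And>x. norm (cgrad f x) \<le> B"
  shows "\<bar>f (x + v) - f x\<bar> \<le> B * norm v"
proof -
  have "norm (f (x + v) - f x) \<le> B * norm ((x + v) - x)"
  proof (rule differentiable_bound[of UNIV])
    show "(f has_derivative (\<lambda>v. cgrad f y \<bullet> v)) (at y within UNIV)" for y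
      using smooth_has_derivative[OF assms(1)] by simp
    show "onorm (\<lambda>v. cgrad f y \<bullet> v) \<le> B" for y
      by (intro onorm_le order_trans[OF Cauchy_Schwarz_ineq2[unfolded real_norm_def[symmetric]]] mult_right_mono assms(2)) auto
  qed auto
  then show ?thesis by simp
qed

text \<open>Prepares dominated convergence: along the steps h/(n+1) the quotients tend to the
  directional derivative, and one multiple of the indicator of a ball dominates all of them. It
  serves \<open>integral_cgrad_zero\<close> and \<open>translation_estimate\<close>.\<close>

lemma difference_quotient:
  fixes f :: "'b::euclidean_space \<Rightarrow> real" and h :: 'b
  assumes f: "test_fun A f"
    and q_def: "\<And>n x. q n x = real (Suc n) * (f (x + h /\<^sub>R real (Suc n)) - f x)"
  shows "\<exists>B r. (\<forall>x. (\<lambda>n. q n x) \<longlonglongrightarrow> cgrad f x \<bullet> h) \<and> (\<forall>n x. \<bar>q n x\<bar> \<le> B * indicator (cball 0 r) x) \<and>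
    B \<ge> 0 \<and> (\<forall>n. q n \<in> borel_measurable borel)"
proof -
  note sm = test_fun_smooth[OF f]
  obtain K where K: "compact K" "\<And>x. x \<notin> K \<Longrightarrow> f x = 0" using test_funE[OF f] by metis
  obtain r where "\<forall>x\<in>K. norm x \<le> r" using compact_imp_bounded[OF K(1)] unfolding bounded_iff by blast
  then have r: "K \<subseteq> cball 0 r" by auto
  obtain B where B: "\<And>x. norm (cgrad f x) \<le> B" "B \<ge> 0" using cgrad_bounded[OF f] by metis
  show ?thesis
  proof (intro exI conjI allI)
    show "(\<lambda>n. q n x) \<longlonglongrightarrow> cgrad f x \<bullet> h" for x
    proof -
      have "((\<lambda>t. x + t *\<^sub>R h) has_derivative (\<lambda>t. t *\<^sub>R h)) (at 0)"
        by (auto intro!: derivative_eq_intros)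
      from has_derivative_compose[OF this smooth_has_derivative[OF sm]]
      have "((\<lambda>t. f (x + t *\<^sub>R h)) has_derivative (\<lambda>t. (cgrad f x \<bullet> h) * t)) (at 0)"
        by (simp add: mult.commute)
      then have "((\<lambda>t. f (x + t *\<^sub>R h)) has_real_derivative cgrad f x \<bullet> h) (at 0)"
        by (simp only: has_field_derivative_def)
      then have "((\<lambda>t. (f (x + t *\<^sub>R h) - f x) / t) \<longlongrightarrow> cgrad f x \<bullet> h) (at 0)"
        by (simp add: DERIV_def)
      then have "(\<lambda>n. (f (x + (1 / real (Suc n)) *\<^sub>R h) - f x) / (1 / real (Suc n))) \<longlonglongrightarrow> cgrad f x \<bullet> h"
      proof (rule filterlim_compose)
        have "(\<lambda>n. 1 / real (Suc n)) \<longlonglongrightarrow> 0"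
          using LIMSEQ_inverse_real_of_nat by (simp add: inverse_eq_divide)
        then show "filterlim (\<lambda>n. 1 / real (Suc n)) (at 0) sequentially"
          by (simp add: filterlim_at del: of_nat_Suc)
      qed
      then show ?thesis by (simp add: q_def divide_inverse mult.commute)
    qed
    \<comment> \<open>Each step has length at most |h|, so a ball containing the support, enlarged
      by |h|, accounts for both arguments of the quotient.\<close>
    show "\<bar>q n x\<bar> \<le> (B * norm h) * indicator (cball 0 (r + norm h)) x" for n x
    proof (cases "x \<in> cball 0 (r + norm h)")
      case True
      have "\<bar>q n x\<bar> = real (Suc n) * \<bar>f (x + h /\<^sub>R real (Suc n)) - f x\<bar>" by (simp add: q_def abs_mult)
      also have "\<dots> \<le> real (Suc n) * (B * norm (h /\<^sub>R real (Suc n)))"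
        by (intro mult_left_mono smooth_Lipschitz sm B(1)) auto
      also have "\<dots> = B * norm h" by simp
      finally show ?thesis using True by simp
    next
      case False
      have "norm (h /\<^sub>R real (Suc n)) \<le> norm h" by (simp add: divide_simps distrib_left)
      then have "x + h /\<^sub>R real (Suc n) \<notin> cball 0 r"
        using False norm_triangle_ineq4[of "x + h /\<^sub>R real (Suc n)" "h /\<^sub>R real (Suc n)"] by auto
      moreover have "x \<notin> cball 0 r" using False norm_ge_zero[of h] by (simp del: norm_ge_zero)
      moreover have "f y = 0" if "y \<notin> cball 0 r" for y using r K(2) that by blast
      ultimately show ?thesis using False by (simp add: q_def)
    qed
    show "q n \<in> borel_measurable borel" for n unfolding q_def[abs_def]
      by (intro borel_measurable_continuous_onI continuous_intros continuous_on_compose2[OF smooth_continuous[OF sm]]) auto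
    show "0 \<le> B * norm h" using B(2) by simp
  qed
qed

text \<open>Every difference quotient has integral 0 by translation invariance, and dominated
  convergence passes this to the derivative. Integration by parts is then the product rule.\<close>

lemma integral_cgrad_zero:
  fixes f :: "'b::euclidean_space \<Rightarrow> real"
  assumes f: "test_fun A f"
  shows "(\<integral>x. cgrad f x \<bullet> h \<partial>lborel) = 0"
proof -
  define q where "q n x = real (Suc n) * (f (x + h /\<^sub>R real (Suc n)) - f x)" for n x
  obtain B r where *: "\<And>x. (\<lambda>n. q n x) \<longlonglongrightarrow> cgrad f x \<bullet> h" "\<And>n x. \<bar>q n x\<bar> \<le> B * indicator (cball 0 r) x"
    "B \<ge> 0" "\<And>n. q n \<in> borel_measurable borel"
    using difference_quotient[of A f q h, OF f q_def] by blast
  have "(\<lambda>n. \<integral>x. q n x \<partial>lborel) \<longlonglongrightarrow> (\<integral>x. cgrad f x \<bullet> h \<partial>lborel)"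
  proof (rule integral_dominated_convergence)
    show "(\<lambda>x. cgrad f x \<bullet> h) \<in> borel_measurable lborel"
      using test_fun_sqi(4)[OF f] by simp
    show "integrable lborel (\<lambda>x. B * indicator (cball 0 r :: 'b set) x)"
      by (intro integrable_mult_right integrable_real_indicator) (use emeasure_bounded_finite[OF bounded_cball, of "0::'b" r] in \<open>auto simp: less_top[symmetric]\<close>)
  qed (use * in auto)
  moreover have "(\<integral>x. q n x \<partial>lborel) = 0" for n
  proof -
    note i = test_fun_sqi(3)[OF f]
    have "f \<in> borel_measurable borel" using i by auto
    then show ?thesis using lborel_integral_shift[of f "h /\<^sub>R real (Suc n)"] i
      unfolding q_def by simp
  qed
  ultimately show ?thesis by (simp add: LIMSEQ_const_iff)
qed

lemma integration_by_parts:
  assumes "smooth_fun f" "test_fun A g"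
  shows "(\<integral>x. f x * (cgrad g x \<bullet> h) \<partial>lborel) = - (\<integral>x. (cgrad f x \<bullet> h) * g x \<partial>lborel)"
proof -
  note sg = test_fun_smooth[OF assms(2)]
  have "0 = (\<integral>x. cgrad (\<lambda>x. f x * g x) x \<bullet> h \<partial>lborel)"
    using integral_cgrad_zero[OF test_fun_mult[OF assms(2,1)]] by simp
  also have "\<dots> = (\<integral>x. (cgrad f x \<bullet> h) * g x + f x * (cgrad g x \<bullet> h) \<partial>lborel)"
    by (simp add: cgrad_mult[OF assms(1) sg] inner_add_left mult.commute)
  also have "\<dots> = (\<integral>x. (cgrad f x \<bullet> h) * g x \<partial>lborel) + (\<integral>x. f x * (cgrad g x \<bullet> h) \<partial>lborel)"
    using test_fun_sqi(3)[OF test_fun_mult[OF assms(2) smooth_cgrad_inner[OF assms(1)]]]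
      test_fun_sqi(3)[OF test_fun_mult[OF test_fun_deriv[OF assms(2)] assms(1)]]
    by (intro Bochner_Integration.integral_add) auto
  finally show ?thesis by simp
qed

text \<open>Cutting h into n equal steps, the triangle inequality and translation invariance bound
  the norm of f(x+h) - f(x) by n times the norm of f(x+h/n) - f(x). That is the norm of a difference
  quotient, and n tends to infinity.\<close>

lemma translation_estimate:
  fixes f :: "'b::euclidean_space \<Rightarrow> real"
  assumes f: "test_fun A f"
  shows "N2 lborel (\<lambda>x. f (x + h) - f x) \<le> (norm h)\<^sup>2 * N2 lborel (cgrad f)"
proof -
  note sq = test_fun_sqi[OF f]
  define q where "q n x = real (Suc n) * (f (x + h /\<^sub>R real (Suc n)) - f x)" for n x
  obtain B r where *: "\<And>x. (\<lambda>n. q n x) \<longlonglongrightarrow> cgrad f x \<bullet> h" "\<And>n x. \<bar>q n x\<bar> \<le> B * indicator (cball 0 r) x"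
    "B \<ge> 0" "\<And>n. q n \<in> borel_measurable borel"
    using difference_quotient[of A f q h, OF f q_def] by blast
  have lim: "(\<lambda>n. N2 lborel (q n)) \<longlonglongrightarrow> N2 lborel (\<lambda>x. cgrad f x \<bullet> h)"
    unfolding N2_def
  proof (rule integral_dominated_convergence)
    show "(\<lambda>x. (norm (cgrad f x \<bullet> h))\<^sup>2) \<in> borel_measurable lborel"
      using sq(4) by simp
    show "integrable lborel (\<lambda>x. B\<^sup>2 * indicator (cball 0 r :: 'b set) x)"
      by (intro integrable_mult_right integrable_real_indicator) (use emeasure_bounded_finite[OF bounded_cball, of "0::'b" r] in \<open>auto simp: less_top[symmetric]\<close>)
    show "AE x in lborel. (\<lambda>n. (norm (q n x))\<^sup>2) \<longlonglongrightarrow> (norm (cgrad f x \<bullet> h))\<^sup>2"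
      by (intro AE_I2 tendsto_intros *(1))
    show "AE x in lborel. norm ((norm (q n x))\<^sup>2) \<le> B\<^sup>2 * indicator (cball 0 r) x" for n
    proof (rule AE_I2)
      fix x
      have "\<bar>q n x\<bar>\<^sup>2 \<le> (B * indicator (cball 0 r) x)\<^sup>2" by (intro power_mono *(2)) auto
      then show "norm ((norm (q n x))\<^sup>2) \<le> B\<^sup>2 * indicator (cball 0 r) x"
        by (cases "norm x \<le> r") (auto simp: power_mult_distrib)
    qed
  qed (use *(4) in auto)
  have "sqrt (N2 lborel (\<lambda>x. f (x + h) - f x)) \<le> sqrt (N2 lborel (q n))" for n
  proof -
    let ?v = "h /\<^sub>R real (Suc n)"
    let ?d = "\<lambda>x. f (x + ?v) - f x"
    have d: "sqi lborel ?d" by (intro sqi_diff sq sqi_shift)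
    have "sqrt (N2 lborel (\<lambda>x. f (x + real k *\<^sub>R ?v) - f x)) \<le> real k * sqrt (N2 lborel ?d)" for k
    proof (induction k)
      case 0 then show ?case by (simp add: N2_def)
    next
      case (Suc k)
      have e: "(\<lambda>x. f (x + real (Suc k) *\<^sub>R ?v) - f x) =
          (\<lambda>x. ?d (x + real k *\<^sub>R ?v) + (f (x + real k *\<^sub>R ?v) - f x))"
        by (simp add: algebra_simps fun_eq_iff)
      have "sqrt (N2 lborel (\<lambda>x. f (x + real (Suc k) *\<^sub>R ?v) - f x)) \<le>
         sqrt (N2 lborel (\<lambda>x. ?d (x + real k *\<^sub>R ?v))) + sqrt (N2 lborel (\<lambda>x. f (x + real k *\<^sub>R ?v) - f x))"
        unfolding e by (rule N2_triangle) (intro sqi_shift(1) d sqi_diff sq)+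
      also have "N2 lborel (\<lambda>x. ?d (x + real k *\<^sub>R ?v)) = N2 lborel ?d"
        by (rule sqi_shift(2)[OF d])
      finally show ?case using Suc.IH by (simp add: algebra_simps)
    qed
    from this[of "Suc n"]
    have "sqrt (N2 lborel (\<lambda>x. f (x + h) - f x)) \<le> real (Suc n) * sqrt (N2 lborel ?d)" by simp
    also have "\<dots> = sqrt (N2 lborel (q n))"
      using N2_scaleR[of lborel "real (Suc n)" ?d] by (simp add: q_def[abs_def] real_sqrt_mult)
    finally show ?thesis .
  qed
  then have "N2 lborel (\<lambda>x. f (x + h) - f x) \<le> N2 lborel (q n)" for n by simp
  then have "N2 lborel (\<lambda>x. f (x + h) - f x) \<le> N2 lborel (\<lambda>x. cgrad f x \<bullet> h)"
    by (intro LIMSEQ_le_const[OF lim]) auto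
  also have "\<dots> \<le> (\<integral>x. (norm h)\<^sup>2 * (norm (cgrad f x))\<^sup>2 \<partial>lborel)"
    unfolding N2_def
  proof (rule integral_mono')
    show "integrable lborel (\<lambda>x. (norm h)\<^sup>2 * (norm (cgrad f x))\<^sup>2)"
      using sqi_integrable[OF sq(2)] by simp
    show "(norm (cgrad f x \<bullet> h))\<^sup>2 \<le> (norm h)\<^sup>2 * (norm (cgrad f x))\<^sup>2" for x
      using power_mono[OF Cauchy_Schwarz_ineq2[of "cgrad f x" h], of 2] by (simp add: power_mult_distrib mult.commute)
  qed auto
  finally show ?thesis by (simp add: N2_def)
qed

text \<open>Convolution with the reflected kernel, written as an average of translates so that a
  translation estimate applies directly. The kernel may have any total mass.\<close>

definition smear :: "('b::euclidean_space \<Rightarrow> real) \<Rightarrow> ('b \<Rightarrow> real) \<Rightarrow> 'b \<Rightarrow> real" where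
  "smear \<rho> u x = (\<integral>h. \<rho> h * u (x + h) \<partial>lborel)"

text \<open>The error is the \<rho>-average of u(x+h) - u(x). Writing \<rho> as a product of two
  square roots, Cauchy-Schwarz bounds its square by c times the \<rho>-average of the squared
  differences; Tonelli and the translation bound for |h| <= d then produce d^2. This rate, uniform
  over functions with a common energy bound, drives both Rellich's theorem and the maximum
  principle.\<close>

lemma smear_estimate:
  fixes u \<rho> :: "'b::euclidean_space \<Rightarrow> real"
  assumes \<rho>: "sqi lborel \<rho>" "integrable lborel \<rho>" "\<And>h. \<rho> h \<ge> 0" "\<And>h. norm h > d \<Longrightarrow> \<rho> h = 0"
    and c: "(\<integral>h. \<rho> h \<partial>lborel) = c"
    and u: "sqi lborel u" "\<And>h. N2 lborel (\<lambda>x. u (x + h) - u x) \<le> (norm h)\<^sup>2 * M"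
  shows "sqi lborel (smear \<rho> u)" "N2 lborel (\<lambda>x. smear \<rho> u x - c * u x) \<le> c\<^sup>2 * d\<^sup>2 * M"
proof -
  have [measurable]: "u \<in> borel_measurable borel" "\<rho> \<in> borel_measurable borel"
    using u \<rho> by (auto simp: sqi_def)
  have cnn: "c \<ge> 0" unfolding c[symmetric] by (rule integral_nonneg_AE) (simp add: \<rho>(3))
  have Mnn: "M \<ge> 0"
  proof -
    obtain b :: 'b where "b \<in> Basis" using nonempty_Basis by blast
    then show ?thesis using u(2)[of b] N2_nonneg[of lborel "\<lambda>x. u (x + b) - u x"] by simp
  qed
  let ?D = "\<lambda>x. smear \<rho> u x - c * u x"
  have D: "?D x = (\<integral>h. \<rho> h * (u (x + h) - u x) \<partial>lborel)" for x
  proof -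
    have "integrable lborel (\<lambda>h. \<rho> h * u (x + h))"
      using sqi_integrable_mult[OF \<rho>(1) sqi_shift(1)[OF u(1), of x]] by (simp add: add.commute)
    then show ?thesis using \<rho>(2) c by (simp add: smear_def right_diff_distrib)
  qed
  have m [measurable]: "smear \<rho> u \<in> borel_measurable borel"
  proof -
    have "smear \<rho> u \<in> borel_measurable lborel" unfolding smear_def[abs_def] by measurable
    then show ?thesis by simp
  qed
  have pt: "(ennreal ((norm (?D x))\<^sup>2)) \<le> ennreal c * (\<integral>\<^sup>+h. ennreal (\<rho> h) * ennreal ((u (x + h) - u x)\<^sup>2) \<partial>lborel)" for x
  proof -
    let ?g = "\<lambda>h. \<rho> h * (u (x + h) - u x)"
    have "ennreal (norm (?D x)) \<le> (\<integral>\<^sup>+h. ennreal (norm (?g h)) \<partial>lborel)"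
    \<comment> \<open>The integral of a non-integrable function is 0 by convention, and the bound is
      then trivial.\<close>
    proof (cases "integrable lborel ?g")
      case True then show ?thesis unfolding D by (rule integral_norm_bound_ennreal)
    qed (simp add: D not_integrable_integral_eq)
    also have "\<dots> = (\<integral>\<^sup>+h. ennreal (sqrt (\<rho> h)) * ennreal (sqrt (\<rho> h) * \<bar>u (x + h) - u x\<bar>) \<partial>lborel)"
      by (intro nn_integral_cong) (simp add: ennreal_mult'[symmetric] \<rho>(3) abs_mult mult.assoc[symmetric])
    finally have "(ennreal (norm (?D x)))\<^sup>2 \<le> (\<integral>\<^sup>+h. ennreal (sqrt (\<rho> h)) * ennreal (sqrt (\<rho> h) * \<bar>u (x + h) - u x\<bar>) \<partial>lborel)\<^sup>2"
      by (rule power_mono) simp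
    also have "\<dots> \<le> (\<integral>\<^sup>+h. (ennreal (sqrt (\<rho> h)))\<^sup>2 \<partial>lborel) * (\<integral>\<^sup>+h. (ennreal (sqrt (\<rho> h) * \<bar>u (x + h) - u x\<bar>))\<^sup>2 \<partial>lborel)"
      by (rule Cauchy_Schwarz_nn_integral) measurable
    also have "(\<integral>\<^sup>+h. (ennreal (sqrt (\<rho> h)))\<^sup>2 \<partial>lborel) = ennreal c"
      using nn_integral_eq_integral[OF \<rho>(2)] \<rho>(3) c by (simp add: ennreal_power)
    also have "(\<integral>\<^sup>+h. (ennreal (sqrt (\<rho> h) * \<bar>u (x + h) - u x\<bar>))\<^sup>2 \<partial>lborel)
        = (\<integral>\<^sup>+h. ennreal (\<rho> h) * ennreal ((u (x + h) - u x)\<^sup>2) \<partial>lborel)"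
      by (intro nn_integral_cong) (simp add: ennreal_power \<rho>(3) power_mult_distrib ennreal_mult)
    finally show ?thesis by (simp add: ennreal_power)
  qed
  have "(\<integral>\<^sup>+x. ennreal ((norm (?D x))\<^sup>2) \<partial>lborel)
      \<le> (\<integral>\<^sup>+x. ennreal c * (\<integral>\<^sup>+h. ennreal (\<rho> h) * ennreal ((u (x + h) - u x)\<^sup>2) \<partial>lborel) \<partial>lborel)"
    by (intro nn_integral_mono pt)
  also have "\<dots> = ennreal c * (\<integral>\<^sup>+x. (\<integral>\<^sup>+h. ennreal (\<rho> h) * ennreal ((u (x + h) - u x)\<^sup>2) \<partial>lborel) \<partial>lborel)"
    by (rule nn_integral_cmult) measurable
  also have "(\<integral>\<^sup>+x. (\<integral>\<^sup>+h. ennreal (\<rho> h) * ennreal ((u (x + h) - u x)\<^sup>2) \<partial>lborel) \<partial>lborel)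
      = (\<integral>\<^sup>+h. (\<integral>\<^sup>+x. ennreal (\<rho> h) * ennreal ((u (x + h) - u x)\<^sup>2) \<partial>lborel) \<partial>lborel)"
    by (rule lborel_pair.Fubini'[symmetric]) measurable
  also have "\<dots> \<le> (\<integral>\<^sup>+h. ennreal (\<rho> h) * ennreal (d\<^sup>2 * M) \<partial>lborel)"
  proof (intro nn_integral_mono)
    fix h :: 'b
    have "(\<integral>\<^sup>+x. ennreal (\<rho> h) * ennreal ((u (x + h) - u x)\<^sup>2) \<partial>lborel) = ennreal (\<rho> h) * ennreal (N2 lborel (\<lambda>x. u (x + h) - u x))"
      using sqi_nn_integral[OF sqi_diff[OF sqi_shift(1)[OF u(1)] u(1)], of h] by (simp add: nn_integral_cmult)
    also have "\<dots> \<le> ennreal (\<rho> h) * ennreal (d\<^sup>2 * M)"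
    proof (cases "norm h > d")
      case False
      then have "(norm h)\<^sup>2 * M \<le> d\<^sup>2 * M" by (intro mult_right_mono power_mono Mnn) auto
      then show ?thesis using u(2)[of h] by (intro mult_left_mono ennreal_leI) auto
    qed (simp add: \<rho>(4))
    finally show "(\<integral>\<^sup>+x. ennreal (\<rho> h) * ennreal ((u (x + h) - u x)\<^sup>2) \<partial>lborel) \<le> ennreal (\<rho> h) * ennreal (d\<^sup>2 * M)" .
  qed
  also have "\<dots> = ennreal c * ennreal (d\<^sup>2 * M)"
    using nn_integral_eq_integral[OF \<rho>(2)] \<rho>(3) c by (simp add: nn_integral_multc)
  also have "ennreal c * (ennreal c * ennreal (d\<^sup>2 * M)) = ennreal (c\<^sup>2 * d\<^sup>2 * M)"
    using cnn Mnn by (simp add: ennreal_mult'[symmetric] power2_eq_square mult.assoc)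
  finally have b: "(\<integral>\<^sup>+x. ennreal ((norm (?D x))\<^sup>2) \<partial>lborel) \<le> ennreal (c\<^sup>2 * d\<^sup>2 * M)"
    by (simp add: mult_left_mono)
  have DD: "sqi lborel ?D" "N2 lborel ?D \<le> c\<^sup>2 * d\<^sup>2 * M"
    using sqi_nn_integral_bound[OF _ b] Mnn by auto
  then show "N2 lborel ?D \<le> c\<^sup>2 * d\<^sup>2 * M" by simp
  show "sqi lborel (smear \<rho> u)"
    using sqi_add[OF DD(1) sqi_scaleR[OF u(1), of c]] by simp
qed

section \<open>Uniqueness of the weak gradient\<close>

lemma flat_pos_iff: "flat t > 0 \<longleftrightarrow> t > 0" and flat_nonneg: "flat t \<ge> 0" and flat_le_1: "flat t \<le> 1"
  by (auto simp: flat_def)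

definition box_bump :: "'b::euclidean_space \<Rightarrow> 'b \<Rightarrow> 'b \<Rightarrow> real" where
  "box_bump a b x = (\<Prod>i\<in>Basis. flat ((x - a) \<bullet> i) * flat ((b - x) \<bullet> i))"

lemma box_bump_smooth: "smooth_fun (box_bump a b)"
proof -
  have "smooth_fun (\<lambda>x. flat (x \<bullet> i - a \<bullet> i) * flat (b \<bullet> i - x \<bullet> i))" for i
    by (intro smooth_mult smooth_flat smooth_diff smooth_inner smooth_const)
  then have "smooth_fun (\<lambda>x. \<Prod>i\<in>Basis. flat (x \<bullet> i - a \<bullet> i) * flat (b \<bullet> i - x \<bullet> i))"
    by (intro smooth_prod)
  then show ?thesis by (simp add: box_bump_def[abs_def] inner_diff_left)
qed

lemma box_bump_nonneg: "box_bump a b x \<ge> 0"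
  by (auto simp: box_bump_def flat_nonneg intro!: prod_nonneg)

lemma box_bump_pos: "x \<in> box a b \<Longrightarrow> box_bump a b x > 0"
  by (auto simp: box_bump_def flat_pos_iff mem_box inner_diff_left intro!: prod_pos)

lemma box_bump_zero:
  assumes "x \<notin> box a b" shows "box_bump a b x = 0"
proof -
  obtain i where i: "i \<in> Basis" "\<not> (a \<bullet> i < x \<bullet> i \<and> x \<bullet> i < b \<bullet> i)" using assms by (auto simp: mem_box)
  then have "flat ((x - a) \<bullet> i) * flat ((b - x) \<bullet> i) = 0" by (auto simp: flat_def inner_diff_left)
  then show ?thesis using i(1) unfolding box_bump_def by (intro prod_zero) auto
qed

lemma enn2real_inject_finite: "a \<noteq> \<infinity> \<Longrightarrow> b \<noteq> \<infinity> \<Longrightarrow> enn2real a = enn2real b \<Longrightarrow> a = b"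
  by (metis ennreal_enn2real infinity_ennreal_def less_top)

text \<open>The positive and the negative part of w are densities of two finite measures that agree
  on all open boxes. Boxes are stable under intersection and generate the Borel sets, so the
  measures coincide, and with them the densities.\<close>

lemma AE_zero_if_box_integrals_zero:
  fixes w :: "'b::euclidean_space \<Rightarrow> real"
  assumes w: "integrable lborel w"
    and z: "\<And>a b. (\<integral>x. indicator (box a b) x * w x \<partial>lborel) = 0"
  shows "AE x in lborel. w x = 0"
proof -
  have [measurable]: "w \<in> borel_measurable borel" using w by auto
  \<comment> \<open>\<open>ennreal\<close> sends negative numbers to 0, so these are the positive
    and the negative part of w.\<close>
  let ?p = "\<lambda>x. ennreal (w x)" and ?n = "\<lambda>x. ennreal (- w x)"
  have fin: "(\<integral>\<^sup>+x. ?p x \<partial>lborel) \<noteq> \<infinity>" "(\<integral>\<^sup>+x. ?n x \<partial>lborel) \<noteq> \<infinity>"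
    using w by (auto simp: real_integrable_def)
  have "density lborel ?p = density lborel ?n"
  proof (rule measure_eqI_generator_eq)
    let ?E = "range (\<lambda>(a, b). box a b::'b set)"
    show "Int_stable ?E" by (auto simp: Int_stable_def box_Int_box)
    show "?E \<subseteq> Pow UNIV" "sets (density lborel ?p) = sigma_sets UNIV ?E" "sets (density lborel ?n) = sigma_sets UNIV ?E"
      by (simp_all add: borel_eq_box)
    let ?A = "\<lambda>n::nat. box (- (real n *\<^sub>R One)) (real n *\<^sub>R One) :: 'b set"
    show "range ?A \<subseteq> ?E" "(\<Union>i. ?A i) = UNIV"
      unfolding UN_box_eq_UNIV by auto
    show "emeasure (density lborel ?p) (?A i) \<noteq> \<infinity>" for i
    proof -
      have "emeasure (density lborel ?p) (?A i) \<le> (\<integral>\<^sup>+x. ?p x \<partial>lborel)"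
        by (subst emeasure_density) (auto intro!: nn_integral_mono simp: indicator_def)
      then show ?thesis using fin(1) by (auto simp: top_unique)
    qed
    show "emeasure (density lborel ?p) X = emeasure (density lborel ?n) X" if "X \<in> ?E" for X
    proof -
      obtain a b where X: "X = box a b" using \<open>X \<in> ?E\<close> by auto
      let ?w = "\<lambda>x. indicator (box a b) x * w x"
      have i: "integrable lborel ?w"
        using integrable_mult_indicator[OF _ w, of "box a b"] by simp
      have e: "emeasure (density lborel ?p) X = (\<integral>\<^sup>+x. ennreal (?w x) \<partial>lborel)"
              "emeasure (density lborel ?n) X = (\<integral>\<^sup>+x. ennreal (- ?w x) \<partial>lborel)"
      proof -
        have "emeasure (density lborel h) X = (\<integral>\<^sup>+x. h x * indicator X x \<partial>lborel)"
          if "h \<in> borel_measurable lborel" for h :: "'b \<Rightarrow> ennreal"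
          using that by (rule emeasure_density) (simp add: X)
        then have "emeasure (density lborel ?p) X = (\<integral>\<^sup>+x. ?p x * indicator X x \<partial>lborel)"
          "emeasure (density lborel ?n) X = (\<integral>\<^sup>+x. ?n x * indicator X x \<partial>lborel)" by simp_all
        moreover have "?p x * indicator X x = ennreal (?w x)" "?n x * indicator X x = ennreal (- ?w x)" for x
          by (cases "x \<in> X"; simp add: X)+
        ultimately show "emeasure (density lborel ?p) X = (\<integral>\<^sup>+x. ennreal (?w x) \<partial>lborel)"
              "emeasure (density lborel ?n) X = (\<integral>\<^sup>+x. ennreal (- ?w x) \<partial>lborel)" by simp_all
      qed
      have f: "(\<integral>\<^sup>+x. ennreal (?w x) \<partial>lborel) \<noteq> \<infinity>" "(\<integral>\<^sup>+x. ennreal (- ?w x) \<partial>lborel) \<noteq> \<infinity>"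
        using i by (auto simp: real_integrable_def)
      have "enn2real (\<integral>\<^sup>+x. ennreal (?w x) \<partial>lborel) = enn2real (\<integral>\<^sup>+x. ennreal (- ?w x) \<partial>lborel)"
        using z[of a b] real_lebesgue_integral_def[OF i] by simp
      with f show ?thesis unfolding e by (rule enn2real_inject_finite)
    qed
  qed
  then have "AE x in lborel. ?p x = ?n x"
    by (subst (asm) finite_density_unique) (use fin in auto)
  then show ?thesis
  proof eventually_elim
    case (elim x)
    then show ?case by (cases "w x \<ge> 0") (auto simp: ennreal_neg ennreal_eq_0_iff)
  qed
qed

text \<open>Inside a closed box contained in A, the test functions 1 - exp(-n q), with q smooth and
  positive exactly on an intersection of two open boxes, increase to the indicator of that
  intersection. Dominated convergence turns the hypothesis into vanishing integrals over boxes, and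
  countably many closed boxes cover A.\<close>

lemma fundamental_lemma:
  fixes v :: "'b::euclidean_space \<Rightarrow> real"
  assumes A: "open A" and [measurable]: "v \<in> borel_measurable borel"
    and loc: "\<And>K. compact K \<Longrightarrow> K \<subseteq> A \<Longrightarrow> integrable lborel (\<lambda>x. indicator K x * v x)"
    and z: "\<And>\<phi>. test_fun A \<phi> \<Longrightarrow> (\<integral>x. v x * \<phi> x \<partial>lborel) = 0"
  shows "AE x in lborel. x \<in> A \<longrightarrow> v x = 0"
proof -
  have box: "AE x in lborel. x \<in> cbox a b \<longrightarrow> v x = 0" if ab: "cbox a b \<subseteq> A" for a b
  proof -
    let ?w = "\<lambda>x. indicator (box a b) x * v x"
    have sub: "box a b \<subseteq> cbox a b" by (rule box_subset_cbox)
    have ic: "integrable lborel (\<lambda>x. indicator (cbox a b) x * v x)" using loc ab by simp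
    have iw: "integrable lborel ?w"
      by (rule Bochner_Integration.integrable_bound[OF ic]) (use sub in \<open>auto intro!: AE_I2 split: split_indicator\<close>)
    have "AE x in lborel. ?w x = 0"
    proof (rule AE_zero_if_box_integrals_zero[OF iw])
      fix c d :: 'b
      define q where "q x = box_bump c d x * box_bump a b x" for x
      define \<phi> where "\<phi> n x = 1 - exp (- (real n * q x))" for n x
      have qs: "smooth_fun q" unfolding q_def[abs_def] by (intro smooth_mult box_bump_smooth)
      have qn: "q x \<ge> 0" for x by (simp add: q_def box_bump_nonneg)
      have t: "test_fun A (\<phi> n)" for n
      proof (rule test_funI)
        show "smooth_fun (\<phi> n)" unfolding \<phi>_def[abs_def]
          using smooth_diff[OF smooth_const smooth_exp[OF smooth_cmult[OF qs, of "- real n"]], of 1] by simp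
        show "compact (cbox a b)" "cbox a b \<subseteq> A" using ab by auto
        show "\<phi> n x = 0" if "x \<notin> cbox a b" for x
          using box_bump_zero[of x a b] that sub by (auto simp: \<phi>_def q_def)
      qed
      have b: "0 \<le> \<phi> n x" "\<phi> n x \<le> 1" for n x using qn[of x] by (auto simp: \<phi>_def)
      have l: "(\<lambda>n. \<phi> n x) \<longlonglongrightarrow> indicator (box c d) x * indicator (box a b) x" for x
      proof (cases "x \<in> box c d \<and> x \<in> box a b")
        case True
        then have "q x > 0" by (simp add: q_def box_bump_pos)
        then have "filterlim (\<lambda>n. real n * q x) at_top sequentially"
          by (intro filterlim_tendsto_pos_mult_at_top[OF tendsto_const, of "q x", simplified mult.commute] filterlim_real_sequentially)
        then have "(\<lambda>n. exp (- (real n * q x))) \<longlonglongrightarrow> 0"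
          by (intro filterlim_compose[OF exp_at_bot] filterlim_compose[OF filterlim_uminus_at_bot_at_top])
        then show ?thesis using True tendsto_diff[OF tendsto_const, of _ 0 sequentially 1] by (simp add: \<phi>_def)
      next
        case False
        then have "q x = 0" by (auto simp: q_def box_bump_zero)
        then show ?thesis using False by (auto simp: \<phi>_def split: split_indicator)
      qed
      have "(\<lambda>n. \<integral>x. v x * \<phi> n x \<partial>lborel) \<longlonglongrightarrow> (\<integral>x. indicator (box c d) x * ?w x \<partial>lborel)"
      proof (rule integral_dominated_convergence[where w = "\<lambda>x. norm (indicator (cbox a b) x * v x)"])
        show "(\<lambda>x. v x * \<phi> n x) \<in> borel_measurable lborel" for n
          using test_fun_sqi(3)[OF t[of n]] by simp
        show "AE x in lborel. (\<lambda>n. v x * \<phi> n x) \<longlonglongrightarrow> indicator (box c d) x * ?w x"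
          using tendsto_mult[OF tendsto_const l] by (intro AE_I2) (simp add: ac_simps)
        show "AE x in lborel. norm (v x * \<phi> n x) \<le> norm (indicator (cbox a b) x * v x)" for n
        proof (rule AE_I2)
          fix x
          show "norm (v x * \<phi> n x) \<le> norm (indicator (cbox a b) x * v x)"
          proof (cases "x \<in> cbox a b")
            case True then show ?thesis using b[of n x] by (simp add: abs_mult mult_left_le)
          next
            case False
            then have "\<phi> n x = 0" using box_bump_zero[of x a b] sub by (auto simp: \<phi>_def q_def)
            then show ?thesis by simp
          qed
        qed
      qed (use ic in auto)
      moreover have "(\<integral>x. v x * \<phi> n x \<partial>lborel) = 0" for n by (rule z[OF t])
      ultimately show "(\<integral>x. indicator (box c d) x * ?w x \<partial>lborel) = 0"
        by (simp add: LIMSEQ_const_iff)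
    qed
    \<comment> \<open>The bumps vanish on the boundary of the box and see only its interior; the
      boundary has measure zero.\<close>
    moreover have "AE x in lborel. x \<notin> cbox a b - box a b"
    proof -
      have "cbox a b - box a b \<in> null_sets lborel"
        by (auto simp: null_sets_def emeasure_lborel_cbox_eq emeasure_lborel_box_eq emeasure_Diff sub)
      then show ?thesis by (rule AE_not_in)
    qed
    ultimately show ?thesis by eventually_elim (auto split: split_indicator_asm)
  qed
  obtain D where D: "countable D" "\<And>X. X \<in> D \<Longrightarrow> X \<subseteq> A \<and> (\<exists>a b. X = cbox a b)" "\<Union>D = A"
    using open_countable_Union_open_cbox[OF A] by (metis PowD subsetD)
  have "AE x in lborel. \<forall>X\<in>D. x \<in> X \<longrightarrow> v x = 0"
    using D(2) box by (subst AE_ball_countable[OF D(1)]) metis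
  then show ?thesis by eventually_elim (use D(3) in blast)
qed

section \<open>From Lebesgue measure on A to Borel functions on the whole space\<close>

lemma ex_borel_version:
  fixes f :: "'b::euclidean_space \<Rightarrow> 'c::euclidean_space"
  assumes A: "A \<in> sets borel" and f: "f \<in> borel_measurable (lebesgue_on A)"
  shows "\<exists>F\<in>borel_measurable borel. (\<forall>x. x \<notin> A \<longrightarrow> F x = 0) \<and> (AE x in lborel. x \<in> A \<longrightarrow> f x = F x)"
proof -
  have AL: "A \<inter> space lebesgue \<in> sets lebesgue" using A by simp
  have m: "(\<lambda>x. indicator A x *\<^sub>R f x) \<in> borel_measurable lebesgue"
    using f by (simp add: borel_measurable_restrict_space_iff[OF AL])
  have "\<forall>i. \<exists>g. g \<in> borel_measurable lborel \<and> (AE x in lborel. (indicator A x *\<^sub>R f x) \<bullet> i = g x)" 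
    using completion_ex_borel_measurable_real[OF borel_measurable_inner[OF m borel_measurable_const]] by blast
  then obtain g where g: "\<And>i. g i \<in> borel_measurable lborel" "\<And>i. AE x in lborel. (indicator A x *\<^sub>R f x) \<bullet> i = g i x"
    by metis
  have [measurable]: "g i \<in> borel_measurable borel" for i using g(1)[of i] by simp
  note [measurable] = A
  define F where "F x = indicator A x *\<^sub>R (\<Sum>i\<in>Basis. g i x *\<^sub>R i)" for x
  have "AE x in lborel. \<forall>i\<in>Basis. (indicator A x *\<^sub>R f x) \<bullet> i = g i x"
    by (intro AE_finite_allI finite_Basis g(2))
  then have "AE x in lborel. x \<in> A \<longrightarrow> f x = F x"
    by eventually_elim (auto simp: F_def intro!: euclidean_eqI[where 'a='c])
  moreover have "F \<in> borel_measurable borel" unfolding F_def[abs_def] by measurable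
  ultimately show ?thesis by (intro bexI[of _ F]) (auto simp: F_def)
qed

lemma AE_lebesgue_on_iff:
  "A \<in> sets borel \<Longrightarrow> (AE x in lebesgue_on A. P x) \<longleftrightarrow> (AE x in lborel. x \<in> A \<longrightarrow> P x)"
  by (subst AE_restrict_space_iff) (auto simp: AE_completion_iff)

text \<open>Agreement inside A and vanishing outside are asked only almost everywhere, because
  limits in L^2 are determined no further. The integrals of the definitions become integrals over
  \<open>lborel\<close> by this lemma.\<close>

lemma lebesgue_on_transfer:
  fixes f :: "'b::euclidean_space \<Rightarrow> 'c::euclidean_space"
  assumes A: "A \<in> sets borel" and f: "f \<in> borel_measurable (lebesgue_on A)"
    and F: "F \<in> borel_measurable borel"
    and eq: "AE x in lborel. x \<in> A \<longrightarrow> f x = F x" and off: "AE x in lborel. x \<notin> A \<longrightarrow> F x = 0"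
  shows "(\<integral>x. f x \<partial>lebesgue_on A) = (\<integral>x. F x \<partial>lborel)"
    and "integrable (lebesgue_on A) f \<longleftrightarrow> integrable lborel F"
proof -
  have AL: "A \<inter> space lebesgue \<in> sets lebesgue" using A by simp
  have m: "(\<lambda>x. indicator A x *\<^sub>R f x) \<in> borel_measurable lebesgue"
    using f by (simp add: borel_measurable_restrict_space_iff[OF AL])
  have FL: "F \<in> borel_measurable lebesgue" using F by (intro measurable_completion) simp
  have ae: "AE x in lebesgue. indicator A x *\<^sub>R f x = F x"
    unfolding AE_completion_iff using eq off by eventually_elim (auto split: split_indicator)
  have F': "F \<in> borel_measurable lborel" using F by simp
  show "(\<integral>x. f x \<partial>lebesgue_on A) = (\<integral>x. F x \<partial>lborel)"
    unfolding integral_restrict_space[OF AL] integral_completion[OF F', symmetric]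
    by (rule integral_cong_AE[OF m FL ae])
  show "integrable (lebesgue_on A) f \<longleftrightarrow> integrable lborel F"
    unfolding integrable_restrict_space[OF AL] integrable_completion[OF F', symmetric]
    by (rule integrable_cong_AE[OF m FL ae])
qed

lemma borel_imp_lebesgue_on: "F \<in> borel_measurable borel \<Longrightarrow> F \<in> borel_measurable (lebesgue_on A)"
  by (intro measurable_restrict_space1 measurable_completion) simp

text \<open>Completeness of Lebesgue measure: the two preimages of a Borel set differ by a null
  set.\<close>

lemma borel_measurable_lebesgue_AE:
  fixes f g :: "'b::euclidean_space \<Rightarrow> 'c::euclidean_space"
  assumes f: "f \<in> borel_measurable lebesgue" and eq: "AE x in lebesgue. f x = g x"
  shows "g \<in> borel_measurable lebesgue"
proof (rule measurableI)
  fix S :: "'c set" assume S: "S \<in> sets borel"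
  show "g -` S \<inter> space lebesgue \<in> sets lebesgue"
  proof (rule completion.in_sets_AE)
    show "AE x in lebesgue. x \<in> f -` S \<inter> space lebesgue \<longleftrightarrow> x \<in> g -` S \<inter> space lebesgue"
      using eq by eventually_elim auto
    show "f -` S \<inter> space lebesgue \<in> sets lebesgue" by (rule measurable_sets[OF f S])
  qed auto
qed auto

lemma AE_imp_borel_measurable_lebesgue_on:
  fixes f :: "'b::euclidean_space \<Rightarrow> 'c::euclidean_space"
  assumes A: "A \<in> sets borel" and "F \<in> borel_measurable borel"
    and eq: "AE x in lborel. x \<in> A \<longrightarrow> f x = F x"
  shows "f \<in> borel_measurable (lebesgue_on A)"
proof -
  have AL: "A \<inter> space lebesgue \<in> sets lebesgue" using A by simp
  have "(\<lambda>x. indicator A x *\<^sub>R f x) \<in> borel_measurable lebesgue"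
  proof (rule borel_measurable_lebesgue_AE)
    show "(\<lambda>x. indicator A x *\<^sub>R F x) \<in> borel_measurable lebesgue"
      using A assms(2) by (intro measurable_completion) simp
    show "AE x in lebesgue. indicator A x *\<^sub>R F x = indicator A x *\<^sub>R f x"
      unfolding AE_completion_iff using eq by eventually_elim (auto split: split_indicator)
  qed
  then show ?thesis by (simp add: borel_measurable_restrict_space_iff[OF AL])
qed

section \<open>The space of pairs of a function and its weak gradient\<close>

text \<open>Elements of $W^{1,2}_0(A)$ together with their weak gradient, both extended by zero to the whole space.\<close>

definition h10_pair :: "'b::euclidean_space set \<Rightarrow> ('b \<Rightarrow> real) \<Rightarrow> ('b \<Rightarrow> 'b) \<Rightarrow> bool" where
  "h10_pair A U G \<longleftrightarrow> sqi lborel U \<and> sqi lborel G \<and>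
     (\<exists>\<phi>::nat \<Rightarrow> 'b \<Rightarrow> real. (\<forall>n. test_fun A (\<phi> n)) \<and>
        (\<lambda>n. N2 lborel (\<lambda>x. U x - \<phi> n x)) \<longlonglongrightarrow> 0 \<and>
        (\<lambda>n. N2 lborel (\<lambda>x. G x - cgrad (\<phi> n) x)) \<longlonglongrightarrow> 0)"

lemma h10_pair_test: "test_fun A \<phi> \<Longrightarrow> h10_pair A \<phi> (cgrad \<phi>)"
  unfolding h10_pair_def using test_fun_sqi[of A \<phi>] by (intro conjI exI[of _ "\<lambda>n. \<phi>"]) (auto simp: N2_def)

lemma h10_pair_add:
  assumes "h10_pair A U G" "h10_pair A V H"
  shows "h10_pair A (\<lambda>x. U x + V x) (\<lambda>x. G x + H x)"
proof -
  obtain \<phi> where \<phi>: "sqi lborel U" "sqi lborel G" "\<forall>n. test_fun A (\<phi> n)"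
    "(\<lambda>n. N2 lborel (\<lambda>x. U x - \<phi> n x)) \<longlonglongrightarrow> 0" "(\<lambda>n. N2 lborel (\<lambda>x. G x - cgrad (\<phi> n) x)) \<longlonglongrightarrow> 0"
    using assms(1) unfolding h10_pair_def by blast
  obtain \<psi> where \<psi>: "sqi lborel V" "sqi lborel H" "\<forall>n. test_fun A (\<psi> n)"
    "(\<lambda>n. N2 lborel (\<lambda>x. V x - \<psi> n x)) \<longlonglongrightarrow> 0" "(\<lambda>n. N2 lborel (\<lambda>x. H x - cgrad (\<psi> n) x)) \<longlonglongrightarrow> 0"
    using assms(2) unfolding h10_pair_def by blast
  note t = \<phi>(3)[rule_format] \<psi>(3)[rule_format]
  have g: "cgrad (\<lambda>x. \<phi> n x + \<psi> n x) = (\<lambda>x. cgrad (\<phi> n) x + cgrad (\<psi> n) x)" for n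
    using cgrad_add[OF test_fun_smooth[OF t(1)] test_fun_smooth[OF t(2)]] by auto
  show ?thesis unfolding h10_pair_def
    by (intro conjI exI[of _ "\<lambda>n x. \<phi> n x + \<psi> n x"] sqi_add \<phi> \<psi> allI test_fun_add t)
       (auto simp only: g intro!: L2_limit_add \<phi> \<psi> test_fun_sqi[OF t(1)] test_fun_sqi[OF t(2)])
qed

lemma h10_pair_cmult:
  assumes "h10_pair A U G"
  shows "h10_pair A (\<lambda>x. c * U x) (\<lambda>x. c *\<^sub>R G x)"
proof -
  obtain \<phi> where \<phi>: "sqi lborel U" "sqi lborel G" "\<forall>n. test_fun A (\<phi> n)"
    "(\<lambda>n. N2 lborel (\<lambda>x. U x - \<phi> n x)) \<longlonglongrightarrow> 0" "(\<lambda>n. N2 lborel (\<lambda>x. G x - cgrad (\<phi> n) x)) \<longlonglongrightarrow> 0"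
    using assms(1) unfolding h10_pair_def by blast
  have e: "N2 lborel (\<lambda>x. c * U x - c * \<phi> n x) = c\<^sup>2 * N2 lborel (\<lambda>x. U x - \<phi> n x)"
     "N2 lborel (\<lambda>x. c *\<^sub>R G x - cgrad (\<lambda>x. c * \<phi> n x) x) = c\<^sup>2 * N2 lborel (\<lambda>x. G x - cgrad (\<phi> n) x)" for n
    using N2_scaleR[of lborel c "\<lambda>x. U x - \<phi> n x"] N2_scaleR[of lborel c "\<lambda>x. G x - cgrad (\<phi> n) x"]
      cgrad_cmult[OF test_fun_smooth[OF \<phi>(3)[rule_format, of n]]]
    by (simp_all add: algebra_simps)
  have l: "(\<lambda>n. c\<^sup>2 * N2 lborel (\<lambda>x. U x - \<phi> n x)) \<longlonglongrightarrow> 0"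
    "(\<lambda>n. c\<^sup>2 * N2 lborel (\<lambda>x. G x - cgrad (\<phi> n) x)) \<longlonglongrightarrow> 0"
    using tendsto_mult[OF tendsto_const \<phi>(4), of "c\<^sup>2"] tendsto_mult[OF tendsto_const \<phi>(5), of "c\<^sup>2"] by auto
  show ?thesis unfolding h10_pair_def
    using \<phi> l sqi_scaleR[OF \<phi>(1), of c] sqi_scaleR[OF \<phi>(2), of c]
    by (intro conjI exI[of _ "\<lambda>n x. c * \<phi> n x"]) (auto simp: e test_fun_cmult)
qed

text \<open>Integration by parts for the approximating test functions passes to the limit. The set B
  is arbitrary: since U and G are extended by zero, the identity holds on the whole space.\<close>

lemma h10_pair_weak:
  assumes "h10_pair A U G" "test_fun B \<psi>"
  shows "(\<integral>x. U x * (cgrad \<psi> x \<bullet> b) \<partial>lborel) = - (\<integral>x. (G x \<bullet> b) * \<psi> x \<partial>lborel)"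
proof -
  obtain \<phi> where \<phi>: "sqi lborel U" "sqi lborel G" "\<forall>n. test_fun A (\<phi> n)"
    "(\<lambda>n. N2 lborel (\<lambda>x. U x - \<phi> n x)) \<longlonglongrightarrow> 0" "(\<lambda>n. N2 lborel (\<lambda>x. G x - cgrad (\<phi> n) x)) \<longlonglongrightarrow> 0"
    using assms(1) unfolding h10_pair_def by blast
  note t = \<phi>(3)[rule_format]
  have s: "sqi lborel (\<lambda>x. \<psi> x *\<^sub>R b)"
    by (rule sqi_bound[OF test_fun_sqi(1)[OF assms(2)], of _ "norm b"])
       (use test_fun_sqi(3)[OF assms(2)] in \<open>auto simp: mult.commute\<close>)
  have "(\<lambda>n. \<integral>x. \<phi> n x * (cgrad \<psi> x \<bullet> b) \<partial>lborel) \<longlonglongrightarrow> (\<integral>x. U x * (cgrad \<psi> x \<bullet> b) \<partial>lborel)"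
    using inner_tendsto[OF test_fun_sqi(1)[OF t] \<phi>(1) test_fun_sqi(1)[OF test_fun_deriv[OF assms(2)]] \<phi>(4)] by simp
  moreover have "(\<lambda>n. \<integral>x. cgrad (\<phi> n) x \<bullet> (\<psi> x *\<^sub>R b) \<partial>lborel) \<longlonglongrightarrow> (\<integral>x. G x \<bullet> (\<psi> x *\<^sub>R b) \<partial>lborel)"
    by (rule inner_tendsto[OF test_fun_sqi(2)[OF t] \<phi>(2) s \<phi>(5)])
  then have "(\<lambda>n. - (\<integral>x. (cgrad (\<phi> n) x \<bullet> b) * \<psi> x \<partial>lborel)) \<longlonglongrightarrow> - (\<integral>x. (G x \<bullet> b) * \<psi> x \<partial>lborel)"
    by (intro tendsto_minus) (simp add: mult.commute)
  ultimately show ?thesis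
    using LIMSEQ_unique by (simp add: integration_by_parts[OF test_fun_smooth[OF t] assms(2)])
qed

text \<open>The approximants and their gradients are zero off A, and subsequences of them converge
  almost everywhere.\<close>

lemma h10_pair_off:
  assumes "h10_pair A U G"
  shows "AE x in lborel. x \<notin> A \<longrightarrow> U x = 0" "AE x in lborel. x \<notin> A \<longrightarrow> G x = 0"
proof -
  obtain \<phi> where \<phi>: "sqi lborel U" "sqi lborel G" "\<forall>n. test_fun A (\<phi> n)"
    "(\<lambda>n. N2 lborel (\<lambda>x. U x - \<phi> n x)) \<longlonglongrightarrow> 0" "(\<lambda>n. N2 lborel (\<lambda>x. G x - cgrad (\<phi> n) x)) \<longlonglongrightarrow> 0"
    using assms(1) unfolding h10_pair_def by blast
  note t = \<phi>(3)[rule_format]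
  have z: "\<phi> n x = 0" "cgrad (\<phi> n) x = 0" if "x \<notin> A" for n x
    using test_funE[OF t[of n]] that by (metis subsetD)+
  obtain r where "AE x in lborel. (\<lambda>n. \<phi> (r n) x) \<longlonglongrightarrow> U x"
    using L2_AE_subseq[OF test_fun_sqi(1)[OF t] \<phi>(1,4)] by metis
  then show "AE x in lborel. x \<notin> A \<longrightarrow> U x = 0"
    by eventually_elim (auto simp: z LIMSEQ_const_iff)
  obtain r where "AE x in lborel. (\<lambda>n. cgrad (\<phi> (r n)) x) \<longlonglongrightarrow> G x"
    using L2_AE_subseq[OF test_fun_sqi(2)[OF t] \<phi>(2,5)] by metis
  then show "AE x in lborel. x \<notin> A \<longrightarrow> G x = 0"
    by eventually_elim (auto simp: z LIMSEQ_const_iff)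
qed

lemma sqi_locally_integrable:
  fixes F :: "'b::euclidean_space \<Rightarrow> 'c::euclidean_space"
  assumes "sqi lborel F" "compact K"
  shows "integrable lborel (\<lambda>x. indicator K x *\<^sub>R F x)"
proof (rule Bochner_Integration.integrable_bound)
  have [measurable]: "F \<in> borel_measurable borel" "K \<in> sets borel"
    using assms by (auto simp: sqi_def borel_compact)
  show "integrable lborel (\<lambda>x. indicator K x + (norm (F x))\<^sup>2)"
    using emeasure_bounded_finite[OF compact_imp_bounded[OF assms(2)]] sqi_integrable[OF assms(1)]
    by (intro Bochner_Integration.integrable_add integrable_real_indicator) auto
  show "(\<lambda>x. indicator K x *\<^sub>R F x) \<in> borel_measurable lborel" by measurable
  show "AE x in lborel. norm (indicator K x *\<^sub>R F x) \<le> norm (indicator K x + (norm (F x))\<^sup>2)"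
  proof (rule AE_I2)
    fix x
    have "norm (F x) \<le> 1 + (norm (F x))\<^sup>2"
      using zero_le_power2[of "norm (F x) - 1/2"] by (simp add: power2_diff power_divide)
    then show "norm (indicator K x *\<^sub>R F x) \<le> norm (indicator K x + (norm (F x))\<^sup>2)"
      by (auto split: split_indicator)
  qed
qed

lemma set_integrable_lebesgue_transfer:
  fixes f :: "'b::euclidean_space \<Rightarrow> 'c::euclidean_space"
  assumes K: "compact K" "K \<subseteq> A" and F: "F \<in> borel_measurable borel"
    and eq: "AE x in lborel. x \<in> A \<longrightarrow> f x = F x"
  shows "set_integrable lebesgue K f \<longleftrightarrow> integrable lborel (\<lambda>x. indicator K x *\<^sub>R F x)"
proof -
  have KB: "K \<in> sets borel" using K by (simp add: borel_compact)
  have eq': "AE x in lborel. x \<in> K \<longrightarrow> f x = F x" using eq by eventually_elim (use K in auto)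
  have "set_integrable lebesgue K f \<longleftrightarrow> integrable (lebesgue_on K) f"
    unfolding set_integrable_def using KB by (subst integrable_restrict_space) auto
  also have "\<dots> \<longleftrightarrow> integrable lborel (\<lambda>x. indicator K x *\<^sub>R F x)"
  proof (rule lebesgue_on_transfer(2)[OF KB])
    show "f \<in> borel_measurable (lebesgue_on K)"
      by (rule AE_imp_borel_measurable_lebesgue_on[OF KB F eq'])
    show "AE x in lborel. x \<in> K \<longrightarrow> f x = indicator K x *\<^sub>R F x" using eq' by eventually_elim auto
  qed (use F KB in auto)
  finally show ?thesis .
qed

lemma L2_transfer:
  fixes u :: "'b::euclidean_space \<Rightarrow> 'c::euclidean_space"
  assumes A: "A \<in> sets borel" and U: "sqi lborel U" "AE x in lborel. x \<in> A \<longrightarrow> u x = U x"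
    "AE x in lborel. x \<notin> A \<longrightarrow> U x = 0"
  shows "L2 A u" "(\<integral>x. (norm (u x))\<^sup>2 \<partial>lebesgue_on A) = N2 lborel U"
proof -
  have [measurable]: "U \<in> borel_measurable borel" using U(1) by (simp add: sqi_def)
  have um: "u \<in> borel_measurable (lebesgue_on A)"
    by (rule AE_imp_borel_measurable_lebesgue_on[OF A _ U(2)]) measurable
  have e: "AE x in lborel. x \<in> A \<longrightarrow> (norm (u x))\<^sup>2 = (norm (U x))\<^sup>2"
    "AE x in lborel. x \<notin> A \<longrightarrow> (norm (U x))\<^sup>2 = 0"
    using U(2) apply eventually_elim apply simp
    using U(3) apply eventually_elim apply simp done
  have m: "(\<lambda>x. (norm (u x))\<^sup>2) \<in> borel_measurable (lebesgue_on A)" using um by measurable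
  note tr = lebesgue_on_transfer[OF A m _ e]
  show "L2 A u" unfolding L2_def using um tr(2) U(1) by (auto simp: sqi_def)
  show "(\<integral>x. (norm (u x))\<^sup>2 \<partial>lebesgue_on A) = N2 lborel U" unfolding N2_def by (rule tr(1)) measurable
qed

lemma L2_ex_sqi:
  fixes u :: "'b::euclidean_space \<Rightarrow> 'c::euclidean_space"
  assumes A: "A \<in> sets borel" and u: "L2 A u"
  obtains U where "sqi lborel U" "AE x in lborel. x \<in> A \<longrightarrow> u x = U x" "\<And>x. x \<notin> A \<Longrightarrow> U x = 0"
proof -
  have um: "u \<in> borel_measurable (lebesgue_on A)" using u by (simp add: L2_def)
  obtain U where U: "U \<in> borel_measurable borel" "\<forall>x. x \<notin> A \<longrightarrow> U x = 0" "AE x in lborel. x \<in> A \<longrightarrow> u x = U x"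
    using ex_borel_version[OF A um] by blast
  have "integrable lborel (\<lambda>x. (norm (U x))\<^sup>2)"
  proof (rule lebesgue_on_transfer(2)[OF A, THEN iffD1])
    show "(\<lambda>x. (norm (u x))\<^sup>2) \<in> borel_measurable (lebesgue_on A)" using um by measurable
    show "AE x in lborel. x \<in> A \<longrightarrow> (norm (u x))\<^sup>2 = (norm (U x))\<^sup>2" using U(3) by eventually_elim simp
    show "integrable (lebesgue_on A) (\<lambda>x. (norm (u x))\<^sup>2)" using u by (simp add: L2_def)
  qed (use U in auto)
  then have "sqi lborel U" using U(1) by (simp add: sqi_def)
  then show ?thesis using that U by blast
qed

lemma h10_pair_is_weak_grad:
  fixes U :: "'b::euclidean_space \<Rightarrow> real"
  assumes A: "open A" and h: "h10_pair A U G"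
    and u: "AE x in lborel. x \<in> A \<longrightarrow> u x = U x" and g: "AE x in lborel. x \<in> A \<longrightarrow> g x = G x"
  shows "is_weak_grad A u g"
proof -
  have AB: "A \<in> sets borel" using A by simp
  have s: "sqi lborel U" "sqi lborel G" using h by (auto simp: h10_pair_def)
  have [measurable]: "U \<in> borel_measurable borel" "G \<in> borel_measurable borel" using s by (auto simp: sqi_def)
  note off = h10_pair_off[OF h]
  have um: "u \<in> borel_measurable (lebesgue_on A)" "g \<in> borel_measurable (lebesgue_on A)"
    by (rule AE_imp_borel_measurable_lebesgue_on[OF AB _ u] AE_imp_borel_measurable_lebesgue_on[OF AB _ g]; measurable)+
  have "(\<integral>x. u x * (cgrad \<phi> x \<bullet> b) \<partial>lebesgue_on A) = - (\<integral>x. (g x \<bullet> b) * \<phi> x \<partial>lebesgue_on A)"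
    if \<phi>: "test_fun A \<phi>" for \<phi> b
  proof -
    have [measurable]: "cgrad \<phi> \<in> borel_measurable borel" "\<phi> \<in> borel_measurable borel"
      using test_fun_sqi(3,4)[OF \<phi>] by auto
    note [measurable] = um borel_imp_lebesgue_on[of "cgrad \<phi>" A] borel_imp_lebesgue_on[of \<phi> A]
    have "(\<integral>x. u x * (cgrad \<phi> x \<bullet> b) \<partial>lebesgue_on A) = (\<integral>x. U x * (cgrad \<phi> x \<bullet> b) \<partial>lborel)"
    proof (rule lebesgue_on_transfer(1)[OF AB])
      show "AE x in lborel. x \<in> A \<longrightarrow> u x * (cgrad \<phi> x \<bullet> b) = U x * (cgrad \<phi> x \<bullet> b)" using u by eventually_elim simp
      show "AE x in lborel. x \<notin> A \<longrightarrow> U x * (cgrad \<phi> x \<bullet> b) = 0" using off(1) by eventually_elim simp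
    qed measurable
    moreover have "(\<integral>x. (g x \<bullet> b) * \<phi> x \<partial>lebesgue_on A) = (\<integral>x. (G x \<bullet> b) * \<phi> x \<partial>lborel)"
    proof (rule lebesgue_on_transfer(1)[OF AB])
      show "AE x in lborel. x \<in> A \<longrightarrow> (g x \<bullet> b) * \<phi> x = (G x \<bullet> b) * \<phi> x" using g by eventually_elim simp
      show "AE x in lborel. x \<notin> A \<longrightarrow> (G x \<bullet> b) * \<phi> x = 0" using off(2) by eventually_elim simp
    qed measurable
    ultimately show ?thesis using h10_pair_weak[OF h \<phi>, of b] by simp
  qed
  moreover have "set_integrable lebesgue K u \<and> set_integrable lebesgue K g" if "compact K" "K \<subseteq> A" for K
    using set_integrable_lebesgue_transfer[OF that _ u] set_integrable_lebesgue_transfer[OF that _ g]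
      sqi_locally_integrable[OF s(1) that(1)] sqi_locally_integrable[OF s(2) that(1)] by auto
  ultimately show ?thesis using um by (auto simp: is_weak_grad_def)
qed

text \<open>This makes the choice in \<open>wgrad\<close> harmless up to null sets. A weak gradient
  is only locally integrable, so \<open>fundamental_lemma\<close> is applied to each coordinate of
  the difference of Borel versions.\<close>

lemma weak_grad_unique:
  fixes u :: "'b::euclidean_space \<Rightarrow> real"
  assumes A: "open A" and g: "is_weak_grad A u g" and g': "is_weak_grad A u g'"
  shows "AE x in lborel. x \<in> A \<longrightarrow> g x = g' x"
proof -
  have AB: "A \<in> sets borel" using A by simp
  have gm: "g \<in> borel_measurable (lebesgue_on A)" "g' \<in> borel_measurable (lebesgue_on A)"
    using g g' by (auto simp: is_weak_grad_def)
  obtain F where F: "F \<in> borel_measurable borel" "\<forall>x. x \<notin> A \<longrightarrow> F x = 0" "AE x in lborel. x \<in> A \<longrightarrow> g x = F x"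
    using ex_borel_version[OF AB gm(1)] by blast
  obtain F' where F': "F' \<in> borel_measurable borel" "\<forall>x. x \<notin> A \<longrightarrow> F' x = 0" "AE x in lborel. x \<in> A \<longrightarrow> g' x = F' x"
    using ex_borel_version[OF AB gm(2)] by blast
  note [measurable] = F(1) F'(1)
  have loc: "integrable lborel (\<lambda>x. indicator K x *\<^sub>R F x)" "integrable lborel (\<lambda>x. indicator K x *\<^sub>R F' x)"
    if "compact K" "K \<subseteq> A" for K
    using set_integrable_lebesgue_transfer[OF that F(1,3)] set_integrable_lebesgue_transfer[OF that F'(1,3)]
      g g' that by (auto simp: is_weak_grad_def)
  have "AE x in lborel. x \<in> A \<longrightarrow> (F x - F' x) \<bullet> b = 0" if b: "b \<in> Basis" for b
  proof (rule fundamental_lemma[OF A])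
    show "integrable lborel (\<lambda>x. indicator K x * ((F x - F' x) \<bullet> b))" if "compact K" "K \<subseteq> A" for K
      using integrable_inner_left[of b, OF Bochner_Integration.integrable_diff[OF loc[OF that]]]
      by (simp add: inner_diff_left right_diff_distrib)
    fix \<phi> assume \<phi>: "test_fun A \<phi>"
    have [measurable]: "\<phi> \<in> borel_measurable borel" using test_fun_sqi(3)[OF \<phi>] by auto
    note [measurable] = gm borel_imp_lebesgue_on[of \<phi> A]
    have t: "(\<integral>x. (h x \<bullet> b) * \<phi> x \<partial>lebesgue_on A) = (\<integral>x. (H x \<bullet> b) * \<phi> x \<partial>lborel)"
      if [measurable]: "h \<in> borel_measurable (lebesgue_on A)" "H \<in> borel_measurable borel"
        and H: "\<forall>x. x \<notin> A \<longrightarrow> H x = 0" "AE x in lborel. x \<in> A \<longrightarrow> h x = H x" for h H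
    proof (rule lebesgue_on_transfer(1)[OF AB])
      show "AE x in lborel. x \<in> A \<longrightarrow> (h x \<bullet> b) * \<phi> x = (H x \<bullet> b) * \<phi> x" using H(2) by eventually_elim simp
    qed (use H(1) in \<open>auto\<close>)
    obtain K where K: "compact K" "K \<subseteq> A" "\<And>x. x \<notin> K \<Longrightarrow> \<phi> x = 0" using test_funE[OF \<phi>] by metis
    obtain B where B: "\<And>x. x \<in> K \<Longrightarrow> \<bar>\<phi> x\<bar> \<le> B"
    proof -
      have "compact (\<phi> ` K)" by (rule compact_continuous_image[OF smooth_continuous[OF test_fun_smooth[OF \<phi>]] K(1)])
      then have "bounded (\<phi> ` K)" by (rule compact_imp_bounded)
      then obtain B where "\<forall>y\<in>\<phi> ` K. norm y \<le> B" unfolding bounded_iff by blast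
      then show ?thesis using that[of B] by auto
    qed
    have i: "integrable lborel (\<lambda>x. (H x \<bullet> b) * \<phi> x)"
      if "integrable lborel (\<lambda>x. indicator K x *\<^sub>R H x)" and [measurable]: "H \<in> borel_measurable borel" for H
    proof (rule Bochner_Integration.integrable_bound[OF integrable_mult_left[OF integrable_norm[OF that(1)], of B]])
      show "AE x in lborel. norm ((H x \<bullet> b) * \<phi> x) \<le> norm (norm (indicator K x *\<^sub>R H x) * B)"
      proof (rule AE_I2)
        fix x
        show "norm ((H x \<bullet> b) * \<phi> x) \<le> norm (norm (indicator K x *\<^sub>R H x) * B)"
        proof (cases "x \<in> K")
          case True
          have "\<bar>H x \<bullet> b\<bar> * \<bar>\<phi> x\<bar> \<le> norm (H x) * \<bar>B\<bar>"
            using B[OF True] Basis_le_norm[OF b, of "H x"] by (intro mult_mono) auto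
          then show ?thesis using True by (simp add: abs_mult)
        qed (use K(3) in auto)
      qed
    qed measurable
    have "(\<integral>x. (F x \<bullet> b) * \<phi> x \<partial>lborel) = (\<integral>x. (F' x \<bullet> b) * \<phi> x \<partial>lborel)"
      using g g' \<phi> b t[OF gm(1) F] t[OF gm(2) F'] by (auto simp: is_weak_grad_def)
    then show "(\<integral>x. ((F x - F' x) \<bullet> b) * \<phi> x \<partial>lborel) = 0"
      using i[OF loc(1)[OF K(1,2)] F(1)] i[OF loc(2)[OF K(1,2)] F'(1)]
      by (simp add: inner_diff_left left_diff_distrib)
  qed measurable
  then have "AE x in lborel. \<forall>b\<in>Basis. x \<in> A \<longrightarrow> (F x - F' x) \<bullet> b = 0"
    by (intro AE_finite_allI finite_Basis)
  then show ?thesis using F(3) F'(3)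
    by eventually_elim (metis euclidean_all_zero_iff eq_iff_diff_eq_0)
qed

lemma h10_pair_wgrad:
  assumes A: "open A" and h: "h10_pair A U G" and u: "AE x in lborel. x \<in> A \<longrightarrow> u x = U x"
  shows "AE x in lborel. x \<in> A \<longrightarrow> wgrad A u x = G x"
proof -
  have w: "is_weak_grad A u G" by (rule h10_pair_is_weak_grad[OF A h u]) simp
  then have "is_weak_grad A u (wgrad A u)" unfolding wgrad_def by (rule someI[where P = "is_weak_grad A u"])
  then show ?thesis by (rule weak_grad_unique[OF A _ w])
qed

text \<open>The analysis is carried out for pairs, and this equivalence, with
  \<open>h10_pair_integrals\<close>, translates back. A member u of \<open>W12_0 A\<close> is
  unrestricted off A and on null sets, hence the link to U almost everywhere in A only.\<close>

theorem W12_0_iff_h10_pair: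
  assumes A: "open A"
  shows "W12_0 A u \<longleftrightarrow> (\<exists>U G. h10_pair A U G \<and> (AE x in lborel. x \<in> A \<longrightarrow> u x = U x))"
proof
  have AB: "A \<in> sets borel" using A by simp
  have lim_eq: "(\<integral>x. (u x - \<phi> x)\<^sup>2 \<partial>lebesgue_on A) = N2 lborel (\<lambda>x. U x - \<phi> x)"
    "(\<integral>x. (norm (wgrad A u x - cgrad \<phi> x))\<^sup>2 \<partial>lebesgue_on A) = N2 lborel (\<lambda>x. G x - cgrad \<phi> x)"
    if s: "sqi lborel U" "sqi lborel G" and u: "AE x in lborel. x \<in> A \<longrightarrow> u x = U x" "AE x in lborel. x \<notin> A \<longrightarrow> U x = 0"
      and g: "AE x in lborel. x \<in> A \<longrightarrow> wgrad A u x = G x" "AE x in lborel. x \<notin> A \<longrightarrow> G x = 0"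
      and \<phi>: "test_fun A \<phi>" for U G \<phi>
  proof -
    have z: "\<phi> x = 0" "cgrad \<phi> x = 0" if "x \<notin> A" for x
      using test_funE[OF \<phi>] that by (metis subsetD)+
    have "AE x in lborel. x \<in> A \<longrightarrow> u x - \<phi> x = U x - \<phi> x" "AE x in lborel. x \<notin> A \<longrightarrow> U x - \<phi> x = 0"
      "AE x in lborel. x \<in> A \<longrightarrow> wgrad A u x - cgrad \<phi> x = G x - cgrad \<phi> x"
      "AE x in lborel. x \<notin> A \<longrightarrow> G x - cgrad \<phi> x = 0"
      using u g by (auto elim!: eventually_mono simp: z)
    then show "(\<integral>x. (u x - \<phi> x)\<^sup>2 \<partial>lebesgue_on A) = N2 lborel (\<lambda>x. U x - \<phi> x)"
      "(\<integral>x. (norm (wgrad A u x - cgrad \<phi> x))\<^sup>2 \<partial>lebesgue_on A) = N2 lborel (\<lambda>x. G x - cgrad \<phi> x)"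
      using L2_transfer(2)[OF AB sqi_diff[OF s(1) test_fun_sqi(1)[OF \<phi>]]]
        L2_transfer(2)[OF AB sqi_diff[OF s(2) test_fun_sqi(2)[OF \<phi>]]] by auto
  qed
  {
    assume W: "W12_0 A u"
    then have "L2 A u" and ex: "\<exists>g. is_weak_grad A u g \<and> L2 A g" by (auto simp: W12_0_def W12_def)
    obtain U where U: "sqi lborel U" "AE x in lborel. x \<in> A \<longrightarrow> u x = U x" "\<And>x. x \<notin> A \<Longrightarrow> U x = 0"
      using L2_ex_sqi[OF AB \<open>L2 A u\<close>] by metis
    obtain g where g: "is_weak_grad A u g" "L2 A g" using ex by blast
    obtain G where G: "sqi lborel G" "AE x in lborel. x \<in> A \<longrightarrow> g x = G x" "\<And>x. x \<notin> A \<Longrightarrow> G x = 0"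
      using L2_ex_sqi[OF AB g(2)] by metis
    have "is_weak_grad A u (wgrad A u)" unfolding wgrad_def using g(1) by (rule someI[where P = "is_weak_grad A u"])
    then have "AE x in lborel. x \<in> A \<longrightarrow> wgrad A u x = g x" using g(1) by (rule weak_grad_unique[OF A])
    then have wG: "AE x in lborel. x \<in> A \<longrightarrow> wgrad A u x = G x" using G(2) by eventually_elim auto
    obtain \<phi> :: "nat \<Rightarrow> _ \<Rightarrow> real" where \<phi>: "\<forall>n. test_fun A (\<phi> n)"
      and lim: "(\<lambda>n. (\<integral>x. (u x - \<phi> n x)\<^sup>2 \<partial>lebesgue_on A)
            + (\<integral>x. (norm (wgrad A u x - cgrad (\<phi> n) x))\<^sup>2 \<partial>lebesgue_on A)) \<longlonglongrightarrow> 0"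
      using W by (auto simp: W12_0_def)
    have lim': "(\<lambda>n. N2 lborel (\<lambda>x. U x - \<phi> n x) + N2 lborel (\<lambda>x. G x - cgrad (\<phi> n) x)) \<longlonglongrightarrow> 0"
      using lim lim_eq[OF U(1) G(1) U(2) _ wG _ \<phi>[rule_format]] U(3) G(3) by simp
    have "(\<lambda>n. N2 lborel (\<lambda>x. U x - \<phi> n x)) \<longlonglongrightarrow> 0" "(\<lambda>n. N2 lborel (\<lambda>x. G x - cgrad (\<phi> n) x)) \<longlonglongrightarrow> 0"
      by (rule tendsto_sandwich[OF _ _ tendsto_const lim']; simp add: N2_nonneg)+
    then show "\<exists>U G. h10_pair A U G \<and> (AE x in lborel. x \<in> A \<longrightarrow> u x = U x)"
      using U G(1) \<phi> unfolding h10_pair_def by blast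
  next
    assume "\<exists>U G. h10_pair A U G \<and> (AE x in lborel. x \<in> A \<longrightarrow> u x = U x)"
    then obtain U G where h: "h10_pair A U G" and u: "AE x in lborel. x \<in> A \<longrightarrow> u x = U x" by blast
    note off = h10_pair_off[OF h] and wG = h10_pair_wgrad[OF A h u]
    obtain \<phi> where \<phi>: "sqi lborel U" "sqi lborel G" "\<forall>n. test_fun A (\<phi> n)"
      "(\<lambda>n. N2 lborel (\<lambda>x. U x - \<phi> n x)) \<longlonglongrightarrow> 0" "(\<lambda>n. N2 lborel (\<lambda>x. G x - cgrad (\<phi> n) x)) \<longlonglongrightarrow> 0"
      using h unfolding h10_pair_def by blast
    have "is_weak_grad A u G" by (rule h10_pair_is_weak_grad[OF A h u]) simp
    moreover have "L2 A u" by (rule L2_transfer(1)[OF AB \<phi>(1) u off(1)])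
    moreover have "L2 A G" by (rule L2_transfer(1)[OF AB \<phi>(2) _ off(2)]) simp
    ultimately have "W12 A u" by (auto simp: W12_def)
    moreover have "(\<lambda>n. (\<integral>x. (u x - \<phi> n x)\<^sup>2 \<partial>lebesgue_on A)
            + (\<integral>x. (norm (wgrad A u x - cgrad (\<phi> n) x))\<^sup>2 \<partial>lebesgue_on A)) \<longlonglongrightarrow> 0"
      using tendsto_add[OF \<phi>(4,5)] lim_eq[OF \<phi>(1,2) u off(1) wG off(2) \<phi>(3)[rule_format]] by simp
    ultimately show "W12_0 A u" using \<phi>(3) by (auto simp: W12_0_def)
  }
qed

lemma h10_pair_integrals:
  assumes A: "open A" and h: "h10_pair A U G" and u: "AE x in lborel. x \<in> A \<longrightarrow> u x = U x"
  shows "(\<integral>x. (u x)\<^sup>2 \<partial>lebesgue_on A) = N2 lborel U" "dirichlet A u = N2 lborel G"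
proof -
  have AB: "A \<in> sets borel" using A by simp
  have s: "sqi lborel U" "sqi lborel G" using h by (auto simp: h10_pair_def)
  show "(\<integral>x. (u x)\<^sup>2 \<partial>lebesgue_on A) = N2 lborel U"
    using L2_transfer(2)[OF AB s(1) u h10_pair_off(1)[OF h]] by simp
  show "dirichlet A u = N2 lborel G"
    unfolding dirichlet_def by (rule L2_transfer(2)[OF AB s(2) h10_pair_wgrad[OF A h u] h10_pair_off(2)[OF h]])
qed

section \<open>Local compactness\<close>

lemma sqi_indicator:
  fixes u :: "'b::euclidean_space \<Rightarrow> real"
  assumes "sqi lborel u" "S \<in> sets borel"
  shows "sqi lborel (\<lambda>x. indicator S x * u x)" "N2 lborel (\<lambda>x. indicator S x * u x) \<le> N2 lborel u"
proof -
  have [measurable]: "u \<in> borel_measurable borel" using assms by (simp add: sqi_def)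
  note [measurable] = assms(2)
  show s: "sqi lborel (\<lambda>x. indicator S x * u x)"
    by (rule sqi_bound[OF assms(1), of _ 1]) (auto split: split_indicator)
  show "N2 lborel (\<lambda>x. indicator S x * u x) \<le> N2 lborel u"
    unfolding N2_def using sqi_integrable[OF assms(1)] sqi_integrable[OF s]
    by (intro integral_mono) (auto split: split_indicator)
qed

lemma sqi_indicator_bounded:
  assumes "S \<in> sets borel" "bounded S"
  shows "sqi lborel (\<lambda>x. c * indicator S x :: real)" "integrable lborel (\<lambda>x. c * indicator S x :: real)"
proof -
  have "integrable lborel (\<lambda>x. a * indicator S x :: real)" for a
    using emeasure_bounded_finite[OF assms(2)] assms(1) by (intro integrable_mult_right integrable_real_indicator) auto
  moreover have "(norm (c * indicator S x :: real))\<^sup>2 = c\<^sup>2 * indicator S x" for x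
    by (simp split: split_indicator)
  ultimately show "sqi lborel (\<lambda>x. c * indicator S x :: real)" "integrable lborel (\<lambda>x. c * indicator S x :: real)"
    using assms(1) by (auto simp: sqi_def)
qed

lemma smear_bound:
  assumes "sqi lborel \<rho>" "sqi lborel u"
  shows "\<bar>smear \<rho> u x\<bar> \<le> sqrt (N2 lborel \<rho>) * sqrt (N2 lborel u)"
proof -
  have s: "sqi lborel (\<lambda>h. u (x + h))" "N2 lborel (\<lambda>h. u (x + h)) = N2 lborel u"
    using sqi_shift[OF assms(2), of x] by (simp_all add: add.commute)
  show ?thesis using L2_Cauchy_Schwarz[OF assms(1) s(1)] by (simp add: smear_def s(2))
qed

text \<open>Moving x by v translates u by v under the integral. Cauchy-Schwarz puts the kernel into
  the constant, which is therefore common to all functions with the same translation bound.\<close>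

lemma smear_Lipschitz:
  assumes \<rho>: "sqi lborel \<rho>" and u: "sqi lborel u" "\<And>h. N2 lborel (\<lambda>x. u (x + h) - u x) \<le> (norm h)\<^sup>2 * M"
  shows "\<bar>smear \<rho> u x - smear \<rho> u y\<bar> \<le> sqrt (N2 lborel \<rho>) * (norm (x - y) * sqrt M)"
proof -
  have s: "sqi lborel (\<lambda>h. u (z + h))" for z
    using sqi_shift[OF u(1), of z] by (simp add: add.commute)
  let ?w = "\<lambda>h. u (h + (x - y)) - u h"
  have w: "sqi lborel ?w" by (intro sqi_diff sqi_shift u)
  have e: "(\<lambda>h. ?w (h + y)) = (\<lambda>h. u (x + h) - u (y + h))" by (simp add: fun_eq_iff algebra_simps)
  have "smear \<rho> u x - smear \<rho> u y = (\<integral>h. \<rho> h * (u (x + h) - u (y + h)) \<partial>lborel)"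
    unfolding smear_def using sqi_integrable_mult[OF \<rho> s[of x]] sqi_integrable_mult[OF \<rho> s[of y]]
    by (simp add: right_diff_distrib)
  also have "\<bar>\<dots>\<bar> \<le> sqrt (N2 lborel \<rho>) * sqrt (N2 lborel (\<lambda>h. u (x + h) - u (y + h)))"
    using L2_Cauchy_Schwarz[OF \<rho> sqi_diff[OF s[of x] s[of y]]] by simp
  also have "N2 lborel (\<lambda>h. u (x + h) - u (y + h)) = N2 lborel ?w"
    using sqi_shift(2)[OF w, of y] by (simp only: e)
  also have "sqrt (N2 lborel ?w) \<le> norm (x - y) * sqrt M"
    using real_sqrt_le_mono[OF u(2)[of "x - y"]] by (simp add: real_sqrt_mult)
  finally show ?thesis by (simp add: mult_left_mono N2_nonneg)
qed

lemma equi_Lipschitz_convergent: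
  fixes g :: "nat \<Rightarrow> 'b::metric_space \<Rightarrow> real"
  assumes L: "\<And>n x y. \<bar>g n x - g n y\<bar> \<le> L * dist x y" "L \<ge> 0"
    and D: "\<And>x \<delta>. \<delta> > 0 \<Longrightarrow> \<exists>d\<in>D. dist x d < \<delta>"
    and conv: "\<And>d. d \<in> D \<Longrightarrow> convergent (\<lambda>n. g n d)"
  shows "convergent (\<lambda>n. g n x)"
proof -
  have "Cauchy (\<lambda>n. g n x)"
  proof (rule metric_CauchyI)
    fix e :: real assume e: "e > 0"
    obtain d where d: "d \<in> D" "dist x d < e / (3 * (L + 1))"
      using D[of "e / (3 * (L + 1))" x] e L(2) by auto
    obtain N where N: "\<And>m n. m \<ge> N \<Longrightarrow> n \<ge> N \<Longrightarrow> dist (g m d) (g n d) < e / 3"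
      using convergent_Cauchy[OF conv[OF d(1)]] e unfolding Cauchy_def by (metis divide_pos_pos zero_less_numeral)
    have "L * dist x d \<le> (L + 1) * dist x d" by (intro mult_right_mono) auto
    also have "\<dots> < e / 3" using d(2) L(2) by (simp add: field_simps)
    finally have Ld: "L * dist x d < e / 3" .
    have "dist (g m x) (g n x) < e" if "m \<ge> N" "n \<ge> N" for m n
      using N[OF that] L(1)[of m x d] L(1)[of n x d] Ld unfolding dist_real_def by linarith
    then show "\<exists>N. \<forall>m\<ge>N. \<forall>n\<ge>N. dist (g m x) (g n x) < e" by blast
  qed
  then show ?thesis by (simp add: Cauchy_convergent)
qed

text \<open>For a fixed radius \<open>d j\<close> the ball averages of the f n are bounded and
  Lipschitz with constants independent of n. A diagonal subsequence that converges on a countable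
  dense set then converges everywhere, and dominated convergence makes it converge in L^2 on balls.
  The averages approximate f n in L^2 uniformly in n, because the energies are bounded.\<close>

theorem rellich:
  fixes f :: "nat \<Rightarrow> 'b::euclidean_space \<Rightarrow> real"
  assumes t: "\<And>n. test_fun UNIV (f n)"
    and M1: "\<And>n. N2 lborel (f n) \<le> M1" and M: "\<And>n. N2 lborel (cgrad (f n)) \<le> M"
  obtains r :: "nat \<Rightarrow> nat" where "strict_mono r"
    "\<And>R e. e > 0 \<Longrightarrow> \<exists>N. \<forall>m\<ge>N. \<forall>n\<ge>N. N2 lborel (\<lambda>x. indicator (ball 0 R) x * (f (r m) x - f (r n) x)) < e"
proof -
  note sq = test_fun_sqi(1)[OF t]
  have Mnn: "M \<ge> 0" "M1 \<ge> 0" using N2_nonneg M[of 0] M1[of 0] order_trans by blast+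
  have tr: "N2 lborel (\<lambda>x. f n (x + h) - f n x) \<le> (norm h)\<^sup>2 * M" for n h
    using translation_estimate[OF t[of n], of h] mult_left_mono[OF M[of n], of "(norm h)\<^sup>2"] by simp
  define d where "d j = 1 / real (Suc j)" for j
  define V where "V j = measure lborel (cball (0::'b) (d j))" for j
  define \<rho> where "\<rho> j h = (1 / V j) * indicator (cball (0::'b) (d j)) h" for j h
  have dpos: "d j > 0" for j by (simp add: d_def)
  have Vpos: "V j > 0" for j
    using content_ball_pos[OF dpos[of j], of "0::'b"] measure_mono_fmeasurable[of "ball (0::'b) (d j)" "cball 0 (d j)" lborel]
    by (auto simp: V_def intro: order.strict_trans2 ball_subset_cball)
  have \<rho>: "sqi lborel (\<rho> j)" "integrable lborel (\<rho> j)" "\<rho> j h \<ge> 0" "norm h > d j \<Longrightarrow> \<rho> j h = 0"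
    "(\<integral>h. \<rho> j h \<partial>lborel) = 1" for j h
    using sqi_indicator_bounded[of "cball (0::'b) (d j)" "1 / V j"] Vpos[of j]
    by (auto simp: \<rho>_def[abs_def] V_def)
  define C where "C j = sqrt (N2 lborel (\<rho> j))" for j
  have Cnn: "C j \<ge> 0" for j by (simp add: C_def N2_nonneg)
  define A where "A j n = smear (\<rho> j) (f n)" for j n
  have As: "sqi lborel (A j n)" and Aest: "N2 lborel (\<lambda>x. A j n x - f n x) \<le> (d j)\<^sup>2 * M" for j n
    using smear_estimate[where \<rho> = "\<rho> j" and d = "d j" and c = 1, OF \<rho>(1-5) sq tr, of n] by (auto simp: A_def)
  have Abd: "\<bar>A j n x\<bar> \<le> C j * sqrt M1" for j n x
    using smear_bound[OF \<rho>(1) sq, of j n x] mult_left_mono[OF real_sqrt_le_mono[OF M1[of n]] Cnn[of j]]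
    by (simp add: A_def C_def)
  have ALip: "\<bar>A j n x - A j n y\<bar> \<le> (C j * sqrt M) * dist x y" for j n x y
    using smear_Lipschitz[OF \<rho>(1) sq tr, of j n x y] by (simp add: A_def C_def dist_norm mult_ac)
  obtain D :: "'b set" where D: "countable D" "\<And>X. open X \<Longrightarrow> X \<noteq> {} \<Longrightarrow> \<exists>d\<in>D. d \<in> X"
    using countable_dense_setE by blast
  have Dd: "\<exists>q\<in>D. dist x q < \<delta>" if "\<delta> > 0" for x \<delta>
    using D(2)[of "ball x \<delta>"] that by auto
  \<comment> \<open>One extraction serves all radii and all points of D: dividing by C + 1 gives a
    bound independent of the pair, and the 1 keeps the divisor positive.\<close>
  define F where "F n p = A (fst p) n (snd p) / (C (fst p) + 1)" for n :: nat and p :: "nat \<times> 'b"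
  have Fb: "norm (F n p) \<le> sqrt M1" for n p
  proof -
    have "\<bar>A (fst p) n (snd p)\<bar> \<le> (C (fst p) + 1) * sqrt M1"
      using Abd[of "fst p" n "snd p"] Mnn by (simp add: distrib_right add_increasing2)
    then show ?thesis using Cnn[of "fst p"] by (simp add: F_def divide_simps mult.commute abs_of_nonneg)
  qed
  obtain r where r: "strict_mono (r :: nat \<Rightarrow> nat)" and rc: "\<And>p. p \<in> UNIV \<times> D \<Longrightarrow> \<exists>l. (\<lambda>n. F (r n) p) \<longlonglongrightarrow> l"
    using function_convergent_subsequence[of "UNIV \<times> D" F "sqrt M1"] D(1) Fb by (metis countable_SIGMA countableI_type)
  have "convergent (\<lambda>n. A j (r n) q)" if q: "q \<in> D" for j q
  proof -
    obtain l where "(\<lambda>n. F (r n) (j, q)) \<longlonglongrightarrow> l" using rc[of "(j, q)"] q by auto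
    then have "(\<lambda>n. F (r n) (j, q) * (C j + 1)) \<longlonglongrightarrow> l * (C j + 1)" by (intro tendsto_intros)
    moreover have "F (r n) (j, q) * (C j + 1) = A j (r n) q" for n using Cnn[of j] by (simp add: F_def)
    ultimately show ?thesis by (auto simp: convergent_def)
  qed
  note convD = this
  have "convergent (\<lambda>n. A j (r n) x)" for j x
  proof (rule equi_Lipschitz_convergent[of "\<lambda>n. A j (r n)" "C j * sqrt M" D x])
    show "0 \<le> C j * sqrt M" using Cnn[of j] Mnn by simp
  qed (fact ALip Dd convD)+
  note convA = this
  define g where "g j x = lim (\<lambda>n. A j (r n) x)" for j x
  have g: "(\<lambda>n. A j (r n) x) \<longlonglongrightarrow> g j x" for j x
    using convA[of j x] unfolding g_def convergent_LIMSEQ_iff .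
  have [measurable]: "A j n \<in> borel_measurable borel" for j n using As[of j n] by (simp add: sqi_def)
  have gm [measurable]: "g j \<in> borel_measurable borel" for j
    by (rule borel_measurable_LIMSEQ_real[OF g]) measurable
  have gb: "\<bar>g j x\<bar> \<le> C j * sqrt M1" for j x
    using LIMSEQ_le_const2[OF tendsto_rabs[OF g[of j x]], of "C j * sqrt M1"] Abd by auto
  show ?thesis
  proof (rule that[OF r])
    fix R e :: real assume e: "e > 0"
    let ?i = "indicator (ball (0::'b) R) :: 'b \<Rightarrow> real"
    \<comment> \<open>The inequality |a+b|^2 <= 2|a|^2 + 2|b|^2 is used twice, with two errors of
      size (d j)^2 M at the end, which makes the factor 8. In the same way the averages contribute 8
      times e / 16, the other half of e.\<close>
    obtain j where j: "8 * (d j)\<^sup>2 * M < e / 2"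
    proof -
      have "(\<lambda>j. 8 * (d j)\<^sup>2 * M) \<longlonglongrightarrow> 8 * 0\<^sup>2 * M"
        unfolding d_def using LIMSEQ_inverse_real_of_nat by (intro tendsto_intros) (simp add: inverse_eq_divide)
      then have "\<forall>\<^sub>F j in sequentially. 8 * (d j)\<^sup>2 * M < e / 2"
        using e by (intro order_tendstoD(2)) auto
      then show ?thesis using that by (auto simp: eventually_sequentially)
    qed
    let ?c = "C j * sqrt M1"
    have gs: "sqi lborel (\<lambda>x. ?i x * g j x)"
    proof (rule sqi_bound[OF sqi_indicator_bounded(1)[of "ball 0 R" 1], of _ ?c])
      show "(\<lambda>x. ?i x * g j x) \<in> borel_measurable lborel"
        by (intro borel_measurable_times borel_measurable_indicator) (simp_all add: gm)
    qed (use gb[of j] in \<open>auto split: split_indicator\<close>)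
    note inds = sqi_indicator(1)[OF _ borel_open[OF open_ball]]
    have lim: "(\<lambda>n. N2 lborel (\<lambda>x. ?i x * g j x - ?i x * A j (r n) x)) \<longlonglongrightarrow> (\<integral>x. 0 \<partial>(lborel::'b measure))"
      unfolding N2_def
    proof (rule integral_dominated_convergence)
      show "integrable lborel (\<lambda>x. (2 * ?c)\<^sup>2 * ?i x)" by (rule sqi_indicator_bounded(2)) auto
      show "AE x in lborel. (\<lambda>n. (norm (?i x * g j x - ?i x * A j (r n) x))\<^sup>2) \<longlonglongrightarrow> 0"
      proof (rule AE_I2)
        fix x
        have "(\<lambda>n. (norm (?i x * g j x - ?i x * A j (r n) x))\<^sup>2) \<longlonglongrightarrow> (norm (?i x * g j x - ?i x * g j x))\<^sup>2"
          by (intro tendsto_intros g)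
        then show "(\<lambda>n. (norm (?i x * g j x - ?i x * A j (r n) x))\<^sup>2) \<longlonglongrightarrow> 0" by simp
      qed
      show "AE x in lborel. norm ((norm (?i x * g j x - ?i x * A j (r n) x))\<^sup>2) \<le> (2 * ?c)\<^sup>2 * ?i x" for n
      proof (rule AE_I2)
        fix x
        have "\<bar>g j x - A j (r n) x\<bar> \<le> 2 * ?c" using gb[of j x] Abd[of j "r n" x] by linarith
        then have "\<bar>g j x - A j (r n) x\<bar>\<^sup>2 \<le> (2 * ?c)\<^sup>2" by (rule power_mono) simp
        then show "norm ((norm (?i x * g j x - ?i x * A j (r n) x))\<^sup>2) \<le> (2 * ?c)\<^sup>2 * ?i x"
          by (simp split: split_indicator)
      qed
    qed (use sqi_measurable[OF sqi_diff[OF gs inds[OF As]]] in auto)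
    then have "\<forall>\<^sub>F n in sequentially. N2 lborel (\<lambda>x. ?i x * g j x - ?i x * A j (r n) x) < e / 16"
      using e by (intro order_tendstoD(2)) auto
    then obtain N where N: "\<And>n. n \<ge> N \<Longrightarrow> N2 lborel (\<lambda>x. ?i x * g j x - ?i x * A j (r n) x) < e / 16"
      by (auto simp: eventually_sequentially)
    have "N2 lborel (\<lambda>x. ?i x * (f (r m) x - f (r n) x)) < e" if mn: "m \<ge> N" "n \<ge> N" for m n
    proof -
      let ?G = "\<lambda>n x. ?i x * g j x - ?i x * A j (r n) x"
      let ?E = "\<lambda>n x. A j n x - f n x"
      have Gs: "sqi lborel (?G n)" for n by (intro sqi_diff gs inds As)
      have Es: "sqi lborel (?E n)" for n by (intro sqi_diff As sq)
      have Ed: "sqi lborel (\<lambda>x. ?E (r n) x - ?E (r m) x)" by (intro sqi_diff Es)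
      have b1: "N2 lborel (\<lambda>x. ?G n x - ?G m x) \<le> 2 * N2 lborel (?G n) + 2 * N2 lborel (?G m)"
        using N2_parallelogram[OF Gs Gs, of n m] N2_nonneg[of lborel "\<lambda>x. ?G n x + ?G m x"] by simp
      have b2: "N2 lborel (\<lambda>x. ?E (r n) x - ?E (r m) x) \<le> 2 * N2 lborel (?E (r n)) + 2 * N2 lborel (?E (r m))"
        using N2_parallelogram[OF Es Es, of "r n" "r m"] N2_nonneg[of lborel "\<lambda>x. ?E (r n) x + ?E (r m) x"] by simp
      have eq: "(\<lambda>x. ?i x * (f (r m) x - f (r n) x)) = (\<lambda>x. (?G n x - ?G m x) + ?i x * (?E (r n) x - ?E (r m) x))"
        by (simp add: fun_eq_iff algebra_simps)
      have "N2 lborel (\<lambda>x. ?i x * (f (r m) x - f (r n) x)) \<le> 2 * N2 lborel (\<lambda>x. ?G n x - ?G m x)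
          + 2 * N2 lborel (\<lambda>x. ?i x * (?E (r n) x - ?E (r m) x))"
        unfolding eq by (rule N2_add_le[OF sqi_diff[OF Gs Gs] inds[OF Ed]])
      also have "\<dots> \<le> 2 * N2 lborel (\<lambda>x. ?G n x - ?G m x) + 2 * N2 lborel (\<lambda>x. ?E (r n) x - ?E (r m) x)"
        using sqi_indicator(2)[OF Ed borel_open[OF open_ball]] by simp
      also have "\<dots> < e"
        using b1 b2 N[OF mn(1)] N[OF mn(2)] Aest[of j "r n"] Aest[of j "r m"] j by linarith
      finally show ?thesis .
    qed
    then show "\<exists>N. \<forall>m\<ge>N. \<forall>n\<ge>N. N2 lborel (\<lambda>x. ?i x * (f (r m) x - f (r n) x)) < e" by blast
  qed
qed

section \<open>Half-cylinders\<close>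

text \<open>As in the uniqueness proof for Haar measure, the double integral of 1_X(f x + y) 1_B(y),
  with B the unit ball, is computed in both orders. Translation invariance evaluates one as the
  image measure of X times |B|. In the other order the norm is preserved, so 1_B(y - f x) equals
  1_B(x - g y) with g the inverse of f, and the result is |X| |B|.\<close>

lemma lborel_distr_orthogonal:
  fixes f :: "'b::euclidean_space \<Rightarrow> 'b"
  assumes f: "orthogonal_transformation f"
  shows "distr lborel borel f = lborel"
proof (rule measure_eqI)
  define g where "g = inv f"
  have lf: "linear f" and bij: "bij f" and lg: "linear g"
    using f orthogonal_transformation_linear orthogonal_transformation_bij
      orthogonal_transformation_linear[OF orthogonal_transformation_inv[OF f]] by (auto simp: g_def)
  have fg: "f (g y) = y" for y using bij by (simp add: g_def bij_is_surj surj_f_inv_f)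
  have nf: "norm (f x) = norm x" for x using f by (simp add: orthogonal_transformation_norm)
  have [measurable]: "f \<in> borel_measurable borel" "g \<in> borel_measurable borel"
    using lf lg by (auto intro!: borel_measurable_continuous_onI linear_continuous_on simp: linear_conv_bounded_linear)
  fix X assume "X \<in> sets (distr lborel borel f)"
  then have [measurable]: "X \<in> sets borel" by simp
  let ?B = "ball (0::'b) 1"
  let ?b = "emeasure lborel ?B"
  have [measurable]: "?B \<in> sets borel" by simp
  have b: "?b \<noteq> 0" "?b \<noteq> \<infinity>"
    using emeasure_lborel_ball_finite[of "0::'b" 1] content_ball_pos[of 1 "0::'b"]
    by (auto simp: measure_def)
  have fX: "emeasure (distr lborel borel f) X = (\<integral>\<^sup>+x. indicator X (f x) \<partial>lborel)"
    using nn_integral_distr[of f lborel borel "indicator X"] nn_integral_indicator[of X "distr lborel borel f"] by simp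
  have "emeasure (distr lborel borel f) X * ?b = (\<integral>\<^sup>+y. emeasure (distr lborel borel f) X * indicator ?B y \<partial>lborel)"
    by (simp add: nn_integral_cmult_indicator)
  also have "\<dots> = (\<integral>\<^sup>+y. (\<integral>\<^sup>+x. indicator X (f x + y) * indicator ?B y \<partial>lborel) \<partial>lborel)"
  proof (rule nn_integral_cong)
    fix y :: 'b
    have "(\<integral>\<^sup>+x. indicator X (f x + y) * indicator ?B y \<partial>lborel) = (\<integral>\<^sup>+x. indicator X (f x + y) \<partial>lborel) * indicator ?B y"
      by (rule nn_integral_multc) measurable
    also have "(\<integral>\<^sup>+x. indicator X (f x + y) \<partial>lborel) = (\<integral>\<^sup>+x. indicator X (f (x + g y)) \<partial>lborel)"
      by (simp add: linear_add[OF lf] fg)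
    also have "\<dots> = (\<integral>\<^sup>+x. indicator X (f x) \<partial>lborel)"
      using lborel_nn_integral_shift[of "\<lambda>x. indicator X (f x)" "g y"] by simp
    finally show "emeasure (distr lborel borel f) X * indicator ?B y = (\<integral>\<^sup>+x. indicator X (f x + y) * indicator ?B y \<partial>lborel)"
      using fX by simp
  qed
  also have "\<dots> = (\<integral>\<^sup>+x. (\<integral>\<^sup>+y. indicator X (f x + y) * indicator ?B y \<partial>lborel) \<partial>lborel)"
    by (rule lborel_pair.Fubini') measurable
  also have "\<dots> = (\<integral>\<^sup>+x. (\<integral>\<^sup>+y. indicator X y * indicator ?B (y - f x) \<partial>lborel) \<partial>lborel)"
  proof (rule nn_integral_cong)
    fix x :: 'b
    show "(\<integral>\<^sup>+y. indicator X (f x + y) * indicator ?B y \<partial>lborel) = (\<integral>\<^sup>+y. indicator X y * indicator ?B (y - f x) \<partial>lborel)"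
      using lborel_nn_integral_shift[of "\<lambda>y. indicator X y * indicator ?B (y - f x)" "f x"]
      by (simp add: add.commute)
  qed
  also have "\<dots> = (\<integral>\<^sup>+y. (\<integral>\<^sup>+x. indicator X y * indicator ?B (y - f x) \<partial>lborel) \<partial>lborel)"
    by (rule lborel_pair.Fubini') measurable
  also have "\<dots> = (\<integral>\<^sup>+y. indicator X y * ?b \<partial>lborel)"
  proof (rule nn_integral_cong)
    fix y :: 'b
    have "indicator ?B (y - f x) = (indicator ?B (x + (- g y)) :: ennreal)" for x
    proof -
      have "norm (y - f x) = norm (f (g y - x))" by (simp add: linear_diff[OF lf] fg)
      then show ?thesis by (simp add: nf indicator_def norm_minus_commute)
    qed
    then have "(\<integral>\<^sup>+x. indicator ?B (y - f x) \<partial>lborel) = (\<integral>\<^sup>+x. indicator ?B (x + (- g y)) \<partial>lborel)" by simp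
    also have "\<dots> = ?b"
      using lborel_nn_integral_shift[of "indicator ?B" "- g y"] by simp
    finally show "(\<integral>\<^sup>+x. indicator X y * indicator ?B (y - f x) \<partial>lborel) = indicator X y * ?b"
      by (simp add: nn_integral_cmult)
  qed
  also have "\<dots> = emeasure lborel X * ?b"
    by (simp add: nn_integral_multc)
  finally have "?b * emeasure (distr lborel borel f) X = ?b * emeasure lborel X"
    by (simp only: mult.commute)
  then show "emeasure (distr lborel borel f) X = emeasure lborel X"
    using ennreal_mult_cancel_left[of ?b] b by auto
qed simp

lemma lborel_nn_integral_rigid:
  fixes f :: "'b::euclidean_space \<Rightarrow> ennreal" and R :: "'b \<Rightarrow> 'b"
  assumes R: "orthogonal_transformation R" and [measurable]: "f \<in> borel_measurable borel"
  shows "(\<integral>\<^sup>+x. f (R x + t) \<partial>lborel) = (\<integral>\<^sup>+x. f x \<partial>lborel)"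
proof -
  have [measurable]: "R \<in> borel_measurable borel"
    using orthogonal_transformation_linear[OF R]
    by (auto intro!: borel_measurable_continuous_onI linear_continuous_on simp: linear_conv_bounded_linear)
  have "(\<integral>\<^sup>+x. f (R x + t) \<partial>lborel) = (\<integral>\<^sup>+x. f (x + t) \<partial>distr lborel borel R)"
    by (subst nn_integral_distr) auto
  also have "\<dots> = (\<integral>\<^sup>+x. f (x + t) \<partial>lborel)" by (simp only: lborel_distr_orthogonal[OF R])
  also have "\<dots> = (\<integral>\<^sup>+x. f x \<partial>lborel)" by (rule lborel_nn_integral_shift) fact
  finally show ?thesis .
qed

lemma cyl_open:
  assumes "open E" "orthogonal_transformation R"
  shows "open (cyl E R t)"
proof -
  have o: "open (E \<times> {0::real<..})" using assms(1) by (intro open_Times) auto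
  have "open (R ` (E \<times> {0<..}))"
    by (rule open_bijective_linear_image_eq[THEN iffD2, OF _ _ o])
       (use assms orthogonal_transformation_linear orthogonal_transformation_bij in auto)
  then have "open ((\<lambda>x. t + x) ` (R ` (E \<times> {0<..})))" by (rule open_translation)
  then show ?thesis by (simp add: cyl_def image_image add.commute)
qed

text \<open>Fixing the axial coordinate s turns a test function of the half-cylinder into one of the
  cross-section, supported in the projection of the original support. Its gradient is at most the
  full gradient because R is an isometry; the axial derivative is dropped. Integration over s by
  Tonelli preserves the constant \<mu>.\<close>

lemma cylinder_bound:
  fixes \<psi> :: "'a::euclidean_space \<times> real \<Rightarrow> real"
  assumes \<mu>: "\<mu> \<ge> 0" "\<And>\<phi>. test_fun E \<phi> \<Longrightarrow> \<mu> * N2 lborel \<phi> \<le> N2 lborel (cgrad \<phi>)"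
    and R: "orthogonal_transformation R" and \<psi>: "test_fun (cyl E R t) \<psi>"
  shows "\<mu> * N2 lborel \<psi> \<le> N2 lborel (cgrad \<psi>)"
proof -
  note sm = test_fun_smooth[OF \<psi>] and sq = test_fun_sqi[OF \<psi>]
  have lR: "linear R" and bR: "bij R" using R orthogonal_transformation_linear orthogonal_transformation_bij by auto
  have nR: "norm (R x) = norm x" for x using R by (simp add: orthogonal_transformation_norm)
  have cR: "continuous_on UNIV R" using lR by (simp add: linear_continuous_on linear_conv_bounded_linear)
  have [measurable]: "R \<in> borel_measurable borel" using cR by (rule borel_measurable_continuous_onI)
  have [measurable]: "\<psi> \<in> borel_measurable borel" "cgrad \<psi> \<in> borel_measurable borel"
    using sq by (auto simp: sqi_def)
  obtain K where K: "compact K" "K \<subseteq> cyl E R t" "\<And>x. x \<notin> K \<Longrightarrow> \<psi> x = 0" using test_funE[OF \<psi>] by metis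
  define K' where "K' = (\<lambda>z. fst (inv R (z - t))) ` K"
  have cI: "continuous_on UNIV (inv R)"
    using orthogonal_transformation_linear[OF orthogonal_transformation_inv[OF R]]
    by (simp add: linear_continuous_on linear_conv_bounded_linear)
  have K': "compact K'" unfolding K'_def
    by (rule compact_continuous_image[OF _ K(1)])
       (intro continuous_intros continuous_on_compose2[OF cI], auto)
  have inv: "inv R (R x + t - t) = x" for x using bR by (simp add: bij_is_inj)
  have K'E: "K' \<subseteq> E" unfolding K'_def using K(2) inv by (force simp: cyl_def)
  define sl where "sl s y = \<psi> (R (y, s) + t)" for s y
  have aff: "R (y, s) + t = R (y, 0) + (R (0, s) + t)" for y s
    using linear_add[OF lR, of "(y, 0)" "(0, s)"] by simp
  have sle: "sl s = (\<lambda>y. \<psi> (R (y, 0) + (R (0, s) + t)))" for s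
    by (rule ext, unfold sl_def, subst aff, rule refl)
  have lin: "linear (\<lambda>y::'a. R (y, 0))"
    using linear_compose[of "\<lambda>y::'a. (y, 0::real)" R] lR by (auto simp: linear_iff o_def)
  have st: "test_fun E (sl s)" for s
  proof (rule test_funI[OF _ K' K'E])
    show "smooth_fun (sl s)" unfolding sle by (rule smooth_comp_affine[OF lin sm])
    fix y assume "y \<notin> K'"
    then have "R (y, s) + t \<notin> K" unfolding K'_def using inv[of "(y, s)"] by force
    then show "sl s y = 0" using K(3) by (simp add: sl_def)
  qed
  have gs: "norm (cgrad (sl s) y) \<le> norm (cgrad \<psi> (R (y, s) + t))" for s y
  proof -
    have "((\<lambda>y. R (y, 0) + (R (0, s) + t)) has_derivative (\<lambda>y. R (y, 0))) (at y)"
      using has_derivative_add[OF linear_imp_has_derivative[OF lin] has_derivative_const] by simp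
    from has_derivative_compose[OF this smooth_has_derivative[OF sm]]
    have d: "(sl s has_derivative (\<lambda>v. cgrad \<psi> (R (y, s) + t) \<bullet> R (v, 0))) (at y)"
      by (simp only: sle aff[symmetric])
    let ?g = "cgrad (sl s) y"
    \<comment> \<open>Evaluating the derivative of the slice on its own gradient gives |g|^2 <=
      |grad \<psi>| |g|, with no need to split the full gradient into components.\<close>
    have "?g \<bullet> ?g = cgrad \<psi> (R (y, s) + t) \<bullet> R (?g, 0)"
      using has_derivative_unique[OF smooth_has_derivative[OF test_fun_smooth[OF st]] d] by metis
    also have "\<dots> \<le> norm (cgrad \<psi> (R (y, s) + t)) * norm ?g"
      using norm_cauchy_schwarz[of "cgrad \<psi> (R (y, s) + t)" "R (?g, 0)"] by (simp add: nR norm_Pair)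
    finally show ?thesis by (cases "?g = 0") (auto simp: power2_norm_eq_inner[symmetric] power2_eq_square)
  qed
  have split: "ennreal (N2 lborel h) = (\<integral>\<^sup>+s. (\<integral>\<^sup>+y. ennreal ((norm (h (R (y, s) + t)))\<^sup>2) \<partial>lborel) \<partial>lborel)"
    if h: "sqi lborel h" for h :: "'a \<times> real \<Rightarrow> 'c::euclidean_space"
  proof -
    have [measurable]: "h \<in> borel_measurable borel" using h by (simp add: sqi_def)
    have "ennreal (N2 lborel h) = (\<integral>\<^sup>+x. ennreal ((norm (h x))\<^sup>2) \<partial>lborel)" using sqi_nn_integral[OF h] by simp
    also have "\<dots> = (\<integral>\<^sup>+x. ennreal ((norm (h (R x + t)))\<^sup>2) \<partial>lborel)"
      using lborel_nn_integral_rigid[OF R, of "\<lambda>x. ennreal ((norm (h x))\<^sup>2)" t] by simp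
    also have "\<dots> = (\<integral>\<^sup>+x. ennreal ((norm (h (R x + t)))\<^sup>2) \<partial>(lborel \<Otimes>\<^sub>M lborel))" by (simp add: lborel_prod)
    also have "\<dots> = (\<integral>\<^sup>+s. (\<integral>\<^sup>+y. ennreal ((norm (h (R (y, s) + t)))\<^sup>2) \<partial>lborel) \<partial>lborel)"
      by (rule lborel_pair.nn_integral_snd[symmetric]) (simp add: lborel_prod)
    finally show ?thesis .
  qed
  have "ennreal (\<mu> * N2 lborel \<psi>) = ennreal \<mu> * (\<integral>\<^sup>+s. (\<integral>\<^sup>+y. ennreal ((norm (sl s y))\<^sup>2) \<partial>lborel) \<partial>lborel)"
    using split[OF sq(1)] \<mu>(1) by (simp add: ennreal_mult N2_nonneg sl_def)
  also have "\<dots> = (\<integral>\<^sup>+s. ennreal \<mu> * (\<integral>\<^sup>+y. ennreal ((norm (sl s y))\<^sup>2) \<partial>lborel) \<partial>lborel)"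
    unfolding sl_def by (rule nn_integral_cmult[symmetric]) measurable
  also have "\<dots> \<le> (\<integral>\<^sup>+s. (\<integral>\<^sup>+y. ennreal ((norm (cgrad \<psi> (R (y, s) + t)))\<^sup>2) \<partial>lborel) \<partial>lborel)"
  proof (rule nn_integral_mono)
    fix s :: real
    have "ennreal \<mu> * (\<integral>\<^sup>+y. ennreal ((norm (sl s y))\<^sup>2) \<partial>lborel) = ennreal (\<mu> * N2 lborel (sl s))"
      using sqi_nn_integral[OF test_fun_sqi(1)[OF st]] \<mu>(1) by (simp add: ennreal_mult N2_nonneg)
    also have "\<dots> \<le> ennreal (N2 lborel (cgrad (sl s)))" by (intro ennreal_leI \<mu>(2) st)
    also have "\<dots> = (\<integral>\<^sup>+y. ennreal ((norm (cgrad (sl s) y))\<^sup>2) \<partial>lborel)"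
      using sqi_nn_integral[OF test_fun_sqi(2)[OF st]] by simp
    also have "\<dots> \<le> (\<integral>\<^sup>+y. ennreal ((norm (cgrad \<psi> (R (y, s) + t)))\<^sup>2) \<partial>lborel)"
      by (intro nn_integral_mono ennreal_leI power_mono gs) auto
    finally show "ennreal \<mu> * (\<integral>\<^sup>+y. ennreal ((norm (sl s y))\<^sup>2) \<partial>lborel) \<le> (\<integral>\<^sup>+y. ennreal ((norm (cgrad \<psi> (R (y, s) + t)))\<^sup>2) \<partial>lborel)" .
  qed
  also have "\<dots> = ennreal (N2 lborel (cgrad \<psi>))" using split[OF sq(2)] by simp
  finally show ?thesis by (simp add: N2_nonneg ennreal_le_iff)
qed

text \<open>Outside the ball the sets C i are disjoint and cover \<Omega>, so a function that
  vanishes in the ball splits into pieces, one in each C i. At every point at most one piece is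
  nonzero; hence both integrals are additive over the pieces, and the bounds can be summed.\<close>

lemma ends_bound:
  fixes C :: "'i \<Rightarrow> 'b::euclidean_space set"
  assumes I: "finite I" and C: "\<And>i. i \<in> I \<Longrightarrow> open (C i)"
    and disj: "\<And>i j. i \<in> I \<Longrightarrow> j \<in> I \<Longrightarrow> i \<noteq> j \<Longrightarrow> (C i \<inter> C j) - ball 0 \<rho> = {}"
    and \<Omega>: "\<Omega> \<subseteq> ball 0 \<rho> \<union> (\<Union>i\<in>I. C i)"
    and \<mu>: "\<And>i \<phi>. i \<in> I \<Longrightarrow> test_fun (C i) \<phi> \<Longrightarrow> \<mu> * N2 lborel \<phi> \<le> N2 lborel (cgrad \<phi>)"
    and \<psi>: "test_fun \<Omega> \<psi>" "\<And>x. x \<in> ball 0 \<rho> \<Longrightarrow> \<psi> x = 0"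
  shows "\<mu> * N2 lborel \<psi> \<le> N2 lborel (cgrad \<psi>)"
proof -
  note sm = test_fun_smooth[OF \<psi>(1)] and sq = test_fun_sqi[OF \<psi>(1)]
  obtain K0 where K0: "compact K0" "K0 \<subseteq> \<Omega>" "\<And>x. x \<notin> K0 \<Longrightarrow> \<psi> x = 0" "\<And>x. x \<notin> K0 \<Longrightarrow> cgrad \<psi> x = 0"
    using test_funE[OF \<psi>(1)] by metis
  define K where "K = K0 - ball 0 \<rho>"
  have K: "compact K" unfolding K_def by (intro compact_diff K0 open_ball)
  have psi0: "\<psi> x = 0" if "x \<notin> K" for x using that K0(3) \<psi>(2) by (auto simp: K_def)
  have grad0: "cgrad \<psi> x = 0" if "x \<notin> K" for x
  proof (cases "x \<in> ball 0 \<rho>")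
    case True
    show ?thesis
    proof (rule cgrad_eqI)
      have "((\<lambda>x. 0) has_derivative (\<lambda>v. 0)) (at x)" by simp
      then have "(\<psi> has_derivative (\<lambda>v. 0)) (at x)"
        by (rule has_derivative_transform_within_open[OF _ open_ball True]) (simp add: \<psi>(2))
      then show "(\<psi> has_derivative (\<bullet>) 0) (at x)" by (simp add: inner_zero_left[abs_def])
    qed
  qed (use that K0(4) in \<open>auto simp: K_def\<close>)
  have uniq: "\<exists>i\<in>I. x \<in> C i \<and> (\<forall>j\<in>I. x \<in> C j \<longrightarrow> j = i)" if x: "x \<in> K" for x
  proof -
    have "x \<in> (\<Union>i\<in>I. C i)" using x K0(2) \<Omega> by (auto simp: K_def)
    then obtain i where i: "i \<in> I" "x \<in> C i" by blast
    moreover have "j = i" if "j \<in> I" "x \<in> C j" for j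
    proof (rule ccontr)
      assume "j \<noteq> i"
      then have "(C i \<inter> C j) - ball 0 \<rho> = {}" using disj[OF i(1) that(1)] by simp
      moreover have "x \<notin> ball 0 \<rho>" using x by (simp add: K_def)
      ultimately show False using i(2) that(2) by blast
    qed
    ultimately show ?thesis by blast
  qed
  define p where "p i x = (if x \<in> C i then \<psi> x else 0)" for i x
  have Kc: "compact (K \<inter> C i)" if i: "i \<in> I" for i
  proof -
    \<comment> \<open>Removing the other ends, which are open, from a compact set leaves a compact
      set. Each piece thus has compact support inside the open set C i, and its extension by zero is
      smooth.\<close>
    have "K \<inter> C i = K - (\<Union>j\<in>I - {i}. C j)" using uniq i by blast
    then show ?thesis using K C by (auto intro!: compact_diff open_UN)
  qed
  have p: "test_fun (C i) (p i)" and pg: "cgrad (p i) x = (if x \<in> C i then cgrad \<psi> x else 0)" if i: "i \<in> I" for i x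
  proof -
    have z: "p i y = 0" if "y \<notin> K \<inter> C i" for y using that psi0 by (auto simp: p_def)
    have op: "open (- (K \<inter> C i))" by (intro open_Compl compact_imp_closed Kc i)
    show "test_fun (C i) (p i)"
    proof (rule test_funI[OF _ Kc[OF i]])
      show "smooth_fun (p i)"
      proof (rule smooth_local)
        fix x
        show "\<exists>U f. open U \<and> x \<in> U \<and> smooth_fun f \<and> (\<forall>y\<in>U. p i y = f y)"
        proof (cases "x \<in> C i")
          case True then show ?thesis using C[OF i] sm by (intro exI[of _ "C i"] exI[of _ \<psi>]) (auto simp: p_def)
        next
          case False
          then show ?thesis using op z smooth_const[of 0]
            by (intro exI[of _ "- (K \<inter> C i)"] exI[of _ "\<lambda>x. 0"]) auto
        qed
      qed
    qed (use z in auto)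
    show "cgrad (p i) x = (if x \<in> C i then cgrad \<psi> x else 0)"
    proof (cases "x \<in> C i")
      case True
      have "(p i has_derivative (\<lambda>v. cgrad \<psi> x \<bullet> v)) (at x)"
        by (rule has_derivative_transform_within_open[OF smooth_has_derivative[OF sm] C[OF i] True]) (simp add: p_def)
      then show ?thesis using True by (simp add: cgrad_eqI)
    next
      case False
      have "((\<lambda>x. 0) has_derivative (\<lambda>v. 0)) (at x)" by simp
      then have "(p i has_derivative (\<lambda>v. 0)) (at x)"
        by (rule has_derivative_transform_within_open[OF _ op]) (use False z in auto)
      then show ?thesis using False by (simp add: cgrad_eqI inner_zero_left[abs_def])
    qed
  qed
  have sum: "(\<Sum>i\<in>I. (norm (if x \<in> C i then h x else 0))\<^sup>2) = (norm (h x))\<^sup>2"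
    if "x \<notin> K \<Longrightarrow> h x = 0" for h :: "'b \<Rightarrow> 'c::euclidean_space" and x
  proof (cases "x \<in> K")
    case True
    then obtain i where i: "i \<in> I" "x \<in> C i" "\<forall>j\<in>I. x \<in> C j \<longrightarrow> j = i" using uniq by blast
    have "(\<Sum>j\<in>I. (norm (if x \<in> C j then h x else 0))\<^sup>2) = (\<Sum>j\<in>I. if j = i then (norm (h x))\<^sup>2 else 0)"
    proof (rule sum.cong[OF refl])
      fix j assume "j \<in> I"
      then have "x \<in> C j \<longleftrightarrow> j = i" using i by blast
      then show "(norm (if x \<in> C j then h x else 0))\<^sup>2 = (if j = i then (norm (h x))\<^sup>2 else 0)" by simp
    qed
    then show ?thesis using I i(1) by simp
  next
    case False
    then have "h x = 0" by (rule that)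
    then have "(if x \<in> C i then h x else 0) = 0" for i by simp
    then show ?thesis using \<open>h x = 0\<close> by (simp only: norm_zero) simp
  qed
  have s1: "(norm (\<psi> x))\<^sup>2 = (\<Sum>i\<in>I. (norm (p i x))\<^sup>2)" for x
    unfolding p_def by (rule sum[symmetric]) (rule psi0)
  have s2: "(norm (cgrad \<psi> x))\<^sup>2 = (\<Sum>i\<in>I. (norm (cgrad (p i) x))\<^sup>2)" for x
    using sum[of x "cgrad \<psi>", OF grad0] pg by (simp cong: sum.cong)
  have "N2 lborel \<psi> = (\<Sum>i\<in>I. N2 lborel (p i))"
    unfolding N2_def s1 by (rule Bochner_Integration.integral_sum) (rule sqi_integrable[OF test_fun_sqi(1)[OF p]])
  then have "\<mu> * N2 lborel \<psi> = (\<Sum>i\<in>I. \<mu> * N2 lborel (p i))" by (simp only: sum_distrib_left)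
  also have "\<dots> \<le> (\<Sum>i\<in>I. N2 lborel (cgrad (p i)))"
    by (rule sum_mono) (rule \<mu>[OF _ p])
  also have "\<dots> = N2 lborel (cgrad \<psi>)"
    unfolding N2_def s2 by (rule Bochner_Integration.integral_sum[symmetric]) (rule sqi_integrable[OF test_fun_sqi(2)[OF p]])
  finally show ?thesis .
qed

section \<open>Minimizing sequences\<close>

lemma h10_pair_poincare:
  assumes L: "\<And>\<phi>. test_fun A \<phi> \<Longrightarrow> L * N2 lborel \<phi> \<le> N2 lborel (cgrad \<phi>)" and h: "h10_pair A U G"
  shows "L * N2 lborel U \<le> N2 lborel G"
proof -
  obtain \<phi> where \<phi>: "sqi lborel U" "sqi lborel G" "\<forall>n. test_fun A (\<phi> n)"
    "(\<lambda>n. N2 lborel (\<lambda>x. U x - \<phi> n x)) \<longlonglongrightarrow> 0" "(\<lambda>n. N2 lborel (\<lambda>x. G x - cgrad (\<phi> n) x)) \<longlonglongrightarrow> 0"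
    using h unfolding h10_pair_def by blast
  note t = \<phi>(3)[rule_format]
  have l: "(\<lambda>n. L * N2 lborel (\<phi> n)) \<longlonglongrightarrow> L * N2 lborel U"
    by (intro tendsto_mult tendsto_const N2_tendsto test_fun_sqi(1)[OF t] \<phi>)
  have g: "(\<lambda>n. N2 lborel (cgrad (\<phi> n))) \<longlonglongrightarrow> N2 lborel G"
    by (intro N2_tendsto test_fun_sqi(2)[OF t] \<phi>)
  show ?thesis by (rule LIMSEQ_le[OF l g]) (use L[OF t] in auto)
qed

text \<open>By the parallelogram law a minimizing sequence that converges in $L^2$ converges in $W^{1,2}$.\<close>

lemma minimizing_sequence_limit:
  assumes L: "\<And>\<phi>. test_fun A \<phi> \<Longrightarrow> L * N2 lborel \<phi> \<le> N2 lborel (cgrad \<phi>)" "L \<ge> 0"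
    and t: "\<And>n. test_fun A (\<psi> n)" and W: "sqi lborel W" "(\<lambda>n. N2 lborel (\<lambda>x. W x - \<psi> n x)) \<longlonglongrightarrow> 0"
    and q: "\<And>n. N2 lborel (cgrad (\<psi> n)) \<le> q n" "q \<longlonglongrightarrow> L * N2 lborel W"
  shows "\<exists>G. h10_pair A W G \<and> N2 lborel G = L * N2 lborel W"
proof -
  note s = test_fun_sqi(1)[OF t] and sg = test_fun_sqi(2)[OF t]
  \<comment> \<open>A bound on the excess energy plus L times the squared distance to W; it controls
    the gradients in pairs, so that they form a Cauchy sequence before any limit gradient is known.
    The upper bound q stands in for the energies because those of regularized functions are known
    only from above.\<close>
  define c where "c n = (q n - L * N2 lborel (\<psi> n)) + L * N2 lborel (\<lambda>x. W x - \<psi> n x)" for n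
  have Nl: "(\<lambda>n. N2 lborel (\<psi> n)) \<longlonglongrightarrow> N2 lborel W" by (rule N2_tendsto[OF s W])
  have "c \<longlonglongrightarrow> (L * N2 lborel W - L * N2 lborel W) + L * 0"
    unfolding c_def by (intro tendsto_intros q Nl W)
  then have c0: "c \<longlonglongrightarrow> 0" by simp
  have main: "N2 lborel (\<lambda>x. cgrad (\<psi> m) x - cgrad (\<psi> n) x) \<le> 2 * c m + 2 * c n" for m n
  proof -
    have g: "cgrad (\<lambda>x. \<psi> m x + \<psi> n x) = (\<lambda>x. cgrad (\<psi> m) x + cgrad (\<psi> n) x)"
      using cgrad_add[OF test_fun_smooth[OF t] test_fun_smooth[OF t]] by auto
    have "L * N2 lborel (\<lambda>x. \<psi> m x + \<psi> n x) \<le> N2 lborel (\<lambda>x. cgrad (\<psi> m) x + cgrad (\<psi> n) x)"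
      using L(1)[OF test_fun_add[OF t t], of m n] by (simp only: g)
    moreover have "N2 lborel (\<lambda>x. cgrad (\<psi> m) x + cgrad (\<psi> n) x) + N2 lborel (\<lambda>x. cgrad (\<psi> m) x - cgrad (\<psi> n) x)
        \<le> 2 * q m + 2 * q n"
      using N2_parallelogram[OF sg sg, of m n] q(1)[of m] q(1)[of n] by simp
    moreover have "L * N2 lborel (\<lambda>x. \<psi> m x + \<psi> n x) = 2 * (L * N2 lborel (\<psi> m)) + 2 * (L * N2 lborel (\<psi> n))
        - L * N2 lborel (\<lambda>x. \<psi> m x - \<psi> n x)"
    proof -
      have "L * (N2 lborel (\<lambda>x. \<psi> m x + \<psi> n x) + N2 lborel (\<lambda>x. \<psi> m x - \<psi> n x)) = L * (2 * N2 lborel (\<psi> m) + 2 * N2 lborel (\<psi> n))"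
        by (simp only: N2_parallelogram[OF s s])
      then show ?thesis by (simp only: distrib_left)
    qed
    moreover have "L * N2 lborel (\<lambda>x. \<psi> m x - \<psi> n x) \<le> 2 * (L * N2 lborel (\<lambda>x. W x - \<psi> m x)) + 2 * (L * N2 lborel (\<lambda>x. W x - \<psi> n x))"
    proof -
      note d = sqi_diff[OF W(1) s]
      have "N2 lborel (\<lambda>x. (W x - \<psi> n x) - (W x - \<psi> m x)) \<le> 2 * N2 lborel (\<lambda>x. W x - \<psi> n x) + 2 * N2 lborel (\<lambda>x. W x - \<psi> m x)"
        using N2_parallelogram[OF d d, of n m] N2_nonneg[of lborel "\<lambda>x. (W x - \<psi> n x) + (W x - \<psi> m x)"] by simp
      then have "N2 lborel (\<lambda>x. \<psi> m x - \<psi> n x) \<le> 2 * N2 lborel (\<lambda>x. W x - \<psi> n x) + 2 * N2 lborel (\<lambda>x. W x - \<psi> m x)"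
        by simp
      from mult_left_mono[OF this L(2)] show ?thesis by (simp add: algebra_simps)
    qed
    ultimately show ?thesis unfolding c_def by (simp add: algebra_simps)
  qed
  have "\<exists>G. sqi lborel G \<and> (\<lambda>n. N2 lborel (\<lambda>x. G x - cgrad (\<psi> n) x)) \<longlonglongrightarrow> 0"
  proof (rule L2_complete[OF sg])
    fix e :: real assume "e > 0"
    then have "\<forall>\<^sub>F n in sequentially. c n < e / 4" by (intro order_tendstoD(2)[OF c0]) simp
    then obtain N where N: "\<And>n. n \<ge> N \<Longrightarrow> c n < e / 4" by (auto simp: eventually_sequentially)
    have "N2 lborel (\<lambda>x. cgrad (\<psi> m) x - cgrad (\<psi> n) x) < e" if "m \<ge> N" "n \<ge> N" for m n
      using main[of m n] N[OF that(1)] N[OF that(2)] by linarith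
    then show "\<exists>N. \<forall>m\<ge>N. \<forall>n\<ge>N. N2 lborel (\<lambda>x. cgrad (\<psi> m) x - cgrad (\<psi> n) x) < e" by blast
  qed
  then obtain G where G: "sqi lborel G" "(\<lambda>n. N2 lborel (\<lambda>x. G x - cgrad (\<psi> n) x)) \<longlonglongrightarrow> 0" by blast
  have h: "h10_pair A W G" using W G t unfolding h10_pair_def by blast
  have "N2 lborel G \<le> L * N2 lborel W"
    by (rule LIMSEQ_le[OF N2_tendsto[OF sg G] q(2)]) (use q(1) in auto)
  then show ?thesis using h h10_pair_poincare[OF L(1) h] by (intro exI[of _ G]) auto
qed

text \<open>The factor 1 + s is |x|^2 / R^2 for the s of \<open>localization\<close> and comes from
  the gradient of s. With z = 1/s, the bounds z exp(-z) <= 1 and z^2 exp(-z) <= 2 give 4 + 2 = 6.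
  Together with the factor 4 / R^2 from the squared gradient of s this is the 24 / R^2 used
  there.\<close>

lemma flat'_bound:
  assumes "s > -1" shows "(flat' s)\<^sup>2 * (1 + s) \<le> 6"
proof (cases "s > 0")
  case True
  define z where "z = 1 / s"
  have z: "z > 0" using True by (simp add: z_def)
  have ex: "1 + z + z\<^sup>2 / 2 \<le> exp z" using exp_lower_Taylor_quadratic[of z] z by simp
  have e1: "z * exp (- z) \<le> 1" and e2: "z\<^sup>2 * exp (- z) \<le> 2"
  proof -
    have "z \<le> exp z" "z\<^sup>2 \<le> 2 * exp z" using ex z zero_le_power2[of z] by linarith+
    then show "z * exp (- z) \<le> 1" "z\<^sup>2 * exp (- z) \<le> 2" by (simp_all add: exp_minus divide_simps)
  qed
  have f: "flat' s = z\<^sup>2 * exp (- z)" using True by (simp add: flat'_def z_def power_divide)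
  have "(flat' s)\<^sup>2 * (1 + s) = (z\<^sup>2 * exp (- z)) * (z\<^sup>2 * exp (- z)) + (z\<^sup>2 * exp (- z)) * (z * exp (- z))"
    unfolding f using z by (simp add: z_def power2_eq_square field_simps)
  also have "\<dots> \<le> 2 * 2 + 2 * 1"
    using e1 e2 z by (intro add_mono mult_mono) auto
  finally show ?thesis by simp
qed (use assms in \<open>simp add: flat'_def\<close>)

lemma flat_mono: "0 < s \<Longrightarrow> s \<le> t \<Longrightarrow> flat s \<le> flat t"
  by (simp add: flat_def frac_le)

text \<open>IMS localization with $\chi=\cos\vartheta$, $\eta=\sin\vartheta$ (\<open>fc\<close> and \<open>fs\<close> are $\chi\varphi$ and $\eta\varphi$),
  where $\vartheta$ vanishes in the ball of radius $R$ and $|\nabla\vartheta|^2\le 24/R^2$.\<close>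

lemma localization:
  fixes \<phi> :: "'b::euclidean_space \<Rightarrow> real"
  assumes L: "\<And>\<phi>. test_fun A \<phi> \<Longrightarrow> L * N2 lborel \<phi> \<le> N2 lborel (cgrad \<phi>)"
    and \<mu>: "\<And>\<psi>. test_fun A \<psi> \<Longrightarrow> (\<And>x. x \<in> ball 0 \<rho> \<Longrightarrow> \<psi> x = 0) \<Longrightarrow> \<mu> * N2 lborel \<psi> \<le> N2 lborel (cgrad \<psi>)"
    and \<mu>L: "L < \<mu>" and R: "R > 0" "R \<ge> \<rho>" and \<phi>: "test_fun A \<phi>"
  shows "(\<mu> - L) * (sin (flat 3))\<^sup>2 * N2 lborel (\<lambda>x. indicator (- ball 0 (2 * R)) x * \<phi> x)
    \<le> N2 lborel (cgrad \<phi>) - L * N2 lborel \<phi> + 24 / R\<^sup>2 * N2 lborel \<phi>"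
proof -
  note sm = test_fun_smooth[OF \<phi>] and sq = test_fun_sqi[OF \<phi>]
  \<comment> \<open>Nonpositive for |x| <= R, where \<theta> vanishes, and at least 3 for |x| >= 2R,
    where \<theta> is at least \<open>flat 3\<close>.\<close>
  define s where "s x = (1 / R\<^sup>2) * (norm x)\<^sup>2 - 1" for x :: 'b
  define \<theta> where "\<theta> x = flat (s x)" for x
  have ss: "smooth_fun s" unfolding s_def[abs_def] by (intro smooth_diff smooth_cmult smooth_norm2 smooth_const)
  have gs: "cgrad s x = (2 / R\<^sup>2) *\<^sub>R x" for x
    unfolding s_def[abs_def] cgrad_diff[OF smooth_cmult[OF smooth_norm2] smooth_const]
      cgrad_cmult[OF smooth_norm2] cgrad_norm2 cgrad_const by simp
  have \<theta>s: "smooth_fun \<theta>" unfolding \<theta>_def[abs_def] by (rule smooth_flat[OF ss])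
  have g\<theta>: "cgrad \<theta> x = flat' (s x) *\<^sub>R cgrad s x" for x
    unfolding \<theta>_def[abs_def] by (rule cgrad_comp[OF ss flat_deriv])
  have b\<theta>: "(norm (cgrad \<theta> x))\<^sup>2 \<le> 24 / R\<^sup>2" for x
  proof -
    have "s x > -1 \<or> x = 0" using R(1) by (auto simp: s_def)
    moreover have "(norm (cgrad \<theta> x))\<^sup>2 = (4 / R\<^sup>2) * ((flat' (s x))\<^sup>2 * (1 + s x))"
      using R(1) by (simp add: g\<theta> gs s_def power_mult_distrib power_divide field_simps power2_eq_square)
    ultimately show ?thesis
    proof (elim disjE)
      assume "s x > -1"
      from mult_left_mono[OF flat'_bound[OF this], of "4 / R\<^sup>2"]
      show ?thesis using \<open>(norm (cgrad \<theta> x))\<^sup>2 = _\<close> R(1) by simp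
    qed (simp add: g\<theta> gs)
  qed
  define fc where "fc x = cos (\<theta> x) * \<phi> x" for x
  define fs where "fs x = sin (\<theta> x) * \<phi> x" for x
  have t: "test_fun A fc" "test_fun A fs"
    unfolding fc_def[abs_def] fs_def[abs_def] by (intro test_fun_mult \<phi> smooth_cos smooth_sin \<theta>s)+
  have gc: "cgrad (\<lambda>x. cos (\<theta> x)) x = (- sin (\<theta> x)) *\<^sub>R cgrad \<theta> x"
    and gsn: "cgrad (\<lambda>x. sin (\<theta> x)) x = cos (\<theta> x) *\<^sub>R cgrad \<theta> x" for x
    by (rule cgrad_comp[OF \<theta>s DERIV_cos] cgrad_comp[OF \<theta>s DERIV_sin])+
  \<comment> \<open>The gradients of the two pieces arise from \<open>cgrad \<phi> x\<close> and
    \<open>\<phi> x *\<^sub>R cgrad \<theta> x\<close> by a rotation through the angle \<theta>, so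
    the mixed terms cancel.\<close>
  have pt: "(norm (cgrad fc x))\<^sup>2 + (norm (cgrad fs x))\<^sup>2 = (norm (cgrad \<phi> x))\<^sup>2 + (\<phi> x)\<^sup>2 * (norm (cgrad \<theta> x))\<^sup>2" for x
  proof -
    have ex: "(norm (c *\<^sub>R a - d *\<^sub>R b))\<^sup>2 + (norm (d *\<^sub>R a + c *\<^sub>R b))\<^sup>2 = (norm a)\<^sup>2 + (norm b)\<^sup>2"
      if "c\<^sup>2 + d\<^sup>2 = 1" for a b :: 'b and c d :: real
    proof -
      have "(norm (c *\<^sub>R a - d *\<^sub>R b))\<^sup>2 + (norm (d *\<^sub>R a + c *\<^sub>R b))\<^sup>2 = (c\<^sup>2 + d\<^sup>2) * ((norm a)\<^sup>2 + (norm b)\<^sup>2)"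
        unfolding power2_norm_eq_inner power2_eq_square[of c] power2_eq_square[of d]
        by (simp add: inner_add_left inner_add_right inner_diff_left inner_diff_right
            inner_commute[of b a] algebra_simps)
      then show ?thesis using that by simp
    qed
    have "cgrad fc x = cos (\<theta> x) *\<^sub>R cgrad \<phi> x - sin (\<theta> x) *\<^sub>R (\<phi> x *\<^sub>R cgrad \<theta> x)"
      unfolding fc_def[abs_def] cgrad_mult[OF smooth_cos[OF \<theta>s] sm] gc by (simp add: mult.commute)
    moreover have "cgrad fs x = sin (\<theta> x) *\<^sub>R cgrad \<phi> x + cos (\<theta> x) *\<^sub>R (\<phi> x *\<^sub>R cgrad \<theta> x)"
      unfolding fs_def[abs_def] cgrad_mult[OF smooth_sin[OF \<theta>s] sm] gsn by (simp add: mult.commute add.commute)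
    ultimately show ?thesis using ex[of "cos (\<theta> x)" "sin (\<theta> x)" "cgrad \<phi> x" "\<phi> x *\<^sub>R cgrad \<theta> x"] by (simp add: power_mult_distrib)
  qed
  note int = sqi_integrable[OF test_fun_sqi(1)[OF t(1)]] sqi_integrable[OF test_fun_sqi(1)[OF t(2)]]
     sqi_integrable[OF test_fun_sqi(2)[OF t(1)]] sqi_integrable[OF test_fun_sqi(2)[OF t(2)]]
     sqi_integrable[OF sq(1)] sqi_integrable[OF sq(2)]
  have "N2 lborel (cgrad fc) + N2 lborel (cgrad fs) = (\<integral>x. (norm (cgrad fc x))\<^sup>2 + (norm (cgrad fs x))\<^sup>2 \<partial>lborel)"
    unfolding N2_def using int by simp
  also have "\<dots> \<le> (\<integral>x. (norm (cgrad \<phi> x))\<^sup>2 + 24 / R\<^sup>2 * (norm (\<phi> x))\<^sup>2 \<partial>lborel)"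
  proof (rule integral_mono)
    show "(norm (cgrad fc x))\<^sup>2 + (norm (cgrad fs x))\<^sup>2 \<le> (norm (cgrad \<phi> x))\<^sup>2 + 24 / R\<^sup>2 * (norm (\<phi> x))\<^sup>2" for x
      unfolding pt using mult_left_mono[OF b\<theta>[of x], of "(\<phi> x)\<^sup>2"] by (simp add: mult.commute)
  qed (use int in \<open>auto intro!: Bochner_Integration.integrable_add integrable_mult_right\<close>)
  also have "\<dots> = N2 lborel (cgrad \<phi>) + 24 / R\<^sup>2 * N2 lborel \<phi>"
    unfolding N2_def using int by (subst Bochner_Integration.integral_add) (auto intro!: integrable_mult_right)
  finally have e1: "N2 lborel (cgrad fc) + N2 lborel (cgrad fs) \<le> N2 lborel (cgrad \<phi>) + 24 / R\<^sup>2 * N2 lborel \<phi>" .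
  have "N2 lborel fc + N2 lborel fs = (\<integral>x. (norm (fc x))\<^sup>2 + (norm (fs x))\<^sup>2 \<partial>lborel)"
    unfolding N2_def using int by simp
  also have "\<dots> = N2 lborel \<phi>" unfolding N2_def
    by (intro Bochner_Integration.integral_cong refl)
       (simp add: fc_def fs_def power_mult_distrib distrib_right[symmetric])
  finally have e2: "N2 lborel fc + N2 lborel fs = N2 lborel \<phi>" .
  have e3: "\<mu> * N2 lborel fs \<le> N2 lborel (cgrad fs)"
  proof (rule \<mu>[OF t(2)])
    fix x :: 'b assume "x \<in> ball 0 \<rho>"
    then have "(norm x)\<^sup>2 \<le> R\<^sup>2" using R by (intro power_mono) auto
    then have "s x \<le> 0" using R(1) by (simp add: s_def divide_simps)
    then show "fs x = 0" by (simp add: fs_def \<theta>_def flat_def)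
  qed
  have e4: "(sin (flat 3))\<^sup>2 * N2 lborel (\<lambda>x. indicator (- ball 0 (2 * R)) x * \<phi> x) \<le> N2 lborel fs"
  proof -
    have "(sin (flat 3))\<^sup>2 * N2 lborel (\<lambda>x. indicator (- ball 0 (2 * R)) x * \<phi> x)
        = (\<integral>x. (sin (flat 3))\<^sup>2 * (norm (indicator (- ball 0 (2 * R)) x * \<phi> x))\<^sup>2 \<partial>lborel)"
      by (simp add: N2_def)
    also have "\<dots> \<le> N2 lborel fs" unfolding N2_def
    proof (rule integral_mono)
      show "integrable lborel (\<lambda>x. (sin (flat 3))\<^sup>2 * (norm (indicator (- ball 0 (2 * R)) x * \<phi> x))\<^sup>2)"
        by (intro integrable_mult_right sqi_integrable sqi_indicator sq) auto
      fix x :: 'b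
      show "(sin (flat 3))\<^sup>2 * (norm (indicator (- ball 0 (2 * R)) x * \<phi> x))\<^sup>2 \<le> (norm (fs x))\<^sup>2"
      proof (cases "x \<in> ball 0 (2 * R)")
        case False
        then have "(2 * R)\<^sup>2 \<le> (norm x)\<^sup>2" using R(1) by (intro power_mono) auto
        then have "s x \<ge> 3" using R(1) by (simp add: s_def divide_simps power_mult_distrib)
        then have m: "flat 3 \<le> \<theta> x" unfolding \<theta>_def by (intro flat_mono) auto
        have "flat 3 \<ge> 0" "\<theta> x \<le> 1" by (auto simp: flat_nonneg \<theta>_def flat_le_1)
        \<comment> \<open>The values of \<theta> lie between 0 and 1, where the sine is nonnegative
          and increasing.\<close>
        moreover have "(1::real) \<le> pi / 2" using pi_gt3 by simp
        ultimately have "0 \<le> sin (flat 3)" "sin (flat 3) \<le> sin (\<theta> x)"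
          using m by (auto intro!: sin_ge_zero sin_monotone_2pi_le)
        then have "(sin (flat 3))\<^sup>2 \<le> (sin (\<theta> x))\<^sup>2" by (intro power_mono) auto
        then show ?thesis using False by (simp add: fs_def power_mult_distrib mult_right_mono)
      qed simp
    qed (rule int)
    finally show ?thesis .
  qed
  \<comment> \<open>The constant L serves the inner piece and \<mu> the outer one; the surplus \<mu>
    - L on the outer piece is paid for by the excess energy and the localization error.\<close>
  have "(\<mu> - L) * ((sin (flat 3))\<^sup>2 * N2 lborel (\<lambda>x. indicator (- ball 0 (2 * R)) x * \<phi> x)) \<le> (\<mu> - L) * N2 lborel fs"
    using e4 \<mu>L by (intro mult_left_mono) auto
  also have "\<dots> = \<mu> * N2 lborel fs - L * N2 lborel fs" by (simp add: algebra_simps)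
  also have "\<dots> \<le> N2 lborel (cgrad \<phi>) - L * N2 lborel \<phi> + 24 / R\<^sup>2 * N2 lborel \<phi>"
    using e1 e3 L[OF t(1)] unfolding e2[symmetric] by (simp add: algebra_simps)
  finally show ?thesis by (simp add: mult.assoc)
qed

text \<open>\<open>localization\<close> bounds \<kappa> times the mass outside a large ball by the
  excess energy, which tends to 0, plus 24 M1 / R^2. This rules out escape to infinity along the
  ends, and \<open>rellich\<close> handles what stays in a ball.\<close>

theorem minimizing_sequence_compact:
  fixes f :: "nat \<Rightarrow> 'b::euclidean_space \<Rightarrow> real"
  assumes L: "\<And>\<phi>. test_fun A \<phi> \<Longrightarrow> L * N2 lborel \<phi> \<le> N2 lborel (cgrad \<phi>)" "L \<ge> 0"
    and \<mu>: "\<And>\<psi>. test_fun A \<psi> \<Longrightarrow> (\<And>x. x \<in> ball 0 \<rho> \<Longrightarrow> \<psi> x = 0) \<Longrightarrow> \<mu> * N2 lborel \<psi> \<le> N2 lborel (cgrad \<psi>)"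
    and \<mu>L: "L < \<mu>"
    and t: "\<And>n. test_fun A (f n)" and M1: "\<And>n. N2 lborel (f n) \<le> M1"
    and a: "(\<lambda>n. N2 lborel (cgrad (f n)) - L * N2 lborel (f n)) \<longlonglongrightarrow> 0"
  shows "\<exists>r W. strict_mono (r :: nat \<Rightarrow> nat) \<and> sqi lborel W \<and> (\<lambda>n. N2 lborel (\<lambda>x. W x - f (r n) x)) \<longlonglongrightarrow> 0"
proof -
  note s = test_fun_sqi(1)[OF t]
  define \<kappa> where "\<kappa> = (\<mu> - L) * (sin (flat 3))\<^sup>2"
  have \<kappa>: "\<kappa> > 0"
  proof -
    have "0 < flat 3" "flat 3 \<le> 1" by (simp_all add: flat_pos_iff flat_le_1)
    then have "sin (flat 3) > 0" using pi_gt3 by (intro sin_gt_zero) auto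
    then show ?thesis using \<mu>L by (simp add: \<kappa>_def)
  qed
  have M1nn: "M1 \<ge> 0" using M1[of 0] N2_nonneg[of lborel "f 0"] by linarith
  obtain Ma where Ma: "\<And>n. N2 lborel (cgrad (f n)) - L * N2 lborel (f n) \<le> Ma"
    using convergent_imp_Bseq[OF convergentI[OF a]] unfolding Bseq_def by (metis abs_le_D1 real_norm_def)
  have M: "N2 lborel (cgrad (f n)) \<le> Ma + L * M1" for n
    using Ma[of n] mult_left_mono[OF M1[of n] L(2)] by linarith
  obtain r where r: "strict_mono (r :: nat \<Rightarrow> nat)"
    and loc: "\<And>R e. e > 0 \<Longrightarrow> \<exists>N. \<forall>m\<ge>N. \<forall>n\<ge>N. N2 lborel (\<lambda>x. indicator (ball 0 R) x * (f (r m) x - f (r n) x)) < e"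
    by (rule rellich[of f, OF test_fun_mono[OF t] M1 M]) auto
  have "\<exists>W. sqi lborel W \<and> (\<lambda>n. N2 lborel (\<lambda>x. W x - f (r n) x)) \<longlonglongrightarrow> 0"
  proof (rule L2_complete[OF s])
    fix e :: real assume e: "e > 0"
    have "((\<lambda>R. 24 / R\<^sup>2 * M1) \<longlongrightarrow> 0) at_top" by real_asymp
    then have "\<forall>\<^sub>F R in at_top. 24 / R\<^sup>2 * M1 < \<kappa> * e / 32 \<and> R > 0 \<and> R \<ge> \<rho>"
      using e \<kappa> by (intro eventually_conj order_tendstoD(2) eventually_gt_at_top eventually_ge_at_top) auto
    then obtain R where R: "24 / R\<^sup>2 * M1 < \<kappa> * e / 32" "R > 0" "R \<ge> \<rho>"
      using eventually_happens'[OF trivial_limit_at_top_linorder] by blast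
    have "(\<lambda>n. N2 lborel (cgrad (f (r n))) - L * N2 lborel (f (r n))) \<longlonglongrightarrow> 0"
      using LIMSEQ_subseq_LIMSEQ[OF a r] by (simp add: o_def)
    then have "\<forall>\<^sub>F n in sequentially. N2 lborel (cgrad (f (r n))) - L * N2 lborel (f (r n)) < \<kappa> * e / 32"
      using e \<kappa> by (intro order_tendstoD(2)) auto
    then obtain N1 where N1: "\<And>n. n \<ge> N1 \<Longrightarrow> N2 lborel (cgrad (f (r n))) - L * N2 lborel (f (r n)) < \<kappa> * e / 32"
      by (auto simp: eventually_sequentially)
    let ?o = "\<lambda>n x. indicator (- ball 0 (2 * R)) x * f n x"
    \<comment> \<open>In the final estimate the part in the ball enters with factor 2 and each tail
      with factor 4, so that the total is below e / 4 + e / 2.\<close>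
    have tail: "N2 lborel (?o (r n)) < e / 16" if "n \<ge> N1" for n
    proof -
      have "\<kappa> * N2 lborel (?o (r n)) \<le> N2 lborel (cgrad (f (r n))) - L * N2 lborel (f (r n)) + 24 / R\<^sup>2 * N2 lborel (f (r n))"
        unfolding \<kappa>_def by (rule localization[OF L(1) \<mu> \<mu>L R(2,3) t])
      also have "\<dots> < \<kappa> * e / 32 + \<kappa> * e / 32"
        using N1[OF that] R(1) mult_left_mono[OF M1[of "r n"], of "24 / R\<^sup>2"] by (intro add_strict_mono) auto
      finally show ?thesis using \<kappa> by (simp add: field_simps)
    qed
    obtain N2' where N2': "\<forall>m\<ge>N2'. \<forall>n\<ge>N2'. N2 lborel (\<lambda>x. indicator (ball 0 (2 * R)) x * (f (r m) x - f (r n) x)) < e / 8"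
      using loc[of "e / 8" "2 * R"] e by auto
    have "N2 lborel (\<lambda>x. f (r m) x - f (r n) x) < e" if mn: "m \<ge> max N1 N2'" "n \<ge> max N1 N2'" for m n
    proof -
      let ?b = "\<lambda>x. indicator (ball 0 (2 * R)) x * (f (r m) x - f (r n) x)"
      let ?d = "\<lambda>x. ?o (r m) x - ?o (r n) x"
      have so: "sqi lborel (?o n)" for n by (rule sqi_indicator(1)[OF s]) auto
      have sb: "sqi lborel ?b" by (rule sqi_indicator(1)[OF sqi_diff[OF s s]]) auto
      have "N2 lborel (\<lambda>x. f (r m) x - f (r n) x) = N2 lborel (\<lambda>x. ?b x + ?d x)"
        by (rule arg_cong[of _ _ "N2 lborel"]) (auto simp: fun_eq_iff split: split_indicator)
      also have "\<dots> \<le> 2 * N2 lborel ?b + 2 * N2 lborel ?d"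
        by (rule N2_add_le[OF sb sqi_diff[OF so so]])
      also have "N2 lborel ?d \<le> 2 * N2 lborel (?o (r m)) + 2 * N2 lborel (?o (r n))"
        using N2_parallelogram[OF so so, of "r m" "r n"] N2_nonneg[of lborel "\<lambda>x. ?o (r m) x + ?o (r n) x"] by simp
      finally show ?thesis
        using tail[of m] tail[of n] N2'[rule_format, of m n] mn e by simp
    qed
    then show "\<exists>N. \<forall>m\<ge>N. \<forall>n\<ge>N. N2 lborel (\<lambda>x. f (r m) x - f (r n) x) < e" by blast
  qed
  then show ?thesis using r by blast
qed

section \<open>Eigenfunctions\<close>

text \<open>The function h(y) = sqrt(y^2 + \<delta>^2) - \<delta> vanishes at 0, so the support does
  not grow; its slope is at most 1 in absolute value, so the energy does not grow; and it stays
  within \<delta> of |y|. The squared error is at most \<delta>^2 V with V the measure of the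
  support, and the 1 in the choice of \<delta> covers V = 0.\<close>

lemma regularized_abs:
  fixes \<phi> :: "'b::euclidean_space \<Rightarrow> real"
  assumes \<phi>: "test_fun A \<phi>" and e: "e > 0"
  shows "\<exists>\<psi>. test_fun A \<psi> \<and> (\<forall>x. \<psi> x \<ge> 0) \<and> N2 lborel (cgrad \<psi>) \<le> N2 lborel (cgrad \<phi>)
     \<and> N2 lborel (\<lambda>x. \<bar>\<phi> x\<bar> - \<psi> x) \<le> e"
proof -
  note sm = test_fun_smooth[OF \<phi>] and sq = test_fun_sqi[OF \<phi>]
  obtain K where K: "compact K" "K \<subseteq> A" "\<And>x. x \<notin> K \<Longrightarrow> \<phi> x = 0" using test_funE[OF \<phi>] by metis
  have KB: "K \<in> sets borel" "bounded K" using K(1) by (auto simp: borel_compact compact_imp_bounded)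
  define V where "V = measure lborel K"
  define \<delta> where "\<delta> = sqrt (e / (V + 1))"
  have V: "V \<ge> 0" by (simp add: V_def)
  have \<delta>: "\<delta> > 0" "\<delta>\<^sup>2 * V \<le> e" using e V by (auto simp: \<delta>_def divide_simps)
  define h where "h y = sqrt (y\<^sup>2 + \<delta>\<^sup>2) - \<delta>" for y
  have pos: "y\<^sup>2 + \<delta>\<^sup>2 > 0" for y using \<delta>(1) by (simp add: add_nonneg_pos)
  have hd: "(h has_real_derivative y / sqrt (y\<^sup>2 + \<delta>\<^sup>2)) (at y)" for y
    unfolding h_def[abs_def] using pos[of y] by (auto intro!: derivative_eq_intros simp: divide_simps)
  have hs: "smooth_fun (\<lambda>x. h (\<phi> x))"
  proof -
    have "smooth_fun (\<lambda>x. (\<phi> x * \<phi> x + \<delta>\<^sup>2) powr (1/2) - \<delta>)"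
      by (intro smooth_diff smooth_powr smooth_add smooth_mult sm smooth_const) (use pos in \<open>simp add: power2_eq_square\<close>)
    then show ?thesis by (simp add: h_def powr_half_sqrt power2_eq_square)
  qed
  have t: "test_fun A (\<lambda>x. h (\<phi> x))" by (rule test_fun_comp[OF \<phi> hs]) (use \<delta> in \<open>simp add: h_def\<close>)
  have h0: "h y \<ge> 0" for y
    using real_sqrt_le_mono[of "\<delta>\<^sup>2" "y\<^sup>2 + \<delta>\<^sup>2"] \<delta>(1) by (simp add: h_def)
  have hb: "\<bar>\<bar>y\<bar> - h y\<bar> \<le> \<delta>" for y
  proof -
    have "\<bar>y\<bar> \<le> sqrt (y\<^sup>2 + \<delta>\<^sup>2)" using real_sqrt_le_mono[of "y\<^sup>2" "y\<^sup>2 + \<delta>\<^sup>2"] by simp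
    moreover have "sqrt (y\<^sup>2 + \<delta>\<^sup>2) \<le> \<bar>y\<bar> + \<delta>" using \<delta>(1) by (intro real_le_lsqrt) (auto simp: power2_sum)
    ultimately show ?thesis using \<delta>(1) by (simp add: h_def)
  qed
  have "N2 lborel (cgrad (\<lambda>x. h (\<phi> x))) \<le> N2 lborel (cgrad \<phi>)"
    unfolding N2_def
  proof (rule integral_mono)
    fix x
    let ?d = "\<phi> x / sqrt ((\<phi> x)\<^sup>2 + \<delta>\<^sup>2)"
    have "\<bar>?d\<bar> \<le> 1"
      using real_sqrt_le_mono[of "(\<phi> x)\<^sup>2" "(\<phi> x)\<^sup>2 + \<delta>\<^sup>2"] pos[of "\<phi> x"] by (simp add: abs_divide divide_simps)
    then have "norm (?d *\<^sub>R cgrad \<phi> x) \<le> norm (cgrad \<phi> x)"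
      unfolding norm_scaleR by (intro mult_left_le_one_le) auto
    then show "(norm (cgrad (\<lambda>x. h (\<phi> x)) x))\<^sup>2 \<le> (norm (cgrad \<phi> x))\<^sup>2"
      unfolding cgrad_comp[OF sm hd] by (intro power_mono) auto
  qed (use sqi_integrable[OF test_fun_sqi(2)[OF t]] sqi_integrable[OF sq(2)] in auto)
  moreover have "N2 lborel (\<lambda>x. \<bar>\<phi> x\<bar> - h (\<phi> x)) \<le> e"
  proof -
    have "N2 lborel (\<lambda>x. \<bar>\<phi> x\<bar> - h (\<phi> x)) \<le> (\<integral>x. \<delta>\<^sup>2 * indicator K x \<partial>lborel)"
      unfolding N2_def
    proof (rule integral_mono')
      show "integrable lborel (\<lambda>x. \<delta>\<^sup>2 * indicator K x :: real)" by (rule sqi_indicator_bounded(2)[OF KB])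
      show "(norm (\<bar>\<phi> x\<bar> - h (\<phi> x)))\<^sup>2 \<le> \<delta>\<^sup>2 * indicator K x" for x
      proof (cases "x \<in> K")
        case True
        have "\<bar>\<bar>\<phi> x\<bar> - h (\<phi> x)\<bar>\<^sup>2 \<le> \<delta>\<^sup>2" by (rule power_mono[OF hb]) simp
        then show ?thesis using True by simp
      next
        case False
        then have "\<phi> x = 0" by (rule K(3))
        then show ?thesis using \<delta>(1) by (simp add: h_def)
      qed
    qed simp
    also have "\<dots> = \<delta>\<^sup>2 * V" using KB by (simp add: V_def)
    finally show ?thesis using \<delta>(2) by simp
  qed
  ultimately show ?thesis using t h0 by (intro exI[of _ "\<lambda>x. h (\<phi> x)"]) auto
qed

lemma regularized_abs_sequence:
  fixes \<phi> :: "nat \<Rightarrow> 'b::euclidean_space \<Rightarrow> real"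
  assumes "\<And>n. test_fun A (\<phi> n)"
  shows "\<exists>\<psi>. \<forall>n. test_fun A (\<psi> n) \<and> (\<forall>x. \<psi> n x \<ge> 0) \<and> N2 lborel (cgrad (\<psi> n)) \<le> N2 lborel (cgrad (\<phi> n))
     \<and> N2 lborel (\<lambda>x. \<bar>\<phi> n x\<bar> - \<psi> n x) \<le> 1 / real (Suc n)"
  by (intro choice allI regularized_abs assms) simp

lemma sqi_abs: "sqi lborel f \<Longrightarrow> sqi lborel (\<lambda>x. \<bar>f x\<bar>)" and N2_abs: "N2 M (\<lambda>x. \<bar>f x\<bar>) = N2 M f"
  for f :: "_ \<Rightarrow> real"
  by (auto simp: sqi_def N2_def)

theorem exists_nonneg_minimizer:
  fixes \<phi> :: "nat \<Rightarrow> 'b::euclidean_space \<Rightarrow> real"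
  assumes L: "\<And>\<phi>. test_fun A \<phi> \<Longrightarrow> L * N2 lborel \<phi> \<le> N2 lborel (cgrad \<phi>)" "L \<ge> 0"
    and \<mu>: "\<And>\<psi>. test_fun A \<psi> \<Longrightarrow> (\<And>x. x \<in> ball 0 \<rho> \<Longrightarrow> \<psi> x = 0) \<Longrightarrow> \<mu> * N2 lborel \<psi> \<le> N2 lborel (cgrad \<psi>)"
    and \<mu>L: "L < \<mu>"
    and t: "\<And>n. test_fun A (\<phi> n)" and one: "(\<lambda>n. N2 lborel (\<phi> n)) \<longlonglongrightarrow> 1"
    and inf: "(\<lambda>n. N2 lborel (cgrad (\<phi> n))) \<longlonglongrightarrow> L"
  shows "\<exists>U G. h10_pair A U G \<and> N2 lborel U = 1 \<and> N2 lborel G = L \<and> (AE x in lborel. U x \<ge> 0)"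
proof -
  obtain \<psi> where \<psi>: "\<And>n. test_fun A (\<psi> n)" "\<And>n x. \<psi> n x \<ge> 0" "\<And>n. N2 lborel (cgrad (\<psi> n)) \<le> N2 lborel (cgrad (\<phi> n))"
     "\<And>n. N2 lborel (\<lambda>x. \<bar>\<phi> n x\<bar> - \<psi> n x) \<le> 1 / real (Suc n)"
    using regularized_abs_sequence[of A \<phi>, OF t] by blast
  note s = test_fun_sqi(1)[OF \<psi>(1)] and sf = sqi_abs[OF test_fun_sqi(1)[OF t]]
  have inv: "(\<lambda>n. 1 / real (Suc n)) \<longlonglongrightarrow> 0"
    using LIMSEQ_inverse_real_of_nat by (simp add: inverse_eq_divide)
  have d0: "(\<lambda>n. N2 lborel (\<lambda>x. \<bar>\<phi> n x\<bar> - \<psi> n x)) \<longlonglongrightarrow> 0"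
    by (rule tendsto_sandwich[OF _ _ tendsto_const inv]) (auto simp: N2_nonneg \<psi>(4) simp del: of_nat_Suc)
  \<comment> \<open>Taking absolute values preserves the norm; the triangle inequality in both
    directions passes it on to the regularization.\<close>
  have sqN: "(\<lambda>n. sqrt (N2 lborel (\<psi> n))) \<longlonglongrightarrow> 1"
  proof -
    let ?a = "\<lambda>n. sqrt (N2 lborel (\<phi> n))" and ?d = "\<lambda>n. sqrt (N2 lborel (\<lambda>x. \<bar>\<phi> n x\<bar> - \<psi> n x))"
    have a: "?a \<longlonglongrightarrow> 1" using tendsto_real_sqrt[OF one] by simp
    have d: "?d \<longlonglongrightarrow> 0" using tendsto_real_sqrt[OF d0] by simp
    have "?a n \<le> ?d n + sqrt (N2 lborel (\<psi> n))" for n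
      using N2_triangle[OF sqi_diff[OF sf s] s, of n n n] by (simp add: N2_abs)
    moreover have "sqrt (N2 lborel (\<psi> n)) \<le> ?d n + ?a n" for n
      using N2_triangle[OF sqi_diff[OF s sf] sf, of n n n] N2_minus_commute[of lborel "\<psi> n" "\<lambda>x. \<bar>\<phi> n x\<bar>"] by (simp add: N2_abs)
    ultimately have b: "?a n - ?d n \<le> sqrt (N2 lborel (\<psi> n))" "sqrt (N2 lborel (\<psi> n)) \<le> ?d n + ?a n" for n
      by (simp_all add: diff_le_eq add.commute)
    have l1: "(\<lambda>n. ?a n - ?d n) \<longlonglongrightarrow> 1" using tendsto_diff[OF a d] by simp
    have l2: "(\<lambda>n. ?d n + ?a n) \<longlonglongrightarrow> 1" using tendsto_add[OF d a] by simp
    show ?thesis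
      by (rule tendsto_sandwich[OF always_eventually always_eventually l1 l2]) (use b in auto)
  qed
  have N1: "(\<lambda>n. N2 lborel (\<psi> n)) \<longlonglongrightarrow> 1"
    using tendsto_power[OF sqN, of 2] by (simp add: N2_nonneg)
  \<comment> \<open>Regularizing could only lower the energies, and L prevents them from dropping in
    the limit: the excess is nonnegative and bounded by a null sequence.\<close>
  have a0: "(\<lambda>n. N2 lborel (cgrad (\<psi> n)) - L * N2 lborel (\<psi> n)) \<longlonglongrightarrow> 0"
  proof (rule tendsto_sandwich[OF _ _ tendsto_const])
    show "(\<lambda>n. N2 lborel (cgrad (\<phi> n)) - L * N2 lborel (\<psi> n)) \<longlonglongrightarrow> 0"
      using tendsto_diff[OF inf tendsto_mult[OF tendsto_const N1], of L] by simp
  qed (use L(1)[OF \<psi>(1)] \<psi>(3) in auto)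
  obtain M1 where M1: "\<And>n. N2 lborel (\<psi> n) \<le> M1"
    using convergent_imp_Bseq[OF convergentI[OF N1]] unfolding Bseq_def by (metis abs_le_D1 real_norm_def)
  obtain r W where r: "strict_mono (r :: nat \<Rightarrow> nat)" and W: "sqi lborel W" "(\<lambda>n. N2 lborel (\<lambda>x. W x - \<psi> (r n) x)) \<longlonglongrightarrow> 0"
    using minimizing_sequence_compact[of A L \<rho> \<mu> \<psi> M1, OF L \<mu> \<mu>L \<psi>(1) M1 a0] by blast
  have W1: "N2 lborel W = 1"
    using LIMSEQ_unique[OF N2_tendsto[OF s W]] LIMSEQ_subseq_LIMSEQ[OF N1 r] by (simp add: o_def)
  have q: "(\<lambda>n. N2 lborel (cgrad (\<phi> (r n)))) \<longlonglongrightarrow> L * N2 lborel W"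
    using LIMSEQ_subseq_LIMSEQ[OF inf r] by (simp add: o_def W1)
  obtain G where G: "h10_pair A W G" "N2 lborel G = L * N2 lborel W"
    using minimizing_sequence_limit[of A L "\<lambda>n. \<psi> (r n)" W, OF L \<psi>(1) W \<psi>(3) q] by blast
  obtain r' where "AE x in lborel. (\<lambda>n. \<psi> (r (r' n)) x) \<longlonglongrightarrow> W x"
    using L2_AE_subseq[OF s W] by blast
  then have "AE x in lborel. W x \<ge> 0"
  proof eventually_elim
    case (elim x)
    show ?case by (rule LIMSEQ_le_const[OF elim]) (use \<psi>(2) in auto)
  qed
  then show ?thesis using G W1 by auto
qed

section \<open>The weak eigenvalue equation and the eigenspace\<close>

definition eigenpair :: "'b::euclidean_space set \<Rightarrow> real \<Rightarrow> ('b \<Rightarrow> real) \<Rightarrow> ('b \<Rightarrow> 'b) \<Rightarrow> bool" where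
  "eigenpair A L U G \<longleftrightarrow> h10_pair A U G \<and>
     (\<forall>V H. h10_pair A V H \<longrightarrow> (\<integral>x. G x \<bullet> H x \<partial>lborel) = L * (\<integral>x. U x * V x \<partial>lborel))"

lemma h10_pair_sqi: "h10_pair A U G \<Longrightarrow> sqi lborel U" "h10_pair A U G \<Longrightarrow> sqi lborel G"
  by (auto simp: h10_pair_def)

text \<open>Expanding the inequality at U + t V gives 0 <= 2tc + t^2 d for all t, which forces c =
  0. The two descriptions complement each other: the equation is linear, so sums of eigenfunctions
  are eigenfunctions, while equality of the energies can be verified for limits and absolute
  values.\<close>

lemma eigenpair_iff_minimizer:
  assumes L: "\<And>\<phi>. test_fun A \<phi> \<Longrightarrow> L * N2 lborel \<phi> \<le> N2 lborel (cgrad \<phi>)"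
  shows "eigenpair A L U G \<longleftrightarrow> h10_pair A U G \<and> N2 lborel G = L * N2 lborel U"
proof
  assume e: "eigenpair A L U G"
  then have "(\<integral>x. G x \<bullet> G x \<partial>lborel) = L * (\<integral>x. U x * U x \<partial>lborel)" unfolding eigenpair_def by blast
  then show "h10_pair A U G \<and> N2 lborel G = L * N2 lborel U"
    using e by (simp add: eigenpair_def N2_def power2_norm_eq_inner) (simp add: power2_eq_square)
next
  assume m: "h10_pair A U G \<and> N2 lborel G = L * N2 lborel U"
  have "(\<integral>x. G x \<bullet> H x \<partial>lborel) = L * (\<integral>x. U x * V x \<partial>lborel)" if h: "h10_pair A V H" for V H
  proof -
    note s = h10_pair_sqi[OF conjunct1[OF m]] h10_pair_sqi[OF h]
    define c where "c = (\<integral>x. G x \<bullet> H x \<partial>lborel) - L * (\<integral>x. U x * V x \<partial>lborel)"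
    define d where "d = N2 lborel H - L * N2 lborel V"
    have q: "0 \<le> 2 * t * c + t\<^sup>2 * d" for t
    proof -
      have "L * N2 lborel (\<lambda>x. U x + t * V x) \<le> N2 lborel (\<lambda>x. G x + t *\<^sub>R H x)"
        by (rule h10_pair_poincare[OF L h10_pair_add[OF conjunct1[OF m] h10_pair_cmult[OF h]]])
      moreover have "N2 lborel (\<lambda>x. U x + t * V x) = N2 lborel U + 2 * t * (\<integral>x. U x * V x \<partial>lborel) + t\<^sup>2 * N2 lborel V"
        using N2_add[OF s(1) sqi_scaleR[OF s(3), of t]] N2_scaleR[of lborel t V]
        by (simp add: mult.left_commute[of _ t])
      moreover have "N2 lborel (\<lambda>x. G x + t *\<^sub>R H x) = N2 lborel G + 2 * t * (\<integral>x. G x \<bullet> H x \<partial>lborel) + t\<^sup>2 * N2 lborel H"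
        using N2_add[OF s(2) sqi_scaleR[OF s(4), of t]] N2_scaleR[of lborel t H] by simp
      ultimately show ?thesis using m by (simp add: c_def d_def algebra_simps)
    qed
    have "c = 0"
    proof (rule ccontr)
      assume c: "c \<noteq> 0"
      \<comment> \<open>At t = -c/D the quadratic equals c^2/D times d/D - 2. Any positive D above d
        makes this negative, whether or not d is 0.\<close>
      obtain D where D: "D > 0" "d < D" by (rule that[of "\<bar>d\<bar> + 1"]) auto
      have "2 * (- c / D) * c + (- c / D)\<^sup>2 * d = c\<^sup>2 / D * (d / D - 2)"
        using D(1) by (simp add: power2_eq_square field_simps)
      moreover have "d / D < 2" using D by (simp add: divide_simps)
      then have "c\<^sup>2 / D * (d / D - 2) < 0"
        using c D by (intro mult_pos_neg divide_pos_pos) auto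
      ultimately show False using q[of "- c / D"] by linarith
    qed
    then show ?thesis by (simp add: c_def)
  qed
  then show "eigenpair A L U G" using m by (auto simp: eigenpair_def)
qed

lemma eigenpair_add:
  assumes "eigenpair A L U G" "eigenpair A L V H"
  shows "eigenpair A L (\<lambda>x. U x + V x) (\<lambda>x. G x + H x)"
proof -
  have h: "h10_pair A U G" "h10_pair A V H" using assms by (auto simp: eigenpair_def)
  note s = h10_pair_sqi[OF h(1)] h10_pair_sqi[OF h(2)]
  have "(\<integral>x. (G x + H x) \<bullet> K x \<partial>lborel) = L * (\<integral>x. (U x + V x) * W x \<partial>lborel)" if k: "h10_pair A W K" for W K
  proof -
    note sk = h10_pair_sqi[OF k]
    have "(\<integral>x. G x \<bullet> K x \<partial>lborel) = L * (\<integral>x. U x * W x \<partial>lborel)" "(\<integral>x. H x \<bullet> K x \<partial>lborel) = L * (\<integral>x. V x * W x \<partial>lborel)"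
      using assms k by (auto simp: eigenpair_def)
    then show ?thesis
      using sqi_integrable_inner[OF s(2) sk(2)] sqi_integrable_inner[OF s(4) sk(2)]
        sqi_integrable_mult[OF s(1) sk(1)] sqi_integrable_mult[OF s(3) sk(1)]
      by (simp add: inner_add_left distrib_right distrib_left)
  qed
  then show ?thesis using h10_pair_add[OF h] by (auto simp: eigenpair_def)
qed

lemma eigenpair_cmult:
  assumes "eigenpair A L U G" shows "eigenpair A L (\<lambda>x. c * U x) (\<lambda>x. c *\<^sub>R G x)"
proof -
  have h: "h10_pair A U G" using assms by (auto simp: eigenpair_def)
  have "(\<integral>x. (c *\<^sub>R G x) \<bullet> K x \<partial>lborel) = L * (\<integral>x. (c * U x) * W x \<partial>lborel)" if k: "h10_pair A W K" for W K
    using assms k by (auto simp: eigenpair_def mult.assoc)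
  then show ?thesis using h10_pair_cmult[OF h, of c] by (auto simp: eigenpair_def)
qed

text \<open>The regularized absolute values of the approximants converge to |W| in L^2. Their
  energies are bounded by those of the approximants, which tend to L times the squared norm of W,
  the least value that |W| allows. \<open>minimizing_sequence_limit\<close> then yields a gradient
  of |W| without a formula for it.\<close>

lemma eigenpair_abs:
  assumes L: "\<And>\<phi>. test_fun A \<phi> \<Longrightarrow> L * N2 lborel \<phi> \<le> N2 lborel (cgrad \<phi>)" "L \<ge> 0"
    and e: "eigenpair A L W G"
  shows "\<exists>G'. eigenpair A L (\<lambda>x. \<bar>W x\<bar>) G'"
proof -
  have h: "h10_pair A W G" and m: "N2 lborel G = L * N2 lborel W"
    using e by (auto simp: eigenpair_iff_minimizer[OF L(1)])
  obtain \<phi> where \<phi>: "sqi lborel W" "sqi lborel G" "\<forall>n. test_fun A (\<phi> n)"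
    "(\<lambda>n. N2 lborel (\<lambda>x. W x - \<phi> n x)) \<longlonglongrightarrow> 0" "(\<lambda>n. N2 lborel (\<lambda>x. G x - cgrad (\<phi> n) x)) \<longlonglongrightarrow> 0"
    using h unfolding h10_pair_def by blast
  note t = \<phi>(3)[rule_format]
  obtain \<psi> where \<psi>: "\<And>n. test_fun A (\<psi> n)" "\<And>n x. \<psi> n x \<ge> 0" "\<And>n. N2 lborel (cgrad (\<psi> n)) \<le> N2 lborel (cgrad (\<phi> n))"
     "\<And>n. N2 lborel (\<lambda>x. \<bar>\<phi> n x\<bar> - \<psi> n x) \<le> 1 / real (Suc n)"
    using regularized_abs_sequence[of A \<phi>, OF t] by blast
  note s = test_fun_sqi(1)[OF \<psi>(1)] and sf = test_fun_sqi(1)[OF t]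
  have inv: "(\<lambda>n. 1 / real (Suc n)) \<longlonglongrightarrow> 0"
    using LIMSEQ_inverse_real_of_nat by (simp add: inverse_eq_divide)
  have b: "N2 lborel (\<lambda>x. \<bar>W x\<bar> - \<psi> n x) \<le> 2 * N2 lborel (\<lambda>x. W x - \<phi> n x) + 2 * (1 / real (Suc n))" for n
  proof -
    have "N2 lborel (\<lambda>x. \<bar>W x\<bar> - \<psi> n x) = N2 lborel (\<lambda>x. (\<bar>W x\<bar> - \<bar>\<phi> n x\<bar>) + (\<bar>\<phi> n x\<bar> - \<psi> n x))" by simp
    also have "\<dots> \<le> 2 * N2 lborel (\<lambda>x. \<bar>W x\<bar> - \<bar>\<phi> n x\<bar>) + 2 * N2 lborel (\<lambda>x. \<bar>\<phi> n x\<bar> - \<psi> n x)"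
      by (intro N2_add_le sqi_diff sqi_abs \<phi>(1) sf s)
    also have "N2 lborel (\<lambda>x. \<bar>W x\<bar> - \<bar>\<phi> n x\<bar>) \<le> N2 lborel (\<lambda>x. W x - \<phi> n x)"
      unfolding N2_def
    proof (rule integral_mono)
      show "(norm (\<bar>W x\<bar> - \<bar>\<phi> n x\<bar>))\<^sup>2 \<le> (norm (W x - \<phi> n x))\<^sup>2" for x
        by (intro power_mono) auto
    qed (intro sqi_integrable sqi_diff sqi_abs \<phi>(1) sf)+
    finally show ?thesis using \<psi>(4)[of n] by simp
  qed
  have W0: "(\<lambda>n. N2 lborel (\<lambda>x. \<bar>W x\<bar> - \<psi> n x)) \<longlonglongrightarrow> 0"
  proof (rule tendsto_sandwich[OF _ _ tendsto_const])
    show "(\<lambda>n. 2 * N2 lborel (\<lambda>x. W x - \<phi> n x) + 2 * (1 / real (Suc n))) \<longlonglongrightarrow> 0"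
      using tendsto_add[OF tendsto_mult[OF tendsto_const \<phi>(4), of 2] tendsto_mult[OF tendsto_const inv, of 2]] by simp
    show "\<forall>\<^sub>F n in sequentially. N2 lborel (\<lambda>x. \<bar>W x\<bar> - \<psi> n x) \<le> 2 * N2 lborel (\<lambda>x. W x - \<phi> n x) + 2 * (1 / real (Suc n))"
      by (rule always_eventually) (intro allI b)
  qed (auto simp: N2_nonneg)
  have q: "(\<lambda>n. N2 lborel (cgrad (\<phi> n))) \<longlonglongrightarrow> L * N2 lborel (\<lambda>x. \<bar>W x\<bar>)"
    using N2_tendsto[OF test_fun_sqi(2)[OF t] \<phi>(2,5)] m by (simp add: N2_abs)
  have "\<exists>G'. h10_pair A (\<lambda>x. \<bar>W x\<bar>) G' \<and> N2 lborel G' = L * N2 lborel (\<lambda>x. \<bar>W x\<bar>)"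
    by (rule minimizing_sequence_limit[of A L \<psi>, OF L \<psi>(1) sqi_abs[OF \<phi>(1)] W0 \<psi>(3) q])
  then show ?thesis by (simp add: eigenpair_iff_minimizer[OF L(1)])
qed

lemma h10_pair_translation_estimate:
  fixes U :: "'b::euclidean_space \<Rightarrow> real"
  assumes h: "h10_pair A U G"
  shows "N2 lborel (\<lambda>x. U (x + h) - U x) \<le> (norm h)\<^sup>2 * N2 lborel G"
proof -
  obtain \<phi> where \<phi>: "sqi lborel U" "sqi lborel G" "\<forall>n. test_fun A (\<phi> n)"
    "(\<lambda>n. N2 lborel (\<lambda>x. U x - \<phi> n x)) \<longlonglongrightarrow> 0" "(\<lambda>n. N2 lborel (\<lambda>x. G x - cgrad (\<phi> n) x)) \<longlonglongrightarrow> 0"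
    using h unfolding h10_pair_def by blast
  note t = \<phi>(3)[rule_format]
  note s = test_fun_sqi(1)[OF t]
  have sh: "(\<lambda>n. N2 lborel (\<lambda>x. U (x + h) - \<phi> n (x + h))) \<longlonglongrightarrow> 0"
    using \<phi>(4) sqi_shift(2)[OF sqi_diff[OF \<phi>(1) s], where h = h] by simp
  have "(\<lambda>n. N2 lborel (\<lambda>x. (U (x + h) + - U x) - (\<phi> n (x + h) + - \<phi> n x))) \<longlonglongrightarrow> 0"
  proof (rule L2_limit_add)
    have "N2 lborel (\<lambda>x. - U x - - \<phi> n x) = N2 lborel (\<lambda>x. U x - \<phi> n x)" for n
      using N2_scaleR[of lborel "-1" "\<lambda>x. U x - \<phi> n x"] by simp
    then show "(\<lambda>n. N2 lborel (\<lambda>x. - U x - - \<phi> n x)) \<longlonglongrightarrow> 0" using \<phi>(4) by simp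
  qed (use sqi_shift(1)[OF s] sqi_shift(1)[OF \<phi>(1)] sh sqi_scaleR[OF s, of "-1"] sqi_scaleR[OF \<phi>(1), of "-1"] in auto)
  then have l1: "(\<lambda>n. N2 lborel (\<lambda>x. \<phi> n (x + h) - \<phi> n x)) \<longlonglongrightarrow> N2 lborel (\<lambda>x. U (x + h) - U x)"
    by (intro N2_tendsto sqi_diff sqi_shift s \<phi>(1)) simp
  have l2: "(\<lambda>n. (norm h)\<^sup>2 * N2 lborel (cgrad (\<phi> n))) \<longlonglongrightarrow> (norm h)\<^sup>2 * N2 lborel G"
    by (intro tendsto_mult tendsto_const N2_tendsto test_fun_sqi(2)[OF t] \<phi>)
  show ?thesis by (rule LIMSEQ_le[OF l1 l2]) (use translation_estimate[OF t] in auto)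
qed

section \<open>The strong maximum principle\<close>

definition bump :: "'b::euclidean_space \<Rightarrow> real" where
  "bump z = flat (1 - (norm z)\<^sup>2)"

text \<open>The factor k in grad P(z) = -k(z) z, where P is \<open>bump\<close>.\<close>

definition bump_kernel :: "'b::euclidean_space \<Rightarrow> real" where
  "bump_kernel z = 2 * flat' (1 - (norm z)\<^sup>2)"

text \<open>Minus the divergence of k(z) z, hence the Laplacian of \<open>bump\<close>. The same
  divergence governs the mass-preserving rescaling of k: this is why the derivative of
  \<open>kern s\<close> in s is, up to a power of s, a Laplacian of a compactly supported
  function.\<close>

definition bump_laplacian :: "'b::euclidean_space \<Rightarrow> real" where
  "bump_laplacian z = - (real DIM('b) * bump_kernel z + cgrad bump_kernel z \<bullet> z)"

definition kern :: "real \<Rightarrow> 'b::euclidean_space \<Rightarrow> real" where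
  "kern s h = inverse s ^ DIM('b) * bump_kernel (inverse s *\<^sub>R h)"

lemma bump_smooth: "smooth_fun bump"
  unfolding bump_def[abs_def] by (intro smooth_flat smooth_diff smooth_const smooth_norm2)

lemma bump_kernel_smooth: "smooth_fun bump_kernel"
  unfolding bump_kernel_def[abs_def] by (intro smooth_cmult smooth_flat' smooth_diff smooth_const smooth_norm2)

lemma bump_nonneg: "bump z \<ge> 0" and bump_kernel_nonneg: "bump_kernel z \<ge> 0"
  by (simp_all add: bump_def flat_nonneg bump_kernel_def flat'_def)

lemma bump_kernel_pos: "norm z < 1 \<Longrightarrow> bump_kernel z > 0"
  using power_strict_mono[of "norm z" 1 2] by (simp add: bump_kernel_def flat'_def)

lemma bump_zero: "norm z \<ge> 1 \<Longrightarrow> bump z = 0" and bump_kernel_zero: "norm z \<ge> 1 \<Longrightarrow> bump_kernel z = 0"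
proof -
  have "\<not> 1 - (norm z)\<^sup>2 > 0" if "norm z \<ge> 1" for z :: 'a
    using one_le_power[OF that, of 2] by linarith
  then show "norm z \<ge> 1 \<Longrightarrow> bump z = 0" "norm z \<ge> 1 \<Longrightarrow> bump_kernel z = 0" for z :: 'a
    unfolding bump_def flat_def bump_kernel_def flat'_def by auto
qed

lemma cgrad_bump: "cgrad bump z = - bump_kernel z *\<^sub>R z"
proof -
  have "cgrad (\<lambda>z. flat (1 - (norm z)\<^sup>2)) z = flat' (1 - (norm z)\<^sup>2) *\<^sub>R cgrad (\<lambda>z. 1 - (norm z)\<^sup>2) z"
    by (rule cgrad_comp[OF smooth_diff[OF smooth_const smooth_norm2] flat_deriv])
  then show ?thesis
    unfolding bump_def[abs_def] bump_kernel_def cgrad_diff[OF smooth_const smooth_norm2] cgrad_norm2 cgrad_const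
    by (simp add: mult.commute)
qed

lemma test_fun_bump_kernel: "test_fun UNIV bump_kernel"
  by (rule test_funI[OF bump_kernel_smooth, of "cball 0 1"]) (auto simp: bump_kernel_zero)

lemma bump_laplacian_continuous: "continuous_on UNIV bump_laplacian"
  unfolding bump_laplacian_def[abs_def]
  by (intro continuous_intros smooth_continuous[OF bump_kernel_smooth] cgrad_continuous[OF bump_kernel_smooth])

lemma bump_laplacian_zero: "norm z > 1 \<Longrightarrow> bump_laplacian z = (0::real)" for z :: "'b::euclidean_space"
proof -
  assume z: "norm z > 1"
  have "((\<lambda>x. 0) has_derivative (\<lambda>v. 0)) (at z)" by simp
  then have "(bump_kernel has_derivative (\<lambda>v. 0)) (at z)"
    by (rule has_derivative_transform_within_open[of _ _ _ _ "- cball 0 1"])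
       (use z in \<open>auto simp: bump_kernel_zero\<close>)
  then have "cgrad bump_kernel z = 0" by (intro cgrad_eqI) (simp add: inner_zero_left[abs_def])
  then show ?thesis using z by (simp add: bump_laplacian_def bump_kernel_zero)
qed

lemma bump_laplacian_bounded: "\<exists>B\<ge>0. \<forall>z::'b::euclidean_space. \<bar>bump_laplacian z\<bar> \<le> B"
proof -
  have "bounded ((bump_laplacian :: 'b \<Rightarrow> real) ` cball 0 1)"
    by (intro compact_imp_bounded compact_continuous_image continuous_on_subset[OF bump_laplacian_continuous]) auto
  then obtain B where B: "\<forall>y\<in>(bump_laplacian :: 'b \<Rightarrow> real) ` cball 0 1. norm y \<le> B" unfolding bounded_iff by blast
  have "\<bar>bump_laplacian z\<bar> \<le> max B 0" for z :: 'b
  proof (cases "norm z \<le> 1")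
    case True then show ?thesis using B by (auto simp: le_max_iff_disj)
  qed (simp add: bump_laplacian_zero)
  then show ?thesis by (intro exI[of _ "max B 0"]) auto
qed

lemma kern_deriv:
  fixes h :: "'b::euclidean_space"
  assumes s: "s > 0"
  shows "((\<lambda>s. kern s h) has_real_derivative inverse s ^ Suc DIM('b) * bump_laplacian (inverse s *\<^sub>R h)) (at s)"
proof -
  let ?i = "inverse s" and ?N = "DIM('b)"
  have i: "(inverse has_real_derivative - (?i * ?i)) (at s)"
    using DERIV_inverse[of s UNIV] s by (simp add: power2_eq_square)
  have "((\<lambda>s. inverse s *\<^sub>R h) has_derivative (\<lambda>t. (t * - (?i * ?i)) *\<^sub>R h)) (at s)"
    using has_derivative_scaleR_left[OF i[unfolded has_field_derivative_def], of h] by (simp add: mult.commute)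
  from has_derivative_compose[OF this smooth_has_derivative[OF bump_kernel_smooth]]
  have "((\<lambda>s. bump_kernel (inverse s *\<^sub>R h)) has_derivative (\<lambda>t. (- (?i * ?i)) * (cgrad bump_kernel (?i *\<^sub>R h) \<bullet> h) * t)) (at s)"
    by (simp add: mult_ac)
  then have k: "((\<lambda>s. bump_kernel (inverse s *\<^sub>R h)) has_real_derivative (- (?i * ?i)) * (cgrad bump_kernel (?i *\<^sub>R h) \<bullet> h)) (at s)"
    by (simp only: has_field_derivative_def)
  have p: "((\<lambda>s. inverse s ^ ?N) has_real_derivative real ?N * (- (?i * ?i) * ?i ^ (?N - Suc 0))) (at s)"
    by (rule DERIV_power[OF i])
  have N: "?i * ?i ^ (?N - Suc 0) = ?i ^ ?N" by (simp add: power_eq_if)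
  have "real ?N * (- (?i * ?i) * ?i ^ (?N - Suc 0)) * bump_kernel (?i *\<^sub>R h)
      + (- (?i * ?i)) * (cgrad bump_kernel (?i *\<^sub>R h) \<bullet> h) * ?i ^ ?N
      = ?i ^ Suc ?N * bump_laplacian (?i *\<^sub>R h)"
    unfolding power_Suc N[symmetric] bump_laplacian_def by (simp add: algebra_simps)
  then show ?thesis using DERIV_mult[OF p k] by (simp add: kern_def[abs_def])
qed

lemma kern_continuous: "continuous_on UNIV (kern s)"
  unfolding kern_def[abs_def]
  by (intro continuous_intros continuous_on_compose2[OF smooth_continuous[OF bump_kernel_smooth]]) auto

lemma kern_nonneg: "s > 0 \<Longrightarrow> kern s h \<ge> 0"
  by (simp add: kern_def bump_kernel_nonneg)

lemma kern_zero: "s > 0 \<Longrightarrow> norm h \<ge> s \<Longrightarrow> kern s h = 0"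
  by (simp add: kern_def bump_kernel_zero divide_simps)

lemma kern_pos: "s > 0 \<Longrightarrow> norm h < s \<Longrightarrow> kern s h > 0"
  by (simp add: kern_def bump_kernel_pos divide_simps)

lemma kern_sqi:
  assumes "s > 0"
  shows "sqi lborel (kern s)" "integrable lborel (kern s)"
  by (rule continuous_compact_support_sqi[OF kern_continuous compact_cball, of 0 s]
      continuous_compact_support_integrable[OF kern_continuous compact_cball, of 0 s]; simp add: kern_zero assms)+

text \<open>The total mass does not depend on the radius, so all means approximate the same multiple
  of W.\<close>

lemma kern_integral:
  assumes s: "s > 0"
  shows "(\<integral>h. kern s h \<partial>(lborel::'b::euclidean_space measure)) = (\<integral>h. bump_kernel h \<partial>(lborel::'b measure))"
proof -
  have [measurable]: "(bump_kernel :: 'b \<Rightarrow> real) \<in> borel_measurable borel"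
    using test_fun_sqi(3)[OF test_fun_bump_kernel] by auto
  have [measurable]: "(kern s :: 'b \<Rightarrow> real) \<in> borel_measurable borel"
    by (intro borel_measurable_continuous_onI kern_continuous)
  have "(\<integral>h. kern s h \<partial>(lborel::'b measure)) =
      (\<integral>h. kern s h \<partial>density (distr lborel borel (\<lambda>x::'b. 0 + s *\<^sub>R x)) (\<lambda>_. \<bar>s\<bar> ^ DIM('b)))"
    using lborel_affine[of s "0::'b"] s by simp
  also have "\<dots> = (\<integral>h. s ^ DIM('b) * kern s (s *\<^sub>R h) \<partial>(lborel::'b measure))"
    using s by (subst integral_density) (auto simp: integral_distr)
  also have "\<dots> = (\<integral>h. bump_kernel h \<partial>(lborel::'b measure))"
    using s by (intro Bochner_Integration.integral_cong refl) (simp add: kern_def power_inverse)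
  finally show ?thesis .
qed

lemma smear_alt:
  fixes u \<rho> :: "'b::euclidean_space \<Rightarrow> real"
  assumes "u \<in> borel_measurable borel" "\<rho> \<in> borel_measurable borel"
  shows "smear \<rho> u x = (\<integral>z. \<rho> (z - x) * u z \<partial>lborel)"
proof -
  have "(\<lambda>z. \<rho> (z - x) * u z) \<in> borel_measurable borel" using assms by measurable
  from lborel_integral_shift(1)[OF this, of x] show ?thesis by (simp add: smear_def add.commute)
qed

text \<open>One derivative is moved back onto W through its weak gradient, and the equation turns
  the result into -L times the integral of W \<phi>. Only the sign of the latter is used.\<close>

lemma eigenpair_superharmonic:
  fixes W :: "'b::euclidean_space \<Rightarrow> real"
  assumes e: "eigenpair A L W G" and L: "L \<ge> 0" and pos: "AE x in lborel. W x \<ge> 0"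
    and \<phi>: "test_fun A \<phi>" "\<And>x. \<phi> x \<ge> 0"
  shows "(\<integral>x. W x * (\<Sum>b\<in>Basis. cgrad (\<lambda>y. cgrad \<phi> y \<bullet> b) x \<bullet> b) \<partial>lborel) \<le> 0"
proof -
  have h: "h10_pair A W G" using e by (simp add: eigenpair_def)
  note s = h10_pair_sqi[OF h]
  note td = test_fun_deriv[OF \<phi>(1)]
  have i1: "integrable lborel (\<lambda>x. W x * (cgrad (\<lambda>y. cgrad \<phi> y \<bullet> b) x \<bullet> b))" for b
    by (rule sqi_integrable_mult[OF s(1) test_fun_sqi(1)[OF test_fun_deriv[OF td]]])
  have Gb: "sqi lborel (\<lambda>x. G x \<bullet> b)" for b
    by (rule sqi_bound[OF s(2), of _ "norm b"]) (use s(2) Cauchy_Schwarz_ineq2[of "G _" b] in \<open>auto simp: sqi_def mult.commute\<close>)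
  have i2: "integrable lborel (\<lambda>x. (G x \<bullet> b) * (cgrad \<phi> x \<bullet> b))" for b
    by (rule sqi_integrable_mult[OF Gb test_fun_sqi(1)[OF td]])
  have "(\<integral>x. W x * (\<Sum>b\<in>Basis. cgrad (\<lambda>y. cgrad \<phi> y \<bullet> b) x \<bullet> b) \<partial>lborel)
      = (\<Sum>b\<in>Basis. \<integral>x. W x * (cgrad (\<lambda>y. cgrad \<phi> y \<bullet> b) x \<bullet> b) \<partial>lborel)"
    unfolding sum_distrib_left by (rule Bochner_Integration.integral_sum) (rule i1)
  also have "\<dots> = (\<Sum>b\<in>Basis. - (\<integral>x. (G x \<bullet> b) * (cgrad \<phi> x \<bullet> b) \<partial>lborel))"
    by (intro sum.cong refl h10_pair_weak[OF h td])
  also have "\<dots> = - (\<integral>x. G x \<bullet> cgrad \<phi> x \<partial>lborel)"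
    unfolding sum_negf euclidean_inner[of "G _" "cgrad \<phi> _"]
    by (subst Bochner_Integration.integral_sum) (auto intro: i2)
  also have "\<dots> = - (L * (\<integral>x. W x * \<phi> x \<partial>lborel))"
    using e h10_pair_test[OF \<phi>(1)] by (simp add: eigenpair_def)
  also have "\<dots> \<le> 0"
  proof -
    have "(\<integral>x. W x * \<phi> x \<partial>lborel) \<ge> 0"
      by (rule integral_nonneg_AE) (use pos in eventually_elim, simp add: \<phi>(2))
    then show ?thesis using L by simp
  qed
  finally show ?thesis .
qed

lemma scaled_bump_laplacian:
  fixes x z :: "'b::euclidean_space"
  defines "p \<equiv> \<lambda>i y. bump (i *\<^sub>R (y - x))"
  shows "smooth_fun (p i)"
    and "(\<Sum>b\<in>Basis. cgrad (\<lambda>y. cgrad (p i) y \<bullet> b) z \<bullet> b) = i\<^sup>2 * bump_laplacian (i *\<^sub>R (z - x))"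
proof -
  have aff: "i *\<^sub>R (y - x) = i *\<^sub>R y + (- i *\<^sub>R x)" for y by (simp add: algebra_simps)
  have lin: "linear (\<lambda>y::'b. i *\<^sub>R y)" by (simp add: linear_iff algebra_simps)
  have dl: "((\<lambda>y. i *\<^sub>R (y - x)) has_derivative (\<lambda>v. i *\<^sub>R v)) (at y)" for y
    by (auto intro!: derivative_eq_intros simp: algebra_simps)
  show "smooth_fun (p i)" unfolding p_def aff by (rule smooth_comp_affine[OF lin bump_smooth])
  define k where "k y = bump_kernel (i *\<^sub>R (y - x))" for y
  have ks: "smooth_fun k" unfolding k_def[abs_def] aff by (rule smooth_comp_affine[OF lin bump_kernel_smooth])
  have gk: "cgrad k y = i *\<^sub>R cgrad bump_kernel (i *\<^sub>R (y - x))" for y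
    unfolding k_def[abs_def]
    by (rule cgrad_eqI) (use has_derivative_compose[OF dl smooth_has_derivative[OF bump_kernel_smooth]] in simp)
  have gp: "cgrad (p i) y = (- i\<^sup>2 * k y) *\<^sub>R (y - x)" for y
  proof (rule cgrad_eqI)
    have e: "cgrad bump (i *\<^sub>R (y - x)) \<bullet> (i *\<^sub>R v) = ((- i\<^sup>2 * k y) *\<^sub>R (y - x)) \<bullet> v" for v
      by (simp add: cgrad_bump k_def power2_eq_square)
    have "(p i has_derivative (\<lambda>v. cgrad bump (i *\<^sub>R (y - x)) \<bullet> (i *\<^sub>R v))) (at y)"
      unfolding p_def by (rule has_derivative_compose[OF dl smooth_has_derivative[OF bump_smooth]])
    then show "(p i has_derivative (\<lambda>v. ((- i\<^sup>2 * k y) *\<^sub>R (y - x)) \<bullet> v)) (at y)" by (simp only: e)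
  qed
  have c: "cgrad (\<lambda>y. cgrad (p i) y \<bullet> b) z \<bullet> b = - i\<^sup>2 * ((cgrad k z \<bullet> b) * ((z - x) \<bullet> b) + k z)" if b: "b \<in> Basis" for b
  proof -
    have "cgrad (\<lambda>y. cgrad (p i) y \<bullet> b) z = (- i\<^sup>2) *\<^sub>R (((z - x) \<bullet> b) *\<^sub>R cgrad k z + k z *\<^sub>R b)"
    proof (rule cgrad_eqI)
      have "((\<lambda>y. (- i\<^sup>2) * (k y * ((y - x) \<bullet> b))) has_derivative
         (\<lambda>v. (- i\<^sup>2) * (k z * (v \<bullet> b) + (cgrad k z \<bullet> v) * ((z - x) \<bullet> b)))) (at z)"
        by (auto intro!: derivative_eq_intros smooth_has_derivative[OF ks])
      moreover have "(\<lambda>y. cgrad (p i) y \<bullet> b) = (\<lambda>y. (- i\<^sup>2) * (k y * ((y - x) \<bullet> b)))"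
        by (simp add: gp mult.assoc)
      moreover have "(\<lambda>v. (- i\<^sup>2) * (k z * (v \<bullet> b) + (cgrad k z \<bullet> v) * ((z - x) \<bullet> b)))
          = (\<lambda>v. ((- i\<^sup>2) *\<^sub>R (((z - x) \<bullet> b) *\<^sub>R cgrad k z + k z *\<^sub>R b)) \<bullet> v)"
        by (simp add: fun_eq_iff inner_add_left inner_commute[of b] algebra_simps)
      ultimately show "((\<lambda>y. cgrad (p i) y \<bullet> b) has_derivative
          (\<lambda>v. ((- i\<^sup>2) *\<^sub>R (((z - x) \<bullet> b) *\<^sub>R cgrad k z + k z *\<^sub>R b)) \<bullet> v)) (at z)" by simp
    qed
    then show ?thesis using b by (simp only: inner_scaleR_left inner_add_left inner_same_Basis) (simp add: algebra_simps)
  qed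
  have "(\<Sum>b\<in>Basis. cgrad (\<lambda>y. cgrad (p i) y \<bullet> b) z \<bullet> b)
      = (\<Sum>b\<in>Basis. - i\<^sup>2 * ((cgrad k z \<bullet> b) * ((z - x) \<bullet> b) + k z))"
    by (rule sum.cong[OF refl c])
  also have "\<dots> = - i\<^sup>2 * (cgrad k z \<bullet> (z - x) + real DIM('b) * k z)"
    unfolding sum_distrib_left[symmetric] sum.distrib euclidean_inner[of "cgrad k z" "z - x"] by simp
  also have "\<dots> = i\<^sup>2 * bump_laplacian (i *\<^sub>R (z - x))"
    unfolding gk bump_laplacian_def k_def by (simp add: algebra_simps)
  finally show "(\<Sum>b\<in>Basis. cgrad (\<lambda>y. cgrad (p i) y \<bullet> b) z \<bullet> b) = i\<^sup>2 * bump_laplacian (i *\<^sub>R (z - x))" .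
qed

text \<open>Since $\frac{d}{ds}\,\kappa_s = s^{1-N}\,\Delta\bigl(P(\cdot/s)\bigr)$ for the kernel \<open>kern s\<close> and
  the test function \<open>bump\<close>, weak superharmonicity makes the weighted means decreasing in the radius.\<close>

lemma weighted_mean_antimono:
  fixes W :: "'b::euclidean_space \<Rightarrow> real"
  assumes e: "eigenpair A L W G" and L: "L \<ge> 0" and pos: "AE x in lborel. W x \<ge> 0"
    and r: "0 < \<delta>" "\<delta> \<le> r" "cball x r \<subseteq> A"
  shows "smear (kern r) W x \<le> smear (kern \<delta>) W x"
proof -
  let ?N = "DIM('b)"
  have sW: "sqi lborel W" using e h10_pair_sqi by (auto simp: eigenpair_def)
  define w where "w h = W (x + h)" for h
  have sw: "sqi lborel w" using sqi_shift(1)[OF sW, of x] by (simp add: w_def[abs_def] add.commute)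
  have [measurable]: "w \<in> borel_measurable borel" using sw by (simp add: sqi_def)
  have [measurable]: "W \<in> borel_measurable borel" using sW by (simp add: sqi_def)
  have [measurable]: "(bump_laplacian :: 'b \<Rightarrow> real) \<in> borel_measurable borel"
    by (rule borel_measurable_continuous_onI[OF bump_laplacian_continuous])
  define F where "F s h = inverse s ^ Suc ?N * bump_laplacian (inverse s *\<^sub>R h)" for s :: real and h :: 'b
  \<comment> \<open>Integrated in s first, f gives the difference of the two means; integrated in h
    first, it gives a positive factor times the pairing of W with the Laplacian of a test function.
    Fubini compares the two.\<close>
  define f where "f h s = w h * (F s h * indicator {\<delta>..r} s)" for h s
  obtain B where B: "B \<ge> 0" "\<And>z::'b. \<bar>bump_laplacian z\<bar> \<le> B" using bump_laplacian_bounded by metis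
  have FTC: "(\<integral>s. F s h * indicator {\<delta>..r} s \<partial>lborel) = kern r h - kern \<delta> h" for h
  proof (rule integral_FTC_Icc_real[OF r(2)])
    fix s assume s: "\<delta> \<le> s" "s \<le> r"
    then have s0: "s > 0" using r(1) by simp
    show "((\<lambda>s. kern s h) has_real_derivative F s h) (at s)" unfolding F_def by (rule kern_deriv[OF s0])
    have "isCont bump_laplacian (inverse s *\<^sub>R h)"
      using bump_laplacian_continuous continuous_on_eq_continuous_at[OF open_UNIV] by blast
    moreover have "isCont (\<lambda>s. inverse s *\<^sub>R h) s" using s0 by (intro continuous_intros) auto
    ultimately have "isCont (\<lambda>s. bump_laplacian (inverse s *\<^sub>R h)) s" by (rule isCont_o2[rotated])
    moreover have "isCont (\<lambda>s. inverse s ^ Suc ?N) s" using s0 by (intro continuous_intros) auto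
    ultimately show "isCont (\<lambda>s. F s h) s" unfolding F_def by (intro continuous_mult)
  qed
  \<comment> \<open>For s at least \<delta> > 0 the inverse powers of s are bounded, so a multiple
    of |w| on the ball of radius r times the indicator of the interval dominates f.\<close>
  have intf: "integrable (lborel \<Otimes>\<^sub>M lborel) (case_prod f)"
  proof (rule Bochner_Integration.integrable_bound)
    define a where "a h = inverse \<delta> ^ Suc ?N * B * (indicator (cball 0 r) h *\<^sub>R w h)" for h
    have ia: "integrable lborel a"
      unfolding a_def[abs_def] by (intro integrable_mult_right sqi_locally_integrable[OF sw]) auto
    have ib: "integrable lborel (indicator {\<delta>..r} :: real \<Rightarrow> real)"
      by (intro integrable_real_indicator) (use r(2) in auto)
    show "integrable (lborel \<Otimes>\<^sub>M lborel) (\<lambda>(h, s). a h * indicator {\<delta>..r} s)"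
    proof (rule lborel_pair.Fubini_integrable)
      have [measurable]: "a \<in> borel_measurable borel" using ia by auto
      show "(\<lambda>(h, s). a h * indicator {\<delta>..r} s) \<in> borel_measurable (lborel \<Otimes>\<^sub>M lborel)" by measurable
      show "integrable lborel (\<lambda>h. \<integral>s. norm (case (h, s) of (h, s) \<Rightarrow> a h * indicator {\<delta>..r} s) \<partial>lborel)"
        using integrable_norm[OF ia] by (simp add: abs_mult)
    qed (use ib in \<open>auto intro!: AE_I2 integrable_mult_right\<close>)
    show "case_prod f \<in> borel_measurable (lborel \<Otimes>\<^sub>M lborel)"
      unfolding f_def[abs_def] F_def by measurable
    have "\<bar>f h s\<bar> \<le> \<bar>a h * indicator {\<delta>..r} s\<bar>" for h s
    proof (cases "s \<in> {\<delta>..r}")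
      case True
      then have s0: "s > 0" "\<delta> \<le> s" "s \<le> r" using r(1) by auto
      show ?thesis
      proof (cases "norm h \<le> r")
        case hr: True
        have "inverse s ^ Suc ?N \<le> inverse \<delta> ^ Suc ?N"
          using s0 r(1) by (intro power_mono le_imp_inverse_le) auto
        then have "inverse s ^ Suc ?N * \<bar>bump_laplacian (inverse s *\<^sub>R h)\<bar> \<le> inverse \<delta> ^ Suc ?N * B"
          using B r(1) by (intro mult_mono) auto
        then have "\<bar>F s h\<bar> \<le> inverse \<delta> ^ Suc ?N * B" using s0 by (simp add: F_def abs_mult)
        from mult_left_mono[OF this, of "\<bar>w h\<bar>"] show ?thesis
          using True hr B(1) r(1) by (simp add: f_def a_def abs_mult mult_ac)
      next
        case False
        then have "1 < norm (inverse s *\<^sub>R h)" using s0 by (simp add: divide_simps)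
        then show ?thesis by (simp add: f_def F_def bump_laplacian_zero)
      qed
    qed (simp add: f_def)
    then show "AE p in lborel \<Otimes>\<^sub>M lborel. norm (case_prod f p) \<le> norm (case p of (h, s) \<Rightarrow> a h * indicator {\<delta>..r} s)"
      by (intro AE_I2) auto
  qed
  have inner: "(\<integral>h. f h s \<partial>lborel) \<le> 0" for s
  proof (cases "s \<in> {\<delta>..r}")
    case True
    then have s0: "s > 0" "s \<le> r" using r(1) by auto
    let ?i = "inverse s"
    let ?p = "\<lambda>y. bump (?i *\<^sub>R (y - x))"
    have tp: "test_fun A ?p"
    proof (rule test_funI[OF scaled_bump_laplacian(1)])
      show "compact (cball x s)" "cball x s \<subseteq> A" using r(3) s0(2) by auto
      show "?p y = 0" if "y \<notin> cball x s" for y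
        using that s0 by (intro bump_zero) (simp add: dist_norm norm_minus_commute divide_simps)
    qed
    have "0 \<ge> (\<integral>z. W z * (?i\<^sup>2 * bump_laplacian (?i *\<^sub>R (z - x))) \<partial>lborel)"
      using eigenpair_superharmonic[OF e L pos tp bump_nonneg] unfolding scaled_bump_laplacian(2) .
    also have "(\<integral>z. W z * (?i\<^sup>2 * bump_laplacian (?i *\<^sub>R (z - x))) \<partial>lborel)
        = (\<integral>h. W (h + x) * (?i\<^sup>2 * bump_laplacian (?i *\<^sub>R (h + x - x))) \<partial>lborel)"
      by (rule lborel_integral_shift(1)[symmetric]) measurable
    also have "\<dots> = ?i\<^sup>2 * (\<integral>h. w h * bump_laplacian (?i *\<^sub>R h) \<partial>lborel)"
    proof -
      have "(\<lambda>h. W (h + x) * (?i\<^sup>2 * bump_laplacian (?i *\<^sub>R (h + x - x))))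
          = (\<lambda>h. ?i\<^sup>2 * (w h * bump_laplacian (?i *\<^sub>R h)))"
        by (simp add: fun_eq_iff w_def add.commute)
      then show ?thesis by (simp only: integral_mult_right_zero)
    qed
    finally have "(\<integral>h. w h * bump_laplacian (?i *\<^sub>R h) \<partial>lborel) \<le> 0"
      using s0 by (simp add: mult_le_0_iff)
    moreover have "(\<integral>h. f h s \<partial>lborel) = ?i ^ Suc ?N * (\<integral>h. w h * bump_laplacian (?i *\<^sub>R h) \<partial>lborel)"
    proof -
      have "(\<lambda>h. f h s) = (\<lambda>h. ?i ^ Suc ?N * (w h * bump_laplacian (?i *\<^sub>R h)))"
        using True by (simp add: fun_eq_iff f_def F_def)
      then show ?thesis by (simp only: integral_mult_right_zero)
    qed
    ultimately show ?thesis using s0 by (simp add: mult_nonneg_nonpos)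
  qed (simp add: f_def)
  have k: "integrable lborel (\<lambda>h. kern s h * w h)" if "s > 0" for s
    by (rule sqi_integrable_mult[OF kern_sqi(1)[OF that] sw])
  have "smear (kern r) W x - smear (kern \<delta>) W x = (\<integral>h. w h * (kern r h - kern \<delta> h) \<partial>lborel)"
    using k[of r] k[of \<delta>] r(1,2) by (simp add: smear_def w_def right_diff_distrib mult.commute)
  also have "\<dots> = (\<integral>h. (\<integral>s. f h s \<partial>lborel) \<partial>lborel)"
    by (simp add: f_def FTC)
  also have "\<dots> = (\<integral>s. (\<integral>h. f h s \<partial>lborel) \<partial>lborel)"
    by (rule lborel_pair.Fubini_integral[OF intf, symmetric])
  also have "\<dots> \<le> 0"
    using integral_nonneg_AE[of "\<lambda>s. - (\<integral>h. f h s \<partial>lborel)" lborel] inner by (auto simp: AE_I2)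
  finally show ?thesis by simp
qed

section \<open>Zero sets of nonnegative eigenfunctions\<close>

lemma zero_set_borel:
  fixes W :: "'b::euclidean_space \<Rightarrow> real"
  assumes "W \<in> borel_measurable borel" shows "{z \<in> ball y r. W z = 0} \<in> sets borel"
proof -
  have "W -` {0} \<inter> space borel \<in> sets borel" using assms by (rule measurable_sets) simp
  then have "ball y r \<inter> (W -` {0} \<inter> space borel) \<in> sets borel" by (intro sets.Int) auto
  moreover have "{z \<in> ball y r. W z = 0} = ball y r \<inter> (W -` {0} \<inter> space borel)" by auto
  ultimately show ?thesis by simp
qed

text \<open>At a point x with W x = 0 the mean of radius 2r is at most the mean of radius \<delta>,
  which there equals its own deviation from c W. That deviation is O(\<delta>) in L^2, so the mean
  of radius 2r vanishes almost everywhere on the zero set. At one such x the kernel is positive on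
  \<open>ball x (2 * r)\<close>, which contains \<open>ball y r\<close>. The radius 3r in the
  hypothesis keeps \<open>cball x (2 * r)\<close> inside A.\<close>

lemma zero_set_propagates:
  fixes W :: "'b::euclidean_space \<Rightarrow> real"
  assumes e: "eigenpair A L W G" and L: "L \<ge> 0" and pos: "AE x in lborel. W x \<ge> 0"
    and r: "r > 0" "cball y (3 * r) \<subseteq> A"
    and Z: "emeasure lborel {z \<in> ball y r. W z = 0} > 0"
  shows "AE z in lborel. z \<in> ball y r \<longrightarrow> W z = 0"
proof -
  have h: "h10_pair A W G" using e by (simp add: eigenpair_def)
  note sW = h10_pair_sqi(1)[OF h]
  have [measurable]: "W \<in> borel_measurable borel" using sW by (simp add: sqi_def)
  define S where "S = {z \<in> ball y r. W z = 0}"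
  have SB [measurable]: "S \<in> sets borel" unfolding S_def by (rule zero_set_borel) measurable
  define c where "c = (\<integral>h. bump_kernel h \<partial>(lborel::'b measure))"
  define K where "K = smear (kern (2 * r)) W"
  have [measurable]: "(kern s :: 'b \<Rightarrow> real) \<in> borel_measurable borel" for s
    by (intro borel_measurable_continuous_onI kern_continuous)
  have est: "sqi lborel (smear (kern s) W)" "N2 lborel (\<lambda>x. smear (kern s) W x - c * W x) \<le> c\<^sup>2 * s\<^sup>2 * N2 lborel G"
    if s: "s > 0" for s
  proof -
    note * = smear_estimate[OF kern_sqi[OF s] kern_nonneg[OF s] _ _ sW h10_pair_translation_estimate[OF h], of s c]
    show "sqi lborel (smear (kern s) W)" by (rule *(1)) (simp_all add: kern_zero s c_def kern_integral)
    show "N2 lborel (\<lambda>x. smear (kern s) W x - c * W x) \<le> c\<^sup>2 * s\<^sup>2 * N2 lborel G"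
      by (rule *(2)) (simp_all add: kern_zero s c_def kern_integral)
  qed
  have sK: "sqi lborel K" unfolding K_def using est(1)[of "2 * r"] r(1) by simp
  have Knn: "K x \<ge> 0" for x unfolding K_def
  proof (subst smear_alt)
    show "0 \<le> (\<integral>z. kern (2 * r) (z - x) * W z \<partial>lborel)"
      by (rule integral_nonneg_AE) (use pos in eventually_elim, use r(1) in \<open>simp add: kern_nonneg\<close>)
  qed measurable
  have b: "N2 lborel (\<lambda>x. indicator S x * K x) \<le> c\<^sup>2 * \<delta>\<^sup>2 * N2 lborel G" if \<delta>: "0 < \<delta>" "\<delta> \<le> 2 * r" for \<delta>
  proof -
    let ?D = "\<lambda>x. smear (kern \<delta>) W x - c * W x"
    have sD: "sqi lborel ?D" using sqi_diff[OF est(1)[OF \<delta>(1)] sqi_scaleR[OF sW, of c]] by simp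
    have "N2 lborel (\<lambda>x. indicator S x * K x) \<le> N2 lborel (\<lambda>x. indicator S x * ?D x)"
      unfolding N2_def
    proof (rule integral_mono)
      show "integrable lborel (\<lambda>x. (norm (indicator S x * K x))\<^sup>2)" "integrable lborel (\<lambda>x. (norm (indicator S x * ?D x))\<^sup>2)"
        by (intro sqi_integrable sqi_indicator(1) sK sD SB)+
      fix x :: 'b
      show "(norm (indicator S x * K x))\<^sup>2 \<le> (norm (indicator S x * ?D x))\<^sup>2"
      proof (cases "x \<in> S")
        case True
        then have x: "dist y x < r" "W x = 0" by (auto simp: S_def)
        have "cball x (2 * r) \<subseteq> cball y (3 * r)"
        proof
          fix z assume "z \<in> cball x (2 * r)"
          then show "z \<in> cball y (3 * r)" using x(1) dist_triangle[of y z x] by auto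
        qed
        then have "K x \<le> ?D x"
          using weighted_mean_antimono[OF e L pos \<delta>] r(2) x(2) by (auto simp: K_def)
        then have "\<bar>K x\<bar> \<le> \<bar>?D x\<bar>" using Knn[of x] by simp
        then show ?thesis using True by (simp add: abs_le_square_iff[symmetric])
      qed simp
    qed
    also have "\<dots> \<le> N2 lborel ?D" by (rule sqi_indicator(2)[OF sD SB])
    also have "\<dots> \<le> c\<^sup>2 * \<delta>\<^sup>2 * N2 lborel G" by (rule est(2)[OF \<delta>(1)])
    finally show ?thesis .
  qed
  have "N2 lborel (\<lambda>x. indicator S x * K x) \<le> 0"
  proof (rule tendsto_lowerbound)
    show "((\<lambda>\<delta>. c\<^sup>2 * \<delta>\<^sup>2 * N2 lborel G) \<longlongrightarrow> 0) (at_right 0)"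
      by (auto intro!: tendsto_eq_intros)
    show "\<forall>\<^sub>F \<delta> in at_right 0. N2 lborel (\<lambda>x. indicator S x * K x) \<le> c\<^sup>2 * \<delta>\<^sup>2 * N2 lborel G"
      unfolding eventually_at_right_field using b r(1) by (intro exI[of _ "2 * r"]) auto
  qed simp
  then have "N2 lborel (\<lambda>x. indicator S x * K x) = 0" using N2_nonneg[of lborel "\<lambda>x. indicator S x * K x"] by simp
  then have ae: "AE x in lborel. indicator S x * K x = 0"
    using N2_zero_iff[OF sqi_indicator(1)[OF sK SB]] by simp
  \<comment> \<open>This is where the positive measure enters: it leaves a genuine point of S
    outside the exceptional null set, and one point suffices.\<close>
  have "\<exists>x\<in>S. K x = 0"
  proof (rule ccontr)
    assume "\<not> (\<exists>x\<in>S. K x = 0)"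
    then have "AE x in lborel. x \<notin> S" using ae by (auto elim!: eventually_mono)
    then have "emeasure lborel S = 0"
      using AE_iff_measurable[of S lborel "\<lambda>x. x \<notin> S"] by simp
    then show False using Z by (simp add: S_def)
  qed
  then obtain x where x: "x \<in> S" "K x = 0" by blast
  have "(\<integral>z. kern (2 * r) (z - x) * W z \<partial>lborel) = 0"
    using x(2) by (simp add: K_def smear_alt)
  moreover have "integrable lborel (\<lambda>z. kern (2 * r) (z - x) * W z)"
    using sqi_integrable_mult[OF sqi_shift(1)[OF kern_sqi(1), of "2 * r" "- x"] sW] r(1) by simp
  moreover have "AE z in lborel. 0 \<le> kern (2 * r) (z - x) * W z"
    using pos by eventually_elim (use r(1) in \<open>simp add: kern_nonneg\<close>)
  ultimately have "AE z in lborel. kern (2 * r) (z - x) * W z = 0"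
    using integral_nonneg_eq_0_iff_AE by blast
  then show ?thesis
  proof eventually_elim
    case (elim z)
    show ?case
    proof
      assume "z \<in> ball y r"
      moreover have "dist y x < r" using x(1) by (simp add: S_def)
      ultimately have "norm (z - x) < 2 * r"
        using dist_triangle[of z x y] by (simp add: dist_norm norm_minus_commute)
      then have "kern (2 * r) (z - x) > 0" using r(1) by (intro kern_pos) auto
      then show "W z = 0" using elim by simp
    qed
  qed
qed

text \<open>The points near which W vanishes almost everywhere form an open set. So do the remaining
  points of A: if some u close to x belonged to the set, the zero set would have positive measure in
  a ball around x, and vanishing would spread over that ball. Connectedness leaves two cases, and in
  the second the zero set is null near every point.\<close>

theorem strong_maximum_principle:
  fixes W :: "'b::euclidean_space \<Rightarrow> real"
  assumes A: "open A" "connected A" and e: "eigenpair A L W G" and L: "L \<ge> 0"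
    and pos: "AE x in lborel. W x \<ge> 0"
  shows "(AE x in lborel. x \<in> A \<longrightarrow> W x = 0) \<or> (AE x in lborel. x \<in> A \<longrightarrow> W x > 0)"
proof -
  have sW: "sqi lborel W" using e h10_pair_sqi by (auto simp: eigenpair_def)
  have [measurable]: "W \<in> borel_measurable borel" using sW by (simp add: sqi_def)
  define Q where "Q = {x \<in> A. \<exists>\<epsilon>>0. AE z in lborel. z \<in> ball x \<epsilon> \<longrightarrow> W z = 0}"
  \<comment> \<open>By the Lindelof property countably many of the balls cover A, so the exceptional
    sets unite to a null set.\<close>
  have cov: "AE z in lborel. z \<in> A \<longrightarrow> P z" if "\<And>x. x \<in> A \<Longrightarrow> \<exists>\<epsilon>>0. AE z in lborel. z \<in> ball x \<epsilon> \<longrightarrow> P z" for P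
  proof -
    obtain \<epsilon> where \<epsilon>: "\<And>x. x \<in> A \<Longrightarrow> \<epsilon> x > 0 \<and> (AE z in lborel. z \<in> ball x (\<epsilon> x) \<longrightarrow> P z)"
      using \<open>\<And>x. x \<in> A \<Longrightarrow> _\<close> by metis
    obtain \<F> where \<F>: "\<F> \<subseteq> (\<lambda>x. ball x (\<epsilon> x)) ` A" "countable \<F>" "\<Union>\<F> = \<Union>((\<lambda>x. ball x (\<epsilon> x)) ` A)"
      by (rule Lindelof[of "(\<lambda>x. ball x (\<epsilon> x)) ` A"]) auto
    have "AE z in lborel. \<forall>X\<in>\<F>. z \<in> X \<longrightarrow> P z"
      using \<F>(1) \<epsilon> by (subst AE_ball_countable[OF \<F>(2)]) blast
    then show ?thesis
    proof eventually_elim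
      case (elim z)
      show ?case
      proof
        assume z: "z \<in> A"
        then have "z \<in> ball z (\<epsilon> z)" using \<epsilon> by simp
        then have "z \<in> \<Union>\<F>" unfolding \<F>(3) using z by blast
        then show "P z" using elim by blast
      qed
    qed
  qed
  have rad: "\<exists>r>0. cball x (3 * r) \<subseteq> A" if x: "x \<in> A" for x
  proof -
    obtain e where "e > 0" "cball x e \<subseteq> A" using A(1) x open_contains_cball by blast
    then show ?thesis by (intro exI[of _ "e / 3"]) auto
  qed
  have inQ: "x \<in> Q" if "x \<in> A" "r > 0" "cball x (3 * r) \<subseteq> A" "emeasure lborel {z \<in> ball x r. W z = 0} > 0" for x r
    using zero_set_propagates[OF e L pos that(2-4)] that(1,2) by (auto simp: Q_def)
  have Qo: "openin (top_of_set A) Q"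
    unfolding openin_contains_ball
  proof (intro conjI ballI)
    show "Q \<subseteq> A" by (auto simp: Q_def)
    fix x assume "x \<in> Q"
    then obtain \<epsilon> where \<epsilon>: "\<epsilon> > 0" "AE z in lborel. z \<in> ball x \<epsilon> \<longrightarrow> W z = 0" by (auto simp: Q_def)
    have "ball x \<epsilon> \<inter> A \<subseteq> Q"
    proof
      fix u assume u: "u \<in> ball x \<epsilon> \<inter> A"
      then obtain d where d: "d > 0" "ball u d \<subseteq> ball x \<epsilon>" using openE[of "ball x \<epsilon>" u] by blast
      have "AE z in lborel. z \<in> ball u d \<longrightarrow> W z = 0" using \<epsilon>(2) by eventually_elim (use d(2) in auto)
      then show "u \<in> Q" using u d(1) by (auto simp: Q_def)
    qed
    then show "\<exists>e>0. ball x e \<inter> A \<subseteq> Q" using \<epsilon>(1) by blast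
  qed
  have Qc: "openin (top_of_set A) (A - Q)"
    unfolding openin_contains_ball
  proof (intro conjI ballI)
    fix x assume x: "x \<in> A - Q"
    obtain r where r: "r > 0" "cball x (3 * r) \<subseteq> A" using rad x by blast
    have "u \<notin> Q" if u: "u \<in> ball x r" for u
    proof
      assume "u \<in> Q"
      then obtain \<epsilon> where \<epsilon>: "\<epsilon> > 0" "AE z in lborel. z \<in> ball u \<epsilon> \<longrightarrow> W z = 0" by (auto simp: Q_def)
      obtain d where d: "d > 0" "ball u d \<subseteq> ball x r" using openE[of "ball x r" u] u by blast
      let ?m = "min d \<epsilon>"
      have "0 < emeasure lborel (ball u ?m)"
        using content_ball_pos[of ?m u] d(1) \<epsilon>(1) by (auto simp: measure_def intro: gr_zeroI)
      also have "\<dots> \<le> emeasure lborel {z \<in> ball x r. W z = 0}"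
      proof (rule emeasure_mono_AE)
        show "AE z in lborel. z \<in> ball u ?m \<longrightarrow> z \<in> {z \<in> ball x r. W z = 0}"
          using \<epsilon>(2) by eventually_elim (use d(2) in auto)
        show "{z \<in> ball x r. W z = 0} \<in> sets lborel" using zero_set_borel[of W] by simp
      qed
      finally show False using inQ[OF _ r] x by blast
    qed
    then show "\<exists>e>0. ball x e \<inter> A \<subseteq> A - Q" using r(1) by blast
  qed auto
  have "Q \<subseteq> A" by (auto simp: Q_def)
  then have "closedin (top_of_set A) Q" using Qc by (simp add: closedin_def)
  then have "Q = {} \<or> Q = A"
    using A(2) Qo unfolding connected_clopen by blast
  then show ?thesis
  proof
    assume Q: "Q = A"
    have "AE z in lborel. z \<in> A \<longrightarrow> W z = 0" by (rule cov) (use Q in \<open>auto simp: Q_def\<close>)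
    then show ?thesis by blast
  next
    assume Q: "Q = {}"
    have "AE z in lborel. z \<in> A \<longrightarrow> W z \<noteq> 0"
    proof (rule cov)
      fix x assume x: "x \<in> A"
      obtain r where r: "r > 0" "cball x (3 * r) \<subseteq> A" using rad x by blast
      have m: "{z \<in> ball x r. W z = 0} \<in> sets lborel" using zero_set_borel[of W] by simp
      have "emeasure lborel {z \<in> ball x r. W z = 0} = 0"
        using inQ[OF x r] Q by (auto simp: zero_less_iff_neq_zero)
      then have "AE z in lborel. z \<notin> {z \<in> ball x r. W z = 0}"
        using m by (intro AE_not_in) (auto simp: null_sets_def)
      then show "\<exists>\<epsilon>>0. AE z in lborel. z \<in> ball x \<epsilon> \<longrightarrow> W z \<noteq> 0"
        using r(1) by (intro exI[of _ r]) (auto elim!: eventually_mono)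
    qed
    then have "AE z in lborel. z \<in> A \<longrightarrow> W z > 0" using pos by eventually_elim auto
    then show ?thesis by blast
  qed
qed

section \<open>The first eigenfunction\<close>

lemma h10_pair_S2:
  assumes A: "open A" and h: "h10_pair A U G" and one: "N2 lborel U = 1"
  shows "S2 A U" "dirichlet A U = N2 lborel G"
proof -
  have "W12_0 A U" using W12_0_iff_h10_pair[OF A] h by auto
  then show "S2 A U" "dirichlet A U = N2 lborel G"
    using h10_pair_integrals[OF A h] one by (auto simp: S2_def)
qed

lemma S2_h10_pair:
  assumes A: "open A" and u: "S2 A u"
  shows "\<exists>U G. h10_pair A U G \<and> (AE x in lborel. x \<in> A \<longrightarrow> u x = U x) \<and> N2 lborel U = 1 \<and> dirichlet A u = N2 lborel G"
proof -
  have "W12_0 A u" and one: "(\<integral>x. (u x)\<^sup>2 \<partial>lebesgue_on A) = 1" using u by (auto simp: S2_def)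
  then obtain U G where h: "h10_pair A U G" and ae: "AE x in lborel. x \<in> A \<longrightarrow> u x = U x"
    using W12_0_iff_h10_pair[OF A] by blast
  show ?thesis using h ae h10_pair_integrals[OF A h ae] one by (intro exI[of _ U] exI[of _ G]) auto
qed

text \<open>A nonzero \<phi> becomes a competitor after normalization. The constant is a real number
  at most \<open>lambda1 A\<close>, because the latter may be infinite; this serves \<Omega> with
  its own eigenvalue as well as the cross-sections with \<mu>.\<close>

lemma lambda1_test_fun:
  assumes A: "open A" and \<mu>: "ereal \<mu> \<le> lambda1 A" and t: "test_fun A \<phi>"
  shows "\<mu> * N2 lborel \<phi> \<le> N2 lborel (cgrad \<phi>)"
proof (cases "N2 lborel \<phi> = 0")
  case False
  then have N: "N2 lborel \<phi> > 0" using N2_nonneg[of lborel \<phi>] by simp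
  define c where "c = 1 / sqrt (N2 lborel \<phi>)"
  have c2: "c\<^sup>2 = 1 / N2 lborel \<phi>" using N by (simp add: c_def power_divide)
  have h: "h10_pair A (\<lambda>x. c * \<phi> x) (\<lambda>x. c *\<^sub>R cgrad \<phi> x)" by (rule h10_pair_cmult[OF h10_pair_test[OF t]])
  have "N2 lborel (\<lambda>x. c * \<phi> x) = 1" using N2_scaleR[of lborel c \<phi>] c2 N by simp
  note S = h10_pair_S2[OF A h this]
  have "lambda1 A \<le> ereal (dirichlet A (\<lambda>x. c * \<phi> x))"
    unfolding lambda1_def by (rule Inf_lower) (use S(1) in blast)
  then have "\<mu> \<le> N2 lborel (\<lambda>x. c *\<^sub>R cgrad \<phi> x)"
    using order_trans[OF \<mu>] S(2) by (metis ereal_less_eq(3))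
  also have "\<dots> = N2 lborel (cgrad \<phi>) / N2 lborel \<phi>" by (simp add: N2_scaleR c2)
  finally show ?thesis using N by (simp add: pos_le_divide_eq)
qed (simp add: N2_nonneg)

lemma lambda1_nonneg: "lambda1 A \<ge> 0"
  unfolding lambda1_def by (rule Inf_greatest) (auto simp: dirichlet_def)

text \<open>A near-optimal competitor costs 1/(n+1) in energy and its approximation by test
  functions another 1/(n+1), whence the numerator 2. The norms are only close to 1; the inequality
  of \<open>lambda1_test_fun\<close> still bounds the energies from below by a sequence tending to
  L.\<close>

lemma lambda1_minimizing_sequence:
  fixes A :: "'b::euclidean_space set"
  assumes A: "open A" and L: "lambda1 A = ereal L"
  shows "\<exists>\<phi>. (\<forall>n::nat. test_fun A (\<phi> n)) \<and> (\<lambda>n. N2 lborel (\<phi> n)) \<longlonglongrightarrow> 1 \<and> (\<lambda>n. N2 lborel (cgrad (\<phi> n))) \<longlonglongrightarrow> L"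
proof -
  have "\<exists>\<psi>. test_fun A \<psi> \<and> \<bar>N2 lborel \<psi> - 1\<bar> < 1 / real (Suc n) \<and> N2 lborel (cgrad \<psi>) < L + 2 / real (Suc n)" for n
  proof -
    let ?e = "1 / real (Suc n)"
    have e: "?e > 0" by simp
    have "lambda1 A < ereal (L + ?e)" using L e by (simp del: of_nat_Suc)
    then obtain u where u: "S2 A u" "dirichlet A u < L + ?e"
      unfolding lambda1_def Inf_less_iff by auto
    obtain U G where h: "h10_pair A U G" and U: "N2 lborel U = 1" "dirichlet A u = N2 lborel G"
      using S2_h10_pair[OF A u(1)] by blast
    obtain \<phi> where \<phi>: "sqi lborel U" "sqi lborel G" "\<forall>n. test_fun A (\<phi> n)"
      "(\<lambda>n. N2 lborel (\<lambda>x. U x - \<phi> n x)) \<longlonglongrightarrow> 0" "(\<lambda>n. N2 lborel (\<lambda>x. G x - cgrad (\<phi> n) x)) \<longlonglongrightarrow> 0"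
      using h unfolding h10_pair_def by blast
    note t = \<phi>(3)[rule_format]
    have l: "(\<lambda>n. N2 lborel (\<phi> n)) \<longlonglongrightarrow> 1" "(\<lambda>n. N2 lborel (cgrad (\<phi> n))) \<longlonglongrightarrow> N2 lborel G"
      using N2_tendsto[OF test_fun_sqi(1)[OF t] \<phi>(1,4)] N2_tendsto[OF test_fun_sqi(2)[OF t] \<phi>(2,5)] U by auto
    have "\<forall>\<^sub>F m in sequentially. dist (N2 lborel (\<phi> m)) 1 < ?e" by (rule tendstoD[OF l(1) e])
    moreover have "N2 lborel G < L + 2 / real (Suc n)" using u(2) U(2) by (simp add: field_simps)
    then have "\<forall>\<^sub>F m in sequentially. N2 lborel (cgrad (\<phi> m)) < L + 2 / real (Suc n)" by (rule order_tendstoD(2)[OF l(2)])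
    ultimately have "\<forall>\<^sub>F m in sequentially. dist (N2 lborel (\<phi> m)) 1 < ?e \<and> N2 lborel (cgrad (\<phi> m)) < L + 2 / real (Suc n)"
      by (rule eventually_conj)
    then obtain m where "dist (N2 lborel (\<phi> m)) 1 < ?e" "N2 lborel (cgrad (\<phi> m)) < L + 2 / real (Suc n)"
      using eventually_happens'[OF sequentially_bot] by blast
    then show ?thesis using t[of m] by (intro exI[of _ "\<phi> m"]) (simp add: dist_real_def)
  qed
  then obtain \<psi> where \<psi>: "\<And>n. test_fun A (\<psi> n)" "\<And>n. \<bar>N2 lborel (\<psi> n) - 1\<bar> < 1 / real (Suc n)"
    "\<And>n. N2 lborel (cgrad (\<psi> n)) < L + 2 / real (Suc n)"
    using choice[of "\<lambda>n \<psi>. test_fun A \<psi> \<and> \<bar>N2 lborel \<psi> - 1\<bar> < 1 / real (Suc n) \<and> N2 lborel (cgrad \<psi>) < L + 2 / real (Suc n)"] by blast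
  have inv: "(\<lambda>n. 1 / real (Suc n)) \<longlonglongrightarrow> 0"
    using LIMSEQ_inverse_real_of_nat by (simp add: inverse_eq_divide)
  have "(\<lambda>n. N2 lborel (\<psi> n) - 1) \<longlonglongrightarrow> 0"
  proof (rule Lim_null_comparison[OF always_eventually inv], rule allI)
    show "norm (N2 lborel (\<psi> n) - 1) \<le> 1 / real (Suc n)" for n using \<psi>(2)[of n] by (simp only: real_norm_def less_imp_le)
  qed
  then have one: "(\<lambda>n. N2 lborel (\<psi> n)) \<longlonglongrightarrow> 1" by (simp add: LIM_zero_iff)
  have lo: "(\<lambda>n. L * N2 lborel (\<psi> n)) \<longlonglongrightarrow> L" using tendsto_mult[OF tendsto_const one, of L] by simp
  have hi: "(\<lambda>n. L + 2 / real (Suc n)) \<longlonglongrightarrow> L"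
    using tendsto_add[OF tendsto_const tendsto_mult[OF tendsto_const inv, of 2], of L] by simp
  have "(\<lambda>n. N2 lborel (cgrad (\<psi> n))) \<longlonglongrightarrow> L"
  proof (rule tendsto_sandwich[OF always_eventually always_eventually lo hi]; rule allI)
    show "L * N2 lborel (\<psi> n) \<le> N2 lborel (cgrad (\<psi> n))" for n
      by (rule lambda1_test_fun[OF A _ \<psi>(1)]) (simp add: L)
    show "N2 lborel (cgrad (\<psi> n)) \<le> L + 2 / real (Suc n)" for n by (rule less_imp_le[OF \<psi>(3)])
  qed
  then show ?thesis using \<psi>(1) one by blast
qed

section \<open>Simplicity of the first eigenvalue\<close>

lemma eigenpair_simple:
  fixes U :: "'b::euclidean_space \<Rightarrow> real"
  assumes A: "open A" "connected A"
    and L: "\<And>\<phi>. test_fun A \<phi> \<Longrightarrow> L * N2 lborel \<phi> \<le> N2 lborel (cgrad \<phi>)" "L \<ge> 0"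
    and U: "eigenpair A L U G" "AE x in lborel. U x \<ge> 0" "N2 lborel U = 1" and V: "eigenpair A L V H"
  shows "\<exists>c. AE x in lborel. x \<in> A \<longrightarrow> V x = c * U x"
proof -
  have hU: "h10_pair A U G" "h10_pair A V H" using U(1) V by (auto simp: eigenpair_def)
  note sU = h10_pair_sqi(1)[OF hU(1)] and sV = h10_pair_sqi(1)[OF hU(2)]
  have Upos: "AE x in lborel. x \<in> A \<longrightarrow> U x > 0"
  proof -
    have "\<not> (AE x in lborel. x \<in> A \<longrightarrow> U x = 0)"
    proof
      assume "AE x in lborel. x \<in> A \<longrightarrow> U x = 0"
      then have "AE x in lborel. U x = 0" using h10_pair_off(1)[OF hU(1)] by eventually_elim blast
      then show False using N2_zero_iff[OF sU] U(3) by simp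
    qed
    then show ?thesis using strong_maximum_principle[OF A U(1) L(2) U(2)] by blast
  qed
  define c where "c = (\<integral>x. V x * U x \<partial>lborel)"
  define w where "w x = V x + (- c) * U x" for x
  obtain K where w: "eigenpair A L w K"
    using eigenpair_add[OF V eigenpair_cmult[OF U(1), of "- c"]] by (auto simp: w_def[abs_def])
  have sw: "sqi lborel w" using w h10_pair_sqi by (auto simp: eigenpair_def)
  have iw: "integrable lborel (\<lambda>x. w x * U x)" by (rule sqi_integrable_mult[OF sw sU])
  have orth: "(\<integral>x. w x * U x \<partial>lborel) = 0"
  proof -
    have "(\<integral>x. w x * U x \<partial>lborel) = (\<integral>x. V x * U x - c * (U x * U x) \<partial>lborel)"
      by (rule Bochner_Integration.integral_cong) (auto simp: w_def algebra_simps)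
    also have "\<dots> = c - c * (\<integral>x. U x * U x \<partial>lborel)"
      using sqi_integrable_mult[OF sV sU] sqi_integrable_mult[OF sU sU] by (simp add: c_def)
    also have "(\<integral>x. U x * U x \<partial>lborel) = 1" using U(3) by (simp add: N2_def power2_eq_square)
    finally show ?thesis by simp
  qed
  obtain K' where "eigenpair A L (\<lambda>x. \<bar>w x\<bar>) K'" using eigenpair_abs[OF L w] by blast
  \<comment> \<open>The sum |w| + w is twice the positive part of w and a nonnegative eigenfunction.
    By the maximum principle it vanishes or is positive almost everywhere in A, so w is either
    nonpositive or positive there: one application settles the sign.\<close>
  note p = eigenpair_add[OF this w]
  have "AE x in lborel. \<bar>w x\<bar> + w x \<ge> 0" by (intro AE_I2) linarith
  note alt = strong_maximum_principle[OF A p L(2) this]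
  have sgn: "(AE x in lborel. w x * U x \<ge> 0) \<or> (AE x in lborel. w x * U x \<le> 0)"
    using alt
  proof (elim disjE)
    assume "AE x in lborel. x \<in> A \<longrightarrow> \<bar>w x\<bar> + w x = 0"
    then have "AE x in lborel. w x * U x \<le> 0" using U(2) h10_pair_off(1)[OF hU(1)]
    proof eventually_elim
      case (elim x)
      then show ?case by (cases "x \<in> A") (auto intro!: mult_nonpos_nonneg)
    qed
    then show ?thesis ..
  next
    assume "AE x in lborel. x \<in> A \<longrightarrow> \<bar>w x\<bar> + w x > 0"
    then have "AE x in lborel. w x * U x \<ge> 0" using U(2) h10_pair_off(1)[OF hU(1)]
    proof eventually_elim
      case (elim x)
      then show ?case by (cases "x \<in> A") (auto intro!: mult_nonneg_nonneg)
    qed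
    then show ?thesis ..
  qed
  have "AE x in lborel. w x * U x = 0"
    using sgn
  proof
    assume "AE x in lborel. w x * U x \<ge> 0"
    then show ?thesis using integral_nonneg_eq_0_iff_AE[OF iw] orth by blast
  next
    assume "AE x in lborel. w x * U x \<le> 0"
    then have n: "AE x in lborel. 0 \<le> - (w x * U x)" by eventually_elim simp
    have "(\<integral>x. - (w x * U x) \<partial>lborel) = 0" using orth by simp
    then have "AE x in lborel. - (w x * U x) = 0"
      using integral_nonneg_eq_0_iff_AE[OF integrable_minus[OF iw] n] by blast
    then show ?thesis by eventually_elim simp
  qed
  then have "AE x in lborel. x \<in> A \<longrightarrow> V x = c * U x" using Upos
    by eventually_elim (auto simp: w_def)
  then show ?thesis by blast
qed

lemma h10_pair_wgrad_inner:
  assumes A: "open A" and h: "h10_pair A U G" "h10_pair A V H"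
    and u: "AE x in lborel. x \<in> A \<longrightarrow> u x = U x" and v: "AE x in lborel. x \<in> A \<longrightarrow> v x = V x"
  shows "(\<integral>x. wgrad A u x \<bullet> wgrad A v x \<partial>lebesgue_on A) = (\<integral>x. G x \<bullet> H x \<partial>lborel)"
    and "(\<integral>x. u x * v x \<partial>lebesgue_on A) = (\<integral>x. U x * V x \<partial>lborel)"
proof -
  have AB: "A \<in> sets borel" using A by simp
  have m [measurable]: "U \<in> borel_measurable borel" "G \<in> borel_measurable borel" "V \<in> borel_measurable borel" "H \<in> borel_measurable borel"
    using h10_pair_sqi[OF h(1)] h10_pair_sqi[OF h(2)] by (auto simp: sqi_def)
  note off = h10_pair_off[OF h(1)]
  have 1: "AE x in lborel. x \<in> A \<longrightarrow> wgrad A u x \<bullet> wgrad A v x = G x \<bullet> H x"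
    using h10_pair_wgrad[OF A h(1) u] h10_pair_wgrad[OF A h(2) v] by eventually_elim auto
  have 2: "AE x in lborel. x \<in> A \<longrightarrow> u x * v x = U x * V x"
    using u v by eventually_elim auto
  show "(\<integral>x. wgrad A u x \<bullet> wgrad A v x \<partial>lebesgue_on A) = (\<integral>x. G x \<bullet> H x \<partial>lborel)"
  proof (rule lebesgue_on_transfer(1)[OF AB AE_imp_borel_measurable_lebesgue_on[OF AB _ 1] _ 1])
    show "AE x in lborel. x \<notin> A \<longrightarrow> G x \<bullet> H x = 0" using off(2) by eventually_elim simp
  qed measurable
  show "(\<integral>x. u x * v x \<partial>lebesgue_on A) = (\<integral>x. U x * V x \<partial>lborel)"
  proof (rule lebesgue_on_transfer(1)[OF AB AE_imp_borel_measurable_lebesgue_on[OF AB _ 2] _ 2])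
    show "AE x in lborel. x \<notin> A \<longrightarrow> U x * V x = 0" using off(1) by eventually_elim simp
  qed measurable
qed

theorem mainTheorem4:
  fixes \<Omega> \<Omega>0 :: "('a::euclidean_space \<times> real) set"
    and k :: nat
    and E :: "nat \<Rightarrow> 'a set"
    and R :: "nat \<Rightarrow> ('a \<times> real \<Rightarrow> 'a \<times> real)"
    and t :: "nat \<Rightarrow> 'a \<times> real"
  assumes k: "k \<ge> 1"
    and A1: "open \<Omega>0" "bounded \<Omega>0"
    and A2: "\<forall>i\<in>{1..k}. open (E i) \<and> bounded (E i) \<and> connected (E i)
                \<and> orthogonal_transformation (R i)"
    and A3: "\<exists>\<rho>0>0. \<forall>i\<in>{1..k}. \<forall>j\<in>{1..k}. i \<noteq> j \<longrightarrow>
                (cyl (E i) (R i) (t i) \<inter> cyl (E j) (R j) (t j)) - ball 0 \<rho>0 = {}"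
    and \<Omega>: "\<Omega> = \<Omega>0 \<union> (\<Union>i\<in>{1..k}. cyl (E i) (R i) (t i))"
    and gap: "lambda1 \<Omega> < Min ((\<lambda>i. lambda1 (E i)) ` {1..k})"
  shows "\<exists>u1. S2 \<Omega> u1 \<and> (AE x in lebesgue_on \<Omega>. u1 x \<ge> 0)
           \<and> ereal (dirichlet \<Omega> u1) = lambda1 \<Omega>
           \<and> (\<forall>\<phi>. W12_0 \<Omega> \<phi> \<longrightarrow>
                 (\<integral>x. wgrad \<Omega> u1 x \<bullet> wgrad \<Omega> \<phi> x \<partial>lebesgue_on \<Omega>)
                   = real_of_ereal (lambda1 \<Omega>) * (\<integral>x. u1 x * \<phi> x \<partial>lebesgue_on \<Omega>))
           \<and> (connected \<Omega> \<longrightarrow>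
                (\<forall>v. S2 \<Omega> v \<and> ereal (dirichlet \<Omega> v) = lambda1 \<Omega> \<longrightarrow>
                   (\<exists>c::real. AE x in lebesgue_on \<Omega>. v x = c * u1 x)))"
proof -
  let ?C = "\<lambda>i. cyl (E i) (R i) (t i)"
  have Co: "open (?C i)" if "i \<in> {1..k}" for i using A2 that by (intro cyl_open) auto
  have \<Omega>o: "open \<Omega>" unfolding \<Omega> using A1(1) Co by (intro open_Un open_UN) auto
  have \<Omega>B: "\<Omega> \<in> sets borel" using \<Omega>o by simp
  \<comment> \<open>A real number strictly between stands in for the minimum, which may be infinite,
    and keeps a positive gap to the eigenvalue of \<Omega>.\<close>
  obtain \<mu> where \<mu>: "lambda1 \<Omega> < ereal \<mu>" "ereal \<mu> < Min ((\<lambda>i. lambda1 (E i)) ` {1..k})"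
    using ereal_dense2[OF gap] by blast
  obtain L where L: "lambda1 \<Omega> = ereal L" "L \<ge> 0"
    using lambda1_nonneg[of \<Omega>] \<mu>(1) by (cases "lambda1 \<Omega>") auto
  have L\<mu>: "L < \<mu>" using \<mu>(1) L by simp
  have \<mu>E: "ereal \<mu> \<le> lambda1 (E i)" if "i \<in> {1..k}" for i
  proof -
    have "Min ((\<lambda>i. lambda1 (E i)) ` {1..k}) \<le> lambda1 (E i)" by (rule Min_le) (use that in auto)
    then show ?thesis using \<mu>(2) by simp
  qed
  have poin: "L * N2 lborel \<phi> \<le> N2 lborel (cgrad \<phi>)" if "test_fun \<Omega> \<phi>" for \<phi>
    by (rule lambda1_test_fun[OF \<Omega>o _ that]) (simp add: L)
  obtain \<rho>0 where \<rho>0: "\<And>i j. i \<in> {1..k} \<Longrightarrow> j \<in> {1..k} \<Longrightarrow> i \<noteq> j \<Longrightarrow> (?C i \<inter> ?C j) - ball 0 \<rho>0 = {}"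
    using A3 by blast
  obtain \<rho>1 where \<rho>1: "\<Omega>0 \<subseteq> ball 0 \<rho>1" using bounded_subset_ballD[OF A1(2)] by blast
  \<comment> \<open>One ball contains the bounded part of \<Omega> and all overlaps of
    half-cylinders; outside it \<Omega> is a disjoint union of ends.\<close>
  define \<rho> where "\<rho> = max \<rho>0 \<rho>1"
  have bb: "ball 0 \<rho>0 \<subseteq> ball (0::'a \<times> real) \<rho>" "ball 0 \<rho>1 \<subseteq> ball (0::'a \<times> real) \<rho>"
    by (auto simp: \<rho>_def)
  have ends: "\<mu> * N2 lborel \<psi> \<le> N2 lborel (cgrad \<psi>)"
    if "test_fun \<Omega> \<psi>" "\<And>x. x \<in> ball 0 \<rho> \<Longrightarrow> \<psi> x = 0" for \<psi>
  proof (rule ends_bound[of "{1..k}" ?C \<rho> \<Omega> \<mu>, OF _ Co _ _ _ that])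
    show "(?C i \<inter> ?C j) - ball 0 \<rho> = {}" if "i \<in> {1..k}" "j \<in> {1..k}" "i \<noteq> j" for i j
      using \<rho>0[OF that] bb(1) by blast
    show "\<Omega> \<subseteq> ball 0 \<rho> \<union> (\<Union>i\<in>{1..k}. ?C i)" using \<Omega> \<rho>1 bb(2) by blast
    show "\<mu> * N2 lborel \<phi> \<le> N2 lborel (cgrad \<phi>)" if "i \<in> {1..k}" "test_fun (?C i) \<phi>" for i \<phi>
    proof (rule cylinder_bound[OF _ _ _ that(2)])
      show "\<mu> \<ge> 0" using L\<mu> L(2) by simp
      show "orthogonal_transformation (R i)" using A2 that(1) by blast
      show "\<mu> * N2 lborel \<phi> \<le> N2 lborel (cgrad \<phi>)" if "test_fun (E i) \<phi>" for \<phi>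
        using A2 \<open>i \<in> {1..k}\<close> by (intro lambda1_test_fun[OF _ \<mu>E that]) auto
    qed
  qed auto
  obtain \<phi> where \<phi>: "\<And>n::nat. test_fun \<Omega> (\<phi> n)" "(\<lambda>n. N2 lborel (\<phi> n)) \<longlonglongrightarrow> 1" "(\<lambda>n. N2 lborel (cgrad (\<phi> n))) \<longlonglongrightarrow> L"
    using lambda1_minimizing_sequence[OF \<Omega>o L(1)] by blast
  obtain U G where h: "h10_pair \<Omega> U G" and one: "N2 lborel U = 1" and GL: "N2 lborel G = L"
    and pos: "AE x in lborel. U x \<ge> 0"
    using exists_nonneg_minimizer[of \<Omega> L \<rho> \<mu> \<phi>, OF poin L(2) ends L\<mu> \<phi>] by blast
  have eig: "eigenpair \<Omega> L U G" using eigenpair_iff_minimizer[OF poin] h one GL by simp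
  note S = h10_pair_S2[OF \<Omega>o h one]
  have EL: "(\<integral>x. wgrad \<Omega> U x \<bullet> wgrad \<Omega> \<phi> x \<partial>lebesgue_on \<Omega>) = real_of_ereal (lambda1 \<Omega>) * (\<integral>x. U x * \<phi> x \<partial>lebesgue_on \<Omega>)"
    if "W12_0 \<Omega> \<phi>" for \<phi>
  proof -
    obtain V H where V: "h10_pair \<Omega> V H" "AE x in lborel. x \<in> \<Omega> \<longrightarrow> \<phi> x = V x"
      using W12_0_iff_h10_pair[OF \<Omega>o] \<open>W12_0 \<Omega> \<phi>\<close> by blast
    have "(\<integral>x. G x \<bullet> H x \<partial>lborel) = L * (\<integral>x. U x * V x \<partial>lborel)" using eig V(1) unfolding eigenpair_def by blast
    then show ?thesis using h10_pair_wgrad_inner[OF \<Omega>o h V(1) _ V(2), of U] L(1) by simp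
  qed
  have simple: "\<exists>c::real. AE x in lebesgue_on \<Omega>. v x = c * U x"
    if conn: "connected \<Omega>" and v: "S2 \<Omega> v" "ereal (dirichlet \<Omega> v) = lambda1 \<Omega>" for v
  proof -
    obtain V H where V: "h10_pair \<Omega> V H" "AE x in lborel. x \<in> \<Omega> \<longrightarrow> v x = V x" "N2 lborel V = 1" "dirichlet \<Omega> v = N2 lborel H"
      using S2_h10_pair[OF \<Omega>o v(1)] by blast
    have "eigenpair \<Omega> L V H" using eigenpair_iff_minimizer[OF poin] V v(2) L(1) by simp
    from eigenpair_simple[OF \<Omega>o conn poin L(2) eig pos one this]
    obtain c where "AE x in lborel. x \<in> \<Omega> \<longrightarrow> V x = c * U x" by blast
    then have "AE x in lborel. x \<in> \<Omega> \<longrightarrow> v x = c * U x" using V(2) by eventually_elim auto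
    then show ?thesis by (auto simp: AE_lebesgue_on_iff[OF \<Omega>B])
  qed
  have "AE x in lebesgue_on \<Omega>. U x \<ge> 0"
    unfolding AE_lebesgue_on_iff[OF \<Omega>B] using pos by eventually_elim simp
  then show ?thesis
    using S EL simple GL L(1) by (intro exI[of _ U]) auto
qed

end
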